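(* For integers $n\ge1$ and $k,l\ge0$ with $k+l<n$, $$\langle\mathrm{SF}(n,k,l),e_n\rangle=q^{\binom{n-k-l}{2}}\begin{bmatrix}n-1\\k+l\end{bmatrix}_q\begin{bmatrix}k+l\\k\end{bmatrix}_q,$$ where $\mathrm{SF}(n,k,l)=\Theta_{e_k}\Theta_{e_l}\widetilde H_{(n-k-l)}\big|_{t=0}$, $\langle\,,\rangle$ is the Hall scalar product and the brackets are $q$-binomial coefficients.
   Context: $\Lambda$ is the ring of symmetric functions in $x_1,x_2,\dots$ over $\mathbb Q(q,t)$. Square brackets after a symmetric function denote plethysm; $M=(1-q)(1-t)$, so $f[X/M]$ is obtained from $f$ by $p_r\mapsto p_r/((1-q^r)(1-t^r))$. The Hall scalar product is the bilinear form for which Schur functions are orthonormal. The modified Macdonald polynomials $\widetilde H_\mu$ ($\mu\vdash m$) form the basis of $\Lambda$ characterized by: $\widetilde H_\mu[X(1-q)]$ is in the span of $\{s_\lambda:\lambda\ge\mu\}$, $\widetilde H_\mu[X(1-t)]$ is in the span of $\{s_\lambda:\lambda\ge\mu'\}$ (dominance order), and $\langle\widetilde H_\mu,h_m\rangle=1$. For a cell $c$ of $\mu$ in row $i$ and column $j$ (both indexed from $0$, $0\le j<\mu_{i+1}$) set $\Pi_\mu=\prod_{c\ne(0,0)}(1-q^jt^i)$ ($\Pi_\varnothing=1$), and let $\mathbf\Pi$ be the linear operator on $\Lambda$ with $\mathbf\Pi\widetilde H_\mu=\Pi_\mu\widetilde H_\mu$. For $f$ homogeneous symmetric of degree $d$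 and $F$ homogeneous symmetric of degree $m$: $\Theta_fF=0$ if $m=0$ and $d\ge1$; $\Theta_fF=fF$ if $m=d=0$; $\Theta_fF=\mathbf\Pi\big(f[X/M]\cdot\mathbf\Pi^{-1}F\big)$ if $m\ge1$. $|_{t=0}$ means setting $t=0$ in the coefficients. *)

theory Defs
  imports
    "HOL-Library.Multiset"
    "HOL-Computational_Algebra.Polynomial"
    "HOL-Computational_Algebra.Fraction_Field"
    "Jordan_Normal_Form.Determinant"
begin

section \<open>The ring of symmetric functions\<close>

text \<open>
  A monomial in the variables \<open>x\<^sub>0, x\<^sub>1, \<dots>\<close> is the finite multiset of the indices of its variables, so
  that the product of monomials is the sum of multisets and the degree is the size. A symmetric
  function is a formal power series of bounded degree which is invariant under all permutations of
  the variables, given by its coefficients.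
\<close>

lemma finite_mset_splits: "finite {(a, b). a + b = (m :: 'a multiset)}"
proof -
  let ?S = "mset ` {xs. set xs \<subseteq> set_mset m \<and> length xs \<le> size m}"
  have "finite ?S"
    by (intro finite_imageI finite_lists_length_le) simp
  moreover have "{(a, b). a + b = m} \<subseteq> ?S \<times> ?S"
  proof (clarsimp, intro conjI)
    fix a b assume m: "m = a + b"
    obtain xs ys where "mset xs = a" "mset ys = b"
      using ex_mset by metis
    then show "a \<in> mset ` {xs. set xs \<subseteq> set_mset a \<union> set_mset b \<and> length xs \<le> size a + size b}"
      "b \<in> mset ` {xs. set xs \<subseteq> set_mset a \<union> set_mset b \<and> length xs \<le> size a + size b}"
      by (auto simp: image_iff intro: exI[of _ xs] exI[of _ ys])
  qed
  ultimately show ?thesis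
    by (meson finite_SigmaI finite_subset)
qed

typedef (overloaded) 'a symfun =
  "{f :: nat multiset \<Rightarrow> 'a :: zero.
      (\<forall>\<sigma> m. bij \<sigma> \<longrightarrow> f (image_mset \<sigma> m) = f m) \<and> (\<exists>d. \<forall>m. size m > d \<longrightarrow> f m = 0)}"
  morphisms coeff_sf Abs_symfun
  by (rule exI[of _ "\<lambda>_. 0"]) simp

setup_lifting type_definition_symfun

lemma symfun_eqI: "(\<And>m. coeff_sf f m = coeff_sf g m) \<Longrightarrow> f = g"
  by (simp add: coeff_sf_inject[symmetric] fun_eq_iff)

lemma splits_image_mset:
  fixes \<sigma> :: "'a \<Rightarrow> 'a"
  assumes "bij \<sigma>"
  shows "{(a, b). a + b = image_mset \<sigma> m}
       = (\<lambda>(a, b). (image_mset \<sigma> a, image_mset \<sigma> b)) ` {(a, b). a + b = m}"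
proof -
  obtain \<tau> :: "'a \<Rightarrow> 'a" where \<tau>: "\<tau> \<circ> \<sigma> = id" "\<sigma> \<circ> \<tau> = id"
    using assms by (metis bij_is_inj bij_is_surj inj_iff inv_o_cancel surj_iff)
  have *: "image_mset \<tau> (image_mset \<sigma> x) = x" "image_mset \<sigma> (image_mset \<tau> x) = x" for x
    using \<tau> by (simp_all add: image_mset.compositionality)
  show ?thesis
  proof (intro equalityI subsetI; clarsimp)
    fix a b assume ab: "a + b = image_mset \<sigma> m"
    have "image_mset \<tau> a + image_mset \<tau> b = m"
      using arg_cong[OF ab, of "image_mset \<tau>"] by (simp add: *)
    then show "(a, b) \<in> (\<lambda>(a, b). (image_mset \<sigma> a, image_mset \<sigma> b)) ` {(a, b). a + b = m}"
      by (intro image_eqI[of _ _ "(image_mset \<tau> a, image_mset \<tau> b)"]) (auto simp: *)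
  qed
qed

instantiation symfun :: (comm_ring_1) comm_ring_1
begin

lift_definition zero_symfun :: "'a symfun" is "\<lambda>_. 0"
  by simp

lift_definition one_symfun :: "'a symfun" is "\<lambda>m. if m = {#} then 1 else 0"
  by (auto intro: exI[of _ 0])

lift_definition plus_symfun :: "'a symfun \<Rightarrow> 'a symfun \<Rightarrow> 'a symfun" is "\<lambda>f g m. f m + g m"
proof -
  fix f g :: "nat multiset \<Rightarrow> 'a"
  assume f: "(\<forall>\<sigma> m. bij \<sigma> \<longrightarrow> f (image_mset \<sigma> m) = f m) \<and> (\<exists>d. \<forall>m. size m > d \<longrightarrow> f m = 0)"
    and g: "(\<forall>\<sigma> m. bij \<sigma> \<longrightarrow> g (image_mset \<sigma> m) = g m) \<and> (\<exists>d. \<forall>m. size m > d \<longrightarrow> g m = 0)"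
  obtain d e where "\<forall>m. size m > d \<longrightarrow> f m = 0" "\<forall>m. size m > e \<longrightarrow> g m = 0"
    using f g by blast
  then have "\<forall>m. size m > max d e \<longrightarrow> f m + g m = 0" by simp
  then show "(\<forall>\<sigma> m. bij \<sigma> \<longrightarrow> f (image_mset \<sigma> m) + g (image_mset \<sigma> m) = f m + g m) \<and>
    (\<exists>d. \<forall>m. size m > d \<longrightarrow> f m + g m = 0)"
    using f g by metis
qed

lift_definition uminus_symfun :: "'a symfun \<Rightarrow> 'a symfun" is "\<lambda>f m. - f m"
  by auto

definition minus_symfun :: "'a symfun \<Rightarrow> 'a symfun \<Rightarrow> 'a symfun" where
  "minus_symfun f g = f + - g"

lift_definition times_symfun :: "'a symfun \<Rightarrow> 'a symfun \<Rightarrow> 'a symfun" is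
  "\<lambda>f g m. \<Sum>(a, b) | a + b = m. f a * g b"
proof (intro conjI allI impI; (elim conjE exE)?)
  fix f g :: "nat multiset \<Rightarrow> 'a" and \<sigma> :: "nat \<Rightarrow> nat" and m
  assume \<sigma>: "bij \<sigma>" and f: "\<forall>\<sigma> m. bij \<sigma> \<longrightarrow> f (image_mset \<sigma> m) = f m"
    and g: "\<forall>\<sigma> m. bij \<sigma> \<longrightarrow> g (image_mset \<sigma> m) = g m"
  have inj: "inj (image_mset \<sigma>)"
    using \<sigma> by (simp add: bij_is_inj multiset.inj_map)
  have "inj_on (\<lambda>(a, b). (image_mset \<sigma> a, image_mset \<sigma> b)) {(a, b). a + b = m}"
    by (auto simp: inj_on_def dest: injD[OF inj])
  then show "(\<Sum>(a, b) | a + b = image_mset \<sigma> m. f a * g b) = (\<Sum>(a, b) | a + b = m. f a * g b)"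
    unfolding splits_image_mset[OF \<sigma>] using \<sigma> f g
    by (subst sum.reindex) (auto intro!: sum.cong)
next
  fix f g :: "nat multiset \<Rightarrow> 'a" and d e
  assume f: "\<forall>m. size m > d \<longrightarrow> f m = 0" and g: "\<forall>m. size m > e \<longrightarrow> g m = 0"
  show "\<exists>d. \<forall>m. size m > d \<longrightarrow> (\<Sum>(a, b) | a + b = m. f a * g b) = 0"
  proof (intro exI allI impI sum.neutral ballI)
    fix m :: "nat multiset" and p assume m: "size m > d + e" and "p \<in> {(a, b). a + b = m}"
    then obtain a b where p: "p = (a, b)" "a + b = m" by blast
    then have "size a > d \<or> size b > e" using m by auto
    then show "(case p of (a, b) \<Rightarrow> f a * g b) = 0" using f g p by auto
  qed
qed

instance
proof
  fix f g h :: "'a symfun"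
  show "f + g + h = f + (g + h)" "f + g = g + f" "0 + f = f" "- f + f = 0"
    by (transfer; simp add: algebra_simps)+
  show "f - g = f + - g" by (rule minus_symfun_def)
  show "f * g = g * f"
  proof (transfer, rule ext)
    fix f g :: "nat multiset \<Rightarrow> 'a" and m
    show "(\<Sum>(a, b) | a + b = m. f a * g b) = (\<Sum>(a, b) | a + b = m. g a * f b)"
      by (rule sum.reindex_bij_witness[of _ prod.swap prod.swap]) (auto simp: algebra_simps)
  qed
  show "1 * f = f"
  proof (transfer, rule ext)
    fix f :: "nat multiset \<Rightarrow> 'a" and m
    have "(\<Sum>(a, b) | a + b = m. (if a = {#} then 1 else 0) * f b)
        = (\<Sum>(a, b) \<in> {({#} :: nat multiset, m)}. (if a = {#} then 1 else 0) * f b)"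
      by (intro sum.mono_neutral_right finite_mset_splits) (auto split: if_splits)
    then show "(\<Sum>(a, b) | a + b = m. (if a = {#} then 1 else 0) * f b) = f m" by simp
  qed
  show "(f + g) * h = f * h + g * h"
    by transfer (auto simp: fun_eq_iff algebra_simps sum.distrib[symmetric] intro!: sum.cong)
  show "f * g * h = f * (g * h)"
  proof (transfer, rule ext)
    fix f g h :: "nat multiset \<Rightarrow> 'a" and m
    have "(\<Sum>(x, c) | x + c = m. (\<Sum>(a, b) | a + b = x. f a * g b) * h c)
        = (\<Sum>((x, c), (a, b)) \<in> Sigma {(x, c). x + c = m} (\<lambda>(x, c). {(a, b). a + b = x}).
            f a * g b * h c)"
      by (subst sum.Sigma[symmetric])
        (auto simp: finite_mset_splits[unfolded case_prod_unfold] sum_distrib_right case_prod_unfold intro!: sum.cong)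
    also have "\<dots> = (\<Sum>((a, y), (b, c)) \<in> Sigma {(a, y). a + y = m} (\<lambda>(a, y). {(b, c). b + c = y}).
            f a * (g b * h c))"
      by (rule sum.reindex_bij_witness[of _ "\<lambda>((a, y), (b, c)). ((a + b, c), (a, b))"
            "\<lambda>((x, c), (a, b)). ((a, b + c), (b, c))"])
        (auto simp: algebra_simps)
    also have "\<dots> = (\<Sum>(a, y) | a + y = m. f a * (\<Sum>(b, c) | b + c = y. g b * h c))"
      by (subst sum.Sigma[symmetric])
        (auto simp: finite_mset_splits[unfolded case_prod_unfold] sum_distrib_left case_prod_unfold intro!: sum.cong)
    finally show "(\<Sum>(x, c) | x + c = m. (\<Sum>(a, b) | a + b = x. f a * g b) * h c)
      = (\<Sum>(a, y) | a + y = m. f a * (\<Sum>(b, c) | b + c = y. g b * h c))" .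
  qed
  show "(0 :: 'a symfun) \<noteq> 1"
    by transfer (auto simp: fun_eq_iff)
qed

end

lift_definition scale_sf :: "'a :: comm_ring_1 \<Rightarrow> 'a symfun \<Rightarrow> 'a symfun" is "\<lambda>c f m. c * f m"
  by (metis mult_zero_right)

lemma vector_space_scale_sf: "vector_space (scale_sf :: 'a :: field \<Rightarrow> _)"
  by unfold_locales (transfer; simp add: algebra_simps)+

definition homogeneous_sf :: "nat \<Rightarrow> 'a :: zero symfun \<Rightarrow> bool" where
  "homogeneous_sf d f \<longleftrightarrow> (\<forall>m. coeff_sf f m \<noteq> 0 \<longrightarrow> size m = d)"

lift_definition esym :: "nat \<Rightarrow> 'a :: comm_ring_1 symfun" is
  "\<lambda>n m. if size m = n \<and> (\<forall>i. count m i \<le> 1) then 1 else 0"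
proof (intro conjI allI impI)
  fix n m and \<sigma> :: "nat \<Rightarrow> nat" assume \<sigma>: "bij \<sigma>"
  have "(\<forall>i. count (image_mset \<sigma> m) i \<le> 1) \<longleftrightarrow> (\<forall>i. count (image_mset \<sigma> m) (\<sigma> i) \<le> 1)"
    using \<sigma> by (metis bij_pointE)
  also have "\<dots> \<longleftrightarrow> (\<forall>i. count m i \<le> 1)"
  proof -
    have "count (image_mset \<sigma> m) (\<sigma> i) = count m i" for i
      using bij_is_inj[OF \<sigma>] by (induction m) (auto dest: injD)
    then show ?thesis by simp
  qed
  finally show "(if size (image_mset \<sigma> m) = n \<and> (\<forall>i. count (image_mset \<sigma> m) i \<le> 1) then 1 else 0)
      = (if size m = n \<and> (\<forall>i. count m i \<le> 1) then 1 else (0 :: 'a))"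
    by simp
next
  fix n
  show "\<exists>d. \<forall>m. size m > d \<longrightarrow> (if size m = n \<and> (\<forall>i. count m i \<le> 1) then 1 else (0 :: 'a)) = 0"
    by (rule exI[of _ n]) simp
qed

lift_definition hsym :: "nat \<Rightarrow> 'a :: comm_ring_1 symfun" is
  "\<lambda>n m. if size m = n then 1 else 0"
  by auto

text \<open>The coefficients of \<open>p\<^sub>r = x\<^sub>0\<^sup>r + x\<^sub>1\<^sup>r + \<dots>\<close>. Only \<open>r \<ge> 1\<close> is used.\<close>

lift_definition psym :: "nat \<Rightarrow> 'a :: comm_ring_1 symfun" is
  "\<lambda>r m. if \<exists>i. m = replicate_mset r i then 1 else 0"
proof (intro conjI allI impI)
  fix r m and \<sigma> :: "nat \<Rightarrow> nat" assume \<sigma>: "bij \<sigma>"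
  have "inj (image_mset \<sigma>)"
    using \<sigma> by (simp add: bij_is_inj multiset.inj_map)
  then have "image_mset \<sigma> m = replicate_mset r (\<sigma> i) \<longleftrightarrow> m = replicate_mset r i" for i
    by (metis image_replicate_mset injD)
  then have "(\<exists>i. image_mset \<sigma> m = replicate_mset r i) \<longleftrightarrow> (\<exists>i. m = replicate_mset r i)"
    using \<sigma> by (metis bij_pointE)
  then show "(if \<exists>i. image_mset \<sigma> m = replicate_mset r i then 1 else 0)
      = (if \<exists>i. m = replicate_mset r i then 1 else (0 :: 'a))"
    by simp
next
  fix r
  show "\<exists>d. \<forall>m. size m > d \<longrightarrow> (if \<exists>i::nat. m = replicate_mset r i then 1 else (0 :: 'a)) = 0"
    by (rule exI[of _ r]) auto
qed


section \<open>Partitions, Schur functions and the Hall scalar product\<close>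

text \<open>Partitions are weakly decreasing lists of positive integers.\<close>

definition is_partition :: "nat list \<Rightarrow> bool" where
  "is_partition \<mu> \<longleftrightarrow> sorted_wrt (\<ge>) \<mu> \<and> 0 \<notin> set \<mu>"

fun conj_partition :: "nat list \<Rightarrow> nat list" where
  "conj_partition [] = []"
| "conj_partition (p # \<mu>) = map (\<lambda>j. length (filter (\<lambda>x. j < x) (p # \<mu>))) [0..<p]"

definition dominates :: "nat list \<Rightarrow> nat list \<Rightarrow> bool" where
  "dominates \<nu> \<mu> \<longleftrightarrow> sum_list \<nu> = sum_list \<mu> \<and>
     (\<forall>k. sum_list (take k \<mu>) \<le> sum_list (take k \<nu>))"

text \<open>The determinant of \<open>h\<close> with index \<open>\<mu>\<^sub>i - i + j\<close>, where \<open>h\<close> of a negative index is zero.\<close>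

definition schur :: "nat list \<Rightarrow> 'a :: comm_ring_1 symfun" where
  "schur \<mu> = det (mat (length \<mu>) (length \<mu>)
     (\<lambda>(i, j). if i \<le> \<mu> ! i + j then hsym (\<mu> ! i + j - i) else 0))"

definition is_hall_product :: "('a :: field symfun \<Rightarrow> 'a symfun \<Rightarrow> 'a) \<Rightarrow> bool" where
  "is_hall_product B \<longleftrightarrow>
     (\<forall>f. Vector_Spaces.linear scale_sf (*) (B f)) \<and>
     (\<forall>g. Vector_Spaces.linear scale_sf (*) (\<lambda>f. B f g)) \<and>
     (\<forall>\<nu> \<mu>. is_partition \<nu> \<longrightarrow> is_partition \<mu> \<longrightarrow>
        B (schur \<nu>) (schur \<mu>) = (if \<nu> = \<mu> then 1 else 0))"

definition hall :: "'a :: field symfun \<Rightarrow> 'a symfun \<Rightarrow> 'a" where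
  "hall = (THE B. is_hall_product B)"


section \<open>Plethystic substitutions and the base field\<close>

text \<open>
  The substitution \<open>p\<^sub>r \<mapsto> c\<^sub>r p\<^sub>r\<close> (for \<open>r \<ge> 1\<close>), extended to a homomorphism of algebras.
  It is uniquely determined over a field of characteristic zero.
\<close>

definition is_psym_scaling :: "(nat \<Rightarrow> 'a :: field) \<Rightarrow> ('a symfun \<Rightarrow> 'a symfun) \<Rightarrow> bool" where
  "is_psym_scaling c \<phi> \<longleftrightarrow> Vector_Spaces.linear scale_sf scale_sf \<phi> \<and> \<phi> 1 = 1 \<and>
     (\<forall>f g. \<phi> (f * g) = \<phi> f * \<phi> g) \<and> (\<forall>r\<ge>1. \<phi> (psym r) = scale_sf (c r) (psym r))"

definition psym_scaling :: "(nat \<Rightarrow> 'a :: field) \<Rightarrow> 'a symfun \<Rightarrow> 'a symfun" where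
  "psym_scaling c = (THE \<phi>. is_psym_scaling c \<phi>)"

text \<open>The field of rational functions in \<open>q\<close> and \<open>t\<close>, as the rational functions in \<open>t\<close> over those in \<open>q\<close>.\<close>

type_synonym ratfun_q = "rat poly fract"
type_synonym ratfun_qt = "ratfun_q poly fract"

definition q_var :: ratfun_q where "q_var = Fract [:0, 1:] 1"

definition qq :: ratfun_qt where "qq = Fract [:q_var:] 1"

definition tt :: ratfun_qt where "tt = Fract [:0, 1:] 1"

text \<open>The value at \<open>t = 0\<close>; unspecified if there is a pole.\<close>

definition eval_t0 :: "'a :: field poly fract \<Rightarrow> 'a" where
  "eval_t0 x = (THE v. \<exists>a b. poly b 0 \<noteq> 0 \<and> x = Fract a b \<and> v = poly a 0 / poly b 0)"

lemma eval_t0_Fract: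
  assumes "poly b 0 \<noteq> 0"
  shows "eval_t0 (Fract a b) = poly a 0 / poly b 0"
  unfolding eval_t0_def
proof (rule the_equality)
  fix v assume "\<exists>a' b'. poly b' 0 \<noteq> 0 \<and> Fract a b = Fract a' b' \<and> v = poly a' 0 / poly b' 0"
  then obtain a' b' where *: "poly b' 0 \<noteq> 0" "Fract a b = Fract a' b'" "v = poly a' 0 / poly b' 0"
    by blast
  have "b \<noteq> 0" "b' \<noteq> 0" using assms *(1) by auto
  then have "a * b' = a' * b" using *(2) by (simp add: eq_fract)
  then have "poly a 0 * poly b' 0 = poly a' 0 * poly b 0" by (metis poly_mult)
  then show "v = poly a 0 / poly b 0" using assms *(1,3) by (simp add: frac_eq_eq)
qed (use assms in blast)

lift_definition eval_t0_sf :: "'a :: field poly fract symfun \<Rightarrow> 'a symfun" is "\<lambda>f m. eval_t0 (f m)"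
proof -
  have "eval_t0 (0 :: 'a poly fract) = 0"
    using eval_t0_Fract[of 1 "0 :: 'a poly"] by (simp add: Zero_fract_def)
  then show "(\<forall>\<sigma> m. bij \<sigma> \<longrightarrow> eval_t0 (f (image_mset \<sigma> m)) = eval_t0 (f m)) \<and>
      (\<exists>d. \<forall>m. size m > d \<longrightarrow> eval_t0 (f m) = 0)"
    if "(\<forall>\<sigma> m. bij \<sigma> \<longrightarrow> f (image_mset \<sigma> m) = f m) \<and> (\<exists>d. \<forall>m. size m > d \<longrightarrow> f m = 0)"
    for f :: "nat multiset \<Rightarrow> 'a poly fract"
    using that by metis
qed


section \<open>Modified Macdonald polynomials and Theta operators\<close>

definition is_modified_macdonald :: "nat list \<Rightarrow> ratfun_qt symfun \<Rightarrow> bool" where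
  "is_modified_macdonald \<mu> F \<longleftrightarrow>
     psym_scaling (\<lambda>r. 1 - qq ^ r) F
       \<in> module.span scale_sf (schur ` {\<nu>. is_partition \<nu> \<and> dominates \<nu> \<mu>}) \<and>
     psym_scaling (\<lambda>r. 1 - tt ^ r) F
       \<in> module.span scale_sf (schur ` {\<nu>. is_partition \<nu> \<and> dominates \<nu> (conj_partition \<mu>)}) \<and>
     hall F (hsym (sum_list \<mu>)) = 1"

definition macdonald_H :: "nat list \<Rightarrow> ratfun_qt symfun" where
  "macdonald_H \<mu> = (THE F. is_modified_macdonald \<mu> F)"

definition cells :: "nat list \<Rightarrow> (nat \<times> nat) set" where
  "cells \<mu> = {(i, j). i < length \<mu> \<and> j < \<mu> ! i}"

definition Pi_coeff :: "nat list \<Rightarrow> ratfun_qt" where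
  "Pi_coeff \<mu> = (\<Prod>(i, j) \<in> cells \<mu> - {(0, 0)}. 1 - qq ^ j * tt ^ i)"

definition Pi_op :: "ratfun_qt symfun \<Rightarrow> ratfun_qt symfun" where
  "Pi_op = (THE L. Vector_Spaces.linear scale_sf scale_sf L \<and>
     (\<forall>\<mu>. is_partition \<mu> \<longrightarrow> L (macdonald_H \<mu>) = scale_sf (Pi_coeff \<mu>) (macdonald_H \<mu>)))"

text \<open>
  Meaningful for homogeneous \<open>f\<close> and \<open>F\<close>. For \<open>f = 0\<close> or \<open>F = 0\<close>, which are homogeneous of
  every degree, all branches give zero.
\<close>

definition Theta :: "ratfun_qt symfun \<Rightarrow> ratfun_qt symfun \<Rightarrow> ratfun_qt symfun" where
  "Theta f F =
     (if homogeneous_sf 0 F then (if homogeneous_sf 0 f then f * F else 0)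
      else Pi_op (psym_scaling (\<lambda>r. 1 / ((1 - qq ^ r) * (1 - tt ^ r))) f * inv_into UNIV Pi_op F))"

text \<open>Used for \<open>k + l < n\<close> only, so that \<open>[n - k - l]\<close> is the partition with a single part.\<close>

definition SF :: "nat \<Rightarrow> nat \<Rightarrow> nat \<Rightarrow> ratfun_q symfun" where
  "SF n k l = eval_t0_sf (Theta (esym k) (Theta (esym l) (macdonald_H [n - k - l])))"


section \<open>Gaussian binomial coefficients\<close>

definition q_fact :: "'a :: field \<Rightarrow> nat \<Rightarrow> 'a" where
  "q_fact q n = (\<Prod>m = 1..n. \<Sum>i<m. q ^ i)"

definition q_binomial :: "'a :: field \<Rightarrow> nat \<Rightarrow> nat \<Rightarrow> 'a" where
  "q_binomial q n k = (if k \<le> n then q_fact q n / (q_fact q k * q_fact q (n - k)) else 0)"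

end

theory Submission
  imports
    Defs
    "HOL-Combinatorics.Permutations"
    "HOL-Computational_Algebra.Formal_Power_Series"
    "HOL-Computational_Algebra.Polynomial_Factorial"
begin

text \<open>
  The operator \<open>D\<^sub>0\<close> of Garsia and Haiman, \<open>F \<mapsto> \<Sum>\<^sub>k (-1)\<^sup>k e\<^sub>k [w\<^sup>k] F[X + M w]\<close>, is symmetric in \<open>q\<close> and
  \<open>t\<close>. After the substitution \<open>X \<mapsto> X (1 - q)\<close> it is triangular on the products \<open>h\<^sub>\<mu>\<close> for the dominance
  order, with distinct eigenvalues \<open>1 - M \<Sum> q\<^sup>j t\<^sup>i\<close>, summed over the cells of \<open>\<mu>\<close>. Exchanging \<open>q\<close> and
  \<open>t\<close> conjugates the partition in the eigenvalue, so the eigenfunctions of \<open>D\<^sub>0\<close> satisfy both triangularity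
  conditions and are the Macdonald polynomials up to normalization. The triangular coefficients are
  regular at \<open>t = 0\<close> and vanish at \<open>t = 1\<close>; setting \<open>t = 1\<close> shows that the normalization is possible.

  The pairing with \<open>e\<^sub>n\<close> is the ring homomorphism \<open>\<psi>\<close> with \<open>p\<^sub>r \<mapsto> (-1)\<^bsup>r-1\<^esup>\<close>. At \<open>t = 0\<close> it satisfies
  \<open>\<psi> (D\<^sub>0 F) = q\<^sup>n \<psi> F\<close>, whereas the eigenvalue of \<open>\<mu>\<close> becomes \<open>q\<close> to the power of the largest part. So
  \<open>\<psi>\<close> annihilates at \<open>t = 0\<close> all eigenfunctions but that of the one-row partition, and the operator with eigenvalues
  \<open>\<Pi>\<^sub>\<mu>\<close> acts under \<open>\<psi>\<close> as multiplication by \<open>(1 - q) \<cdots> (1 - q\<^bsup>n-1\<^esup>)\<close>. Since the inner operators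
  cancel in \<open>\<Theta>\<^sub>f \<Theta>\<^sub>g\<close> and \<open>\<psi>\<close> is multiplicative, the coefficient is a product of explicit factors.
\<close>

section \<open>Bases and triangularity\<close>

text \<open>The objects \<open>hall\<close>, \<open>psym_scaling\<close>, \<open>macdonald_H\<close>
  and \<open>Pi_op\<close> are definite descriptions, so existence and uniqueness must precede any
  use of their values. For \<open>macdonald_H\<close>, uniqueness rests on the simple spectrum and
  on conjugation reversing dominance. The obstacle is division by differences of eigenvalues, which
  all vanish at t = 1 and often at t = 0. Such a difference is (1-t) t^p U with U nonzero at 0 and
  1, where p is the first row in which the partitions differ. An error term with factor (1-t)^2 t^r
  leads to a partition with a larger sum of the first r+1 rows, so p \<le> r. The quotient stays
  regular at 0 and keeps one zero at t = 1. The factor q^n in \<psi>(D_0 F) arises since \<psi>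
  sends (-1)^k e_k to (-1)^k: \<psi> D_0 is evaluation at w = -1, again a homomorphism, with p_r
  going to (-1)^(r-1) (1 - (1-q^r)(1-t^r)). The explicit factors at the end are (q;q)_(n-1) from the
  operator, 1/(q;q)_k and 1/(q;q)_l from e_k[X/M] and e_l[X/M], and, for m = n-k-l,
  q^binom(m,2)/(q;q)_(m-1) from (1-q^m) h_m[X/(1-q)], the preimage of the one-row
  polynomial.\<close>

inductive_set additive_span :: "'b :: comm_monoid_add set \<Rightarrow> 'b set" for G where
  zero: "0 \<in> additive_span G"
| add: "x \<in> G \<Longrightarrow> y \<in> additive_span G \<Longrightarrow> x + y \<in> additive_span G"

lemma additive_span_base: "x \<in> G \<Longrightarrow> x \<in> additive_span G"
  using additive_span.add[OF _ additive_span.zero] by simp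

lemma additive_span_plus:
  "x \<in> additive_span G \<Longrightarrow> y \<in> additive_span G \<Longrightarrow> x + y \<in> additive_span G"
  by (induction x rule: additive_span.induct) (auto simp: add.assoc intro: additive_span.add)

lemma additive_span_image:
  assumes "\<And>x y. f (x + y) = f x + f y" "f 0 = 0" "\<And>x. x \<in> G \<Longrightarrow> f x \<in> additive_span H"
    and "x \<in> additive_span G"
  shows "f x \<in> additive_span H"
  using assms(4) by induction (auto simp: assms intro: additive_span.zero additive_span_plus)

lemma additive_span_mono:
  assumes "\<And>x. x \<in> G \<Longrightarrow> x \<in> additive_span H" and "x \<in> additive_span G"
  shows "x \<in> additive_span H"
  using additive_span_image[of "\<lambda>x. x" G H x] assms by simp

lemma additive_span_sum:
  "(\<And>i. i \<in> I \<Longrightarrow> f i \<in> additive_span G) \<Longrightarrow> sum f I \<in> additive_span G"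
  by (induction I rule: infinite_finite_induct)
    (auto intro: additive_span.zero additive_span_plus)

section \<open>Coordinates with respect to indexed bases\<close>

interpretation sf: vector_space "scale_sf :: 'a :: field \<Rightarrow> 'a symfun \<Rightarrow> 'a symfun"
  by (rule vector_space_scale_sf)

text \<open>Indexing by a fixed set, here the partitions, lets different bases be compared entry by
  entry; injectivity makes the coordinate a function of the index.\<close>

definition basis_family :: "'i set \<Rightarrow> ('i \<Rightarrow> 'a :: field symfun) \<Rightarrow> bool" where
  "basis_family I b \<longleftrightarrow> inj_on b I \<and> sf.independent (b ` I) \<and> sf.span (b ` I) = UNIV"

definition coordinate :: "'i set \<Rightarrow> ('i \<Rightarrow> 'a :: field symfun) \<Rightarrow> 'a symfun \<Rightarrow> 'i \<Rightarrow> 'a" where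
  "coordinate I b x i = (if i \<in> I then sf.representation (b ` I) x (b i) else 0)"

context
  fixes I :: "'i set" and b :: "'i \<Rightarrow> 'a :: field symfun"
  assumes b: "basis_family I b"
begin

lemma coordinate_add: "coordinate I b (x + y) i = coordinate I b x i + coordinate I b y i"
  using b by (simp add: coordinate_def basis_family_def sf.representation_add)

lemma coordinate_scale: "coordinate I b (scale_sf c x) i = c * coordinate I b x i"
  using b by (simp add: coordinate_def basis_family_def sf.representation_scale)

lemma coordinate_zero: "coordinate I b 0 i = 0"
  by (simp add: coordinate_def sf.representation_zero)

lemma coordinate_sum: "coordinate I b (sum f J) i = (\<Sum>j\<in>J. coordinate I b (f j) i)"
  by (induction J rule: infinite_finite_induct) (auto simp: coordinate_zero coordinate_add)

lemma coordinate_basis: "j \<in> I \<Longrightarrow> coordinate I b (b j) i = (if i = j then 1 else 0)"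
  using b by (auto simp: coordinate_def basis_family_def sf.representation_basis dest: inj_onD)

lemma finite_coordinate: "finite {i. coordinate I b x i \<noteq> 0}"
proof -
  have "finite {v. sf.representation (b ` I) x v \<noteq> 0}" by (rule sf.finite_representation)
  moreover have "b ` {i. coordinate I b x i \<noteq> 0} \<subseteq> {v. sf.representation (b ` I) x v \<noteq> 0}"
    by (auto simp: coordinate_def split: if_splits)
  moreover have "inj_on b {i. coordinate I b x i \<noteq> 0}"
    using b by (auto simp: coordinate_def basis_family_def inj_on_def split: if_splits)
  ultimately show ?thesis by (meson finite_imageD finite_subset)
qed

lemma coordinate_in: "coordinate I b x i \<noteq> 0 \<Longrightarrow> i \<in> I"
  by (simp add: coordinate_def split: if_splits)

lemma coordinate_expand: "x = (\<Sum>i | coordinate I b x i \<noteq> 0. scale_sf (coordinate I b x i) (b i))"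
proof -
  have "x = (\<Sum>v | sf.representation (b ` I) x v \<noteq> 0. scale_sf (sf.representation (b ` I) x v) v)"
    using b by (simp add: basis_family_def sf.sum_nonzero_representation_eq)
  also have "\<dots> = (\<Sum>v \<in> b ` {i. coordinate I b x i \<noteq> 0}. scale_sf (sf.representation (b ` I) x v) v)"
  proof (rule sum.cong)
    show "{v. sf.representation (b ` I) x v \<noteq> 0} = b ` {i. coordinate I b x i \<noteq> 0}"
      by (auto simp: coordinate_def dest: sf.representation_ne_zero split: if_splits)
  qed simp
  also have "\<dots> = (\<Sum>i | coordinate I b x i \<noteq> 0. scale_sf (coordinate I b x i) (b i))"
    using b by (subst sum.reindex)
      (auto simp: coordinate_def basis_family_def inj_on_def split: if_splits intro!: sum.cong)
  finally show ?thesis .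
qed

lemma coordinate_span:
  assumes "x \<in> sf.span (b ` J)" "J \<subseteq> I" "i \<notin> J"
  shows "coordinate I b x i = 0"
  using assms(1)
proof (induction rule: sf.span_induct_alt)
  case (step c v y)
  then obtain j where j: "j \<in> J" "v = b j" by auto
  then have "coordinate I b v i = 0" using assms(2,3) coordinate_basis[of j i] by auto
  then show ?case using step.IH by (simp add: coordinate_add coordinate_scale)
qed (simp add: coordinate_zero)

end

lemma basis_familyI:
  assumes "sf.span (b ` I) = UNIV"
    and "\<And>J x i. finite J \<Longrightarrow> J \<subseteq> I \<Longrightarrow> (\<Sum>j\<in>J. scale_sf (x j) (b j)) = 0 \<Longrightarrow> i \<in> J \<Longrightarrow> x i = 0"
  shows "basis_family I b"
  unfolding basis_family_def
proof (intro conjI assms(1))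
  show inj: "inj_on b I"
  proof (rule inj_onI, rule ccontr)
    fix i j assume ij: "i \<in> I" "j \<in> I" "b i = b j" "i \<noteq> j"
    \<comment> \<open>Equal vectors at two indices would give a relation with coefficients 1 and
      -1.\<close>
    have "(\<Sum>k\<in>{i, j}. scale_sf (if k = i then 1 else -1) (b k)) = 0" using ij by simp
    from assms(2)[OF _ _ this, of i] ij show False by simp
  qed
  show "sf.independent (b ` I)"
    unfolding sf.independent_explicit_finite_subsets
  proof (intro allI impI ballI)
    fix A x v assume A: "A \<subseteq> b ` I" "finite A" "(\<Sum>v\<in>A. scale_sf (x v) v) = 0" "v \<in> A"
    from A(1) obtain J where J: "J \<subseteq> I" "A = b ` J" by (meson subset_imageE)
    have injJ: "inj_on b J" using inj J(1) inj_on_subset by blast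
    then have "finite J" using A(2) J(2) by (simp add: finite_image_iff)
    moreover have "(\<Sum>j\<in>J. scale_sf (x (b j)) (b j)) = 0"
      using A(3) unfolding J(2) by (simp add: sum.reindex[OF injJ])
    ultimately show "x v = 0"
      using assms(2)[of J "\<lambda>j. x (b j)"] J A(4) by auto
  qed
qed

text \<open>\<open>R i j\<close> says that \<open>j\<close> may occur in the error of
  \<open>i\<close>. Finiteness of the sets above \<open>i\<close> drives the induction that solves
  for \<open>b i\<close> in terms of \<open>f\<close>. Equality of the spans over upper sets is what
  later identifies the flags of Schur functions with those of other triangular families.\<close>

lemma triangular_basis:
  assumes b: "basis_family I b"
    and irrefl: "\<And>i. \<not> R i i" and trans: "\<And>i j k. R i j \<Longrightarrow> R j k \<Longrightarrow> R i k"
    and fin: "\<And>i. i \<in> I \<Longrightarrow> finite {j \<in> I. R i j}"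
    and c: "\<And>i. i \<in> I \<Longrightarrow> c i \<noteq> 0"
    and f: "\<And>i. i \<in> I \<Longrightarrow> f i - scale_sf (c i) (b i) \<in> sf.span (b ` {j \<in> I. R i j})"
  shows "basis_family I f"
    and "\<And>i. i \<in> I \<Longrightarrow> sf.span (f ` {j \<in> I. j = i \<or> R i j}) = sf.span (b ` {j \<in> I. j = i \<or> R i j})"
proof -
  define U where "U i = {j \<in> I. j = i \<or> R i j}" for i
  have U: "U j \<subseteq> U i" if "j \<in> U i" for i j using that unfolding U_def by (auto intro: trans)
  have fb: "f i \<in> sf.span (b ` U i)" if "i \<in> I" for i
  proof -
    have "f i = scale_sf (c i) (b i) + (f i - scale_sf (c i) (b i))" by simp
    moreover have "f i - scale_sf (c i) (b i) \<in> sf.span (b ` U i)"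
      using f[OF that] sf.span_mono[of "b ` {j \<in> I. R i j}" "b ` U i"] by (auto simp: U_def)
    moreover have "scale_sf (c i) (b i) \<in> sf.span (b ` U i)"
      using that by (intro sf.span_scale sf.span_base imageI) (simp add: U_def)
    ultimately show ?thesis by (subst \<open>f i = _\<close>) (rule sf.span_add)
  qed
  have bf: "b i \<in> sf.span (f ` U i)" if "i \<in> I" for i
    using that
  proof (induction "card {j \<in> I. R i j}" arbitrary: i rule: less_induct)
    case less
    have "b ` {j \<in> I. R i j} \<subseteq> sf.span (f ` U i)"
    proof clarify
      fix j assume j: "j \<in> I" "R i j"
      have "{k \<in> I. R j k} \<subseteq> {k \<in> I. R i k}" using j by (auto intro: trans)
      moreover have "j \<in> {k \<in> I. R i k}" "j \<notin> {k \<in> I. R j k}" using j irrefl by auto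
      ultimately have "{k \<in> I. R j k} \<subset> {k \<in> I. R i k}" by blast
      then have "b j \<in> sf.span (f ` U j)" using less.hyps[of j] j fin[OF less.prems] by (simp add: psubset_card_mono)
      moreover have "U j \<subseteq> U i" using j by (intro U) (simp add: U_def)
      ultimately show "b j \<in> sf.span (f ` U i)" using sf.span_mono[OF image_mono, of "U j" "U i" f] by blast
    qed
    then have "f i - scale_sf (c i) (b i) \<in> sf.span (f ` U i)"
      using f[OF less.prems] sf.span_minimal[OF _ sf.subspace_span, of "b ` {j \<in> I. R i j}" "f ` U i"] by auto
    moreover have fi: "f i \<in> sf.span (f ` U i)" using less.prems by (auto simp: U_def intro: sf.span_base)
    ultimately have "f i - (f i - scale_sf (c i) (b i)) \<in> sf.span (f ` U i)" by (rule sf.span_diff[rotated])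
    then have "scale_sf (c i) (b i) \<in> sf.span (f ` U i)" by (simp only: diff_diff_eq2 add_diff_cancel_left')
    then have "scale_sf (inverse (c i)) (scale_sf (c i) (b i)) \<in> sf.span (f ` U i)" by (rule sf.span_scale)
    then show ?case using c[OF less.prems] by simp
  qed
  show "sf.span (f ` {j \<in> I. j = i \<or> R i j}) = sf.span (b ` {j \<in> I. j = i \<or> R i j})" if "i \<in> I" for i
    unfolding U_def[symmetric]
  proof (intro subset_antisym sf.span_minimal sf.subspace_span; clarify)
    fix j assume j: "j \<in> U i"
    then have "j \<in> I" by (simp add: U_def)
    then show "f j \<in> sf.span (b ` U i)" "b j \<in> sf.span (f ` U i)"
      using fb[of j] bf[of j] sf.span_mono[OF image_mono[OF U[OF j]], of b] sf.span_mono[OF image_mono[OF U[OF j]], of f]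
      by auto
  qed
  show "basis_family I f"
  proof (rule basis_familyI)
    have "b ` I \<subseteq> sf.span (f ` I)"
    proof clarify
      fix i assume "i \<in> I"
      then show "b i \<in> sf.span (f ` I)" using bf[of i] sf.span_mono[of "f ` U i" "f ` I"] by (auto simp: U_def)
    qed
    then have "sf.span (b ` I) \<subseteq> sf.span (f ` I)" by (intro sf.span_minimal sf.subspace_span)
    then show "sf.span (f ` I) = UNIV" using b by (auto simp: basis_family_def)
    fix J x i assume J: "finite J" "J \<subseteq> I" "(\<Sum>j\<in>J. scale_sf (x j) (f j)) = 0" "i \<in> J"
    show "x i = 0"
    proof (rule ccontr)
      assume "x i \<noteq> 0"
      then have "{j \<in> J. x j \<noteq> 0} \<noteq> {}" using J by auto
      \<comment> \<open>If \<open>m\<close> is not an error index of another index in use, the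
        \<open>b m\<close> coordinate of the relation comes from \<open>f m\<close> alone and equals
        \<open>x m * c m\<close>.\<close>
      then obtain m where m: "m \<in> J" "x m \<noteq> 0" "\<And>j. j \<in> J \<Longrightarrow> x j \<noteq> 0 \<Longrightarrow> j \<noteq> m \<Longrightarrow> \<not> R j m"
      proof -
        have "asymp_on {j \<in> J. x j \<noteq> 0} R"
          by (rule asymp_onI) (metis irrefl trans)
        moreover have "transp_on {j \<in> J. x j \<noteq> 0} R"
          by (rule transp_onI) (rule trans)
        moreover have "finite {j \<in> J. x j \<noteq> 0}" using J(1) by simp
        ultimately have "\<exists>m\<in>{j \<in> J. x j \<noteq> 0}. \<forall>j\<in>{j \<in> J. x j \<noteq> 0}. j \<noteq> m \<longrightarrow> \<not> R j m"
          using \<open>{j \<in> J. x j \<noteq> 0} \<noteq> {}\<close> by (intro Finite_Set.bex_min_element)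
        then show ?thesis using that by blast
      qed
      have mI: "m \<in> I" using m J by auto
      have off: "coordinate I b (f j) m = 0" if "j \<in> J" "x j \<noteq> 0" "j \<noteq> m" for j
        using coordinate_span[OF b fb[of j], of m] that m(3)[OF that] J(2) by (auto simp: U_def)
      have "coordinate I b (f m - scale_sf (c m) (b m)) m = 0"
        by (rule coordinate_span[OF b f[OF mI]]) (auto simp: irrefl)
      then have "coordinate I b (f m) m = c m"
        using coordinate_add[OF b, of "f m - scale_sf (c m) (b m)" "scale_sf (c m) (b m)" m] mI
        by (simp add: coordinate_scale[OF b] coordinate_basis[OF b])
      moreover have "coordinate I b (\<Sum>j\<in>J. scale_sf (x j) (f j)) m = (\<Sum>j\<in>{m}. x j * coordinate I b (f j) m)"
        unfolding coordinate_sum[OF b] coordinate_scale[OF b]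
        using J(1) m(1) off by (intro sum.mono_neutral_right) auto
      ultimately show False using J(3) c[OF mI] m(2) by (simp add: coordinate_zero[OF b])
    qed
  qed
qed

section \<open>Monomial and power sum bases\<close>

abbreviation partitions :: "nat list set" where
  "partitions \<equiv> {\<mu>. is_partition \<mu>}"

text \<open>Determinants and straightening produce unsorted compositions, possibly with zeros.
  Sorting them and dropping the zeros does not change a product of \<open>hsym\<close>, because
  \<open>hsym 0 = 1\<close>.\<close>

definition partition_of :: "nat list \<Rightarrow> nat list" where
  "partition_of \<alpha> = rev (sort (filter (\<lambda>x. x \<noteq> 0) \<alpha>))"

lemma is_partition_partition_of: "is_partition (partition_of \<alpha>)"
  by (simp add: is_partition_def partition_of_def sorted_wrt_rev)

lemma mset_partition_of: "mset (partition_of \<alpha>) = filter_mset (\<lambda>x. x \<noteq> 0) (mset \<alpha>)"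
  by (simp add: partition_of_def)

lemma sum_list_partition_of: "sum_list (partition_of \<alpha>) = sum_list \<alpha>"
proof -
  have "sum_list (partition_of \<alpha>) = sum_mset (filter_mset (\<lambda>x. x \<noteq> 0) (mset \<alpha>))"
    by (metis mset_partition_of sum_mset_sum_list)
  also have "\<dots> = sum_list \<alpha>" by (induction \<alpha>) auto
  finally show ?thesis .
qed

lemma prod_list_partition_of:
  fixes h :: "nat \<Rightarrow> 'a :: comm_monoid_mult"
  assumes "h 0 = 1"
  shows "prod_list (map h (partition_of \<alpha>)) = prod_list (map h \<alpha>)"
proof -
  have "prod_list (map h (partition_of \<alpha>)) = prod_mset (image_mset h (filter_mset (\<lambda>x. x \<noteq> 0) (mset \<alpha>)))"
    by (metis mset_map mset_partition_of prod_mset_prod_list)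
  also have "\<dots> = prod_list (map h \<alpha>)" by (induction \<alpha>) (auto simp: assms)
  finally show ?thesis .
qed

lemma partition_eqI: "is_partition \<mu> \<Longrightarrow> is_partition \<nu> \<Longrightarrow> mset \<mu> = mset \<nu> \<Longrightarrow> \<mu> = \<nu>"
proof -
  assume *: "is_partition \<mu>" "is_partition \<nu>" "mset \<mu> = mset \<nu>"
  have "sorted (rev \<mu>)" "sorted (rev \<nu>)"
    using * by (auto simp: is_partition_def sorted_wrt_rev)
  then have "rev \<mu> = rev \<nu>" using * by (metis mset_rev properties_for_sort)
  then show ?thesis by simp
qed

lemma partition_of_partition:
  assumes "is_partition \<mu>"
  shows "partition_of \<mu> = \<mu>"
proof (rule partition_eqI[OF is_partition_partition_of assms])
  have "\<forall>x \<in> set \<mu>. x \<noteq> 0" using assms by (auto simp: is_partition_def intro!: gr0I)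
  then have "filter (\<lambda>x. x \<noteq> 0) \<mu> = \<mu>" by (rule filter_True)
  then show "mset (partition_of \<mu>) = mset \<mu>" by (simp add: partition_of_def)
qed

lemma length_partition_le: "0 \<notin> set \<mu> \<Longrightarrow> length \<mu> \<le> sum_list \<mu>"
  by (induction \<mu>) auto

lemma finite_partitions_le: "finite {\<mu>. is_partition \<mu> \<and> sum_list \<mu> \<le> d}"
proof (rule finite_subset)
  show "{\<mu>. is_partition \<mu> \<and> sum_list \<mu> \<le> d} \<subseteq> {xs. set xs \<subseteq> {..d} \<and> length xs \<le> d}"
    using length_partition_le by (fastforce simp: is_partition_def dest: member_le_sum_list)
qed (simp add: finite_lists_length_le)

definition exponents :: "nat multiset \<Rightarrow> nat multiset" where
  "exponents m = image_mset (count m) (mset_set (set_mset m))"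

definition shape :: "nat multiset \<Rightarrow> nat list" where
  "shape m = partition_of (map (count m) (sorted_list_of_set (set_mset m)))"

lemma mset_sorted_list_of_set: "mset (sorted_list_of_set A) = mset_set A"
  by (metis mset_sorted_list_of_multiset sorted_list_of_mset_set)

lemma mset_shape: "mset (shape m) = exponents m"
proof -
  have "mset (map (count m) (sorted_list_of_set (set_mset m))) = exponents m"
    by (simp add: exponents_def mset_sorted_list_of_set)
  moreover have "filter_mset (\<lambda>x. x \<noteq> 0) (exponents m) = exponents m"
    by (auto simp: exponents_def filter_mset_eq_conv)
  ultimately show ?thesis by (simp add: shape_def mset_partition_of)
qed

lemma is_partition_shape: "is_partition (shape m)"
  by (simp add: shape_def is_partition_partition_of)

lemma size_exponents: "size (exponents m) = card (set_mset m)"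
  by (simp add: exponents_def)

lemma sum_exponents: "sum_mset (exponents m) = size m"
  by (simp add: exponents_def size_multiset_overloaded_eq sum_unfold_sum_mset)

lemma sum_list_shape: "sum_list (shape m) = size m"
  by (metis mset_shape sum_exponents sum_mset_sum_list)

lemma length_shape: "length (shape m) = card (set_mset m)"
  by (metis mset_shape size_exponents size_mset)

lemma count_image_bij: "bij \<sigma> \<Longrightarrow> count (image_mset \<sigma> m) (\<sigma> x) = count m x"
  using bij_is_inj[of \<sigma>] by (induction m) (auto dest: injD)

lemma exponents_image:
  assumes "bij \<sigma>"
  shows "exponents (image_mset \<sigma> m) = exponents m"
proof -
  have "mset_set (\<sigma> ` set_mset m) = image_mset \<sigma> (mset_set (set_mset m))"
    using assms by (intro image_mset_mset_set[symmetric]) (auto dest: bij_is_inj intro: inj_on_subset)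
  then show ?thesis
    using assms by (simp add: exponents_def multiset.map_comp comp_def count_image_bij)
qed

lemma shape_image: "bij \<sigma> \<Longrightarrow> shape (image_mset \<sigma> m) = shape m"
  by (rule partition_eqI) (auto simp: is_partition_shape mset_shape exponents_image)

text \<open>The supports are matched by a permutation of the exponents. Invariance of a symmetric
  function speaks of bijections of all variables, so the infinite complements of the supports are
  matched as well, through their increasing enumerations.\<close>

lemma ex_bij_of_shape_eq:
  assumes "shape m = shape m'"
  obtains \<sigma> where "bij \<sigma>" "image_mset \<sigma> m = m'"
proof -
  define xs ys where "xs = sorted_list_of_set (set_mset m)" and "ys = sorted_list_of_set (set_mset m')"
  have sets: "set xs = set_mset m" "set ys = set_mset m'" "distinct xs" "distinct ys"
    by (simp_all add: xs_def ys_def)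
  have "mset (map (count m) xs) = mset (map (count m') ys)"
    using arg_cong[OF assms, of mset] unfolding mset_shape by (simp add: xs_def ys_def exponents_def mset_sorted_list_of_set)
  then obtain p where p: "p permutes {..<length (map (count m') ys)}"
      "permute_list p (map (count m') ys) = map (count m) xs"
    by (rule mset_eq_permutation)
  define n where "n = length ys"
  have len: "length xs = n" using arg_cong[OF p(2), of length] by (simp add: n_def)
  have pn: "p permutes {..<n}" using p(1) by (simp add: n_def)
  have cnt: "count m (xs ! i) = count m' (ys ! p i)" if "i < n" for i
  proof -
    have "map (count m) xs ! i = permute_list p (map (count m') ys) ! i" using p(2) by simp
    also have "\<dots> = map (count m') ys ! p i"
      using pn that by (intro permute_list_nth) (auto simp: n_def)
    also have "\<dots> = count m' (ys ! p i)"
      using permutes_in_image[OF pn, of i] that by (auto simp: n_def)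
    finally show ?thesis using that len by simp
  qed
  define h where "h = (!) ys \<circ> p \<circ> inv_into {..<n} ((!) xs)"
  have bx: "bij_betw ((!) xs) {..<n} (set xs)" and "bij_betw ((!) ys) {..<n} (set ys)"
    using sets len by (auto intro!: bij_betw_nth simp: n_def)
  then have bh: "bij_betw h (set xs) (set ys)"
    unfolding h_def using permutes_imp_bij[OF pn] by (blast intro: bij_betw_trans bij_betw_inv_into)
  have hx: "count m' (h x) = count m x" if "x \<in> set xs" for x
  proof -
    obtain i where i: "i < n" "x = xs ! i" using \<open>x \<in> set xs\<close> len by (auto simp: in_set_conv_nth)
    then have "inv_into {..<n} ((!) xs) x = i" using bx by (simp add: bij_betw_def inv_into_f_f)
    then show ?thesis using cnt i by (simp add: h_def)
  qed
  have inf: "infinite (- set xs)" "infinite (- set ys)" by simp_all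
  define g where "g = enumerate (- set ys) \<circ> inv_into UNIV (enumerate (- set xs))"
  have bg: "bij_betw g (- set xs) (- set ys)"
    unfolding g_def using bij_enumerate[OF inf(1)] bij_enumerate[OF inf(2)]
    by (blast intro: bij_betw_trans bij_betw_inv_into)
  define \<sigma> where "\<sigma> x = (if x \<in> set xs then h x else g x)" for x
  have "bij_betw \<sigma> (set xs) (set ys) \<longleftrightarrow> bij_betw h (set xs) (set ys)"
      "bij_betw \<sigma> (- set xs) (- set ys) \<longleftrightarrow> bij_betw g (- set xs) (- set ys)"
    by (rule bij_betw_cong; simp add: \<sigma>_def)+
  then have "bij_betw \<sigma> (set xs) (set ys)" "bij_betw \<sigma> (- set xs) (- set ys)"
    using bh bg by simp_all
  then have "bij_betw \<sigma> (set xs \<union> - set xs) (set ys \<union> - set ys)"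
    by (rule bij_betw_combine) auto
  then have bij: "bij \<sigma>" by simp
  have "count (image_mset \<sigma> m) y = count m' y" for y
  proof -
    obtain x where y: "y = \<sigma> x" using bij by (meson bij_pointE)
    have "count m' (g x) = 0" if "x \<notin> set xs"
      using bij_betwE[OF bg] that sets(2) by (auto simp: not_in_iff)
    then have "count m' y = count m x"
      using hx[of x] sets(1) by (cases "x \<in> set xs") (simp_all add: y \<sigma>_def not_in_iff)
    then show ?thesis using count_image_bij[OF bij, of m x] y by simp
  qed
  then show ?thesis using that[OF bij] by (simp add: multiset_eq_iff)
qed

lemma coeff_sf_image: "bij \<sigma> \<Longrightarrow> coeff_sf f (image_mset \<sigma> m) = coeff_sf f m"
  using coeff_sf[of f] by simp

lemma coeff_sf_shape_eq:
  assumes "shape m = shape m'"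
  shows "coeff_sf f m = coeff_sf f m'"
  by (rule ex_bij_of_shape_eq[OF assms]) (auto simp: coeff_sf_image)

definition monomial_of :: "nat list \<Rightarrow> nat multiset" where
  "monomial_of \<mu> = (\<Sum>i<length \<mu>. replicate_mset (\<mu> ! i) i)"

lemma count_monomial_of: "count (monomial_of \<mu>) i = (if i < length \<mu> then \<mu> ! i else 0)"
  by (simp add: monomial_of_def count_sum)

lemma shape_monomial_of:
  assumes "is_partition \<mu>"
  shows "shape (monomial_of \<mu>) = \<mu>"
proof -
  have "set_mset (monomial_of \<mu>) = {..<length \<mu>}"
  proof (rule Set.set_eqI)
    fix i
    have "\<mu> ! i \<noteq> 0" if "i < length \<mu>" using assms that unfolding is_partition_def by (metis nth_mem)
    then show "i \<in> set_mset (monomial_of \<mu>) \<longleftrightarrow> i \<in> {..<length \<mu>}"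
      by (auto simp: set_mset_def count_monomial_of)
  qed
  then have "map (count (monomial_of \<mu>)) (sorted_list_of_set (set_mset (monomial_of \<mu>))) = \<mu>"
    by (auto simp: lessThan_atLeast0 count_monomial_of intro!: nth_equalityI)
  then show ?thesis using assms by (simp add: shape_def partition_of_partition)
qed

definition msym :: "nat list \<Rightarrow> 'a :: comm_ring_1 symfun" where
  "msym \<mu> = Abs_symfun (\<lambda>m. if shape m = \<mu> then 1 else 0)"

lemma coeff_sf_msym: "coeff_sf (msym \<mu>) m = (if shape m = \<mu> then 1 else (0 :: 'a :: comm_ring_1))"
proof -
  let ?f = "\<lambda>m. if shape m = \<mu> then 1 else (0 :: 'a)"
  have "?f (image_mset \<sigma> m) = ?f m" if "bij \<sigma>" for \<sigma> m
    unfolding shape_image[OF that] ..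
  moreover have "\<forall>m. size m > sum_list \<mu> \<longrightarrow> ?f m = 0"
    by (auto simp: sum_list_shape)
  ultimately have "?f \<in> {f. (\<forall>\<sigma> m. bij \<sigma> \<longrightarrow> f (image_mset \<sigma> m) = f m) \<and> (\<exists>d. \<forall>m. size m > d \<longrightarrow> f m = 0)}"
    by blast
  then have "coeff_sf (msym \<mu> :: 'a symfun) = ?f"
    unfolding msym_def by (rule Abs_symfun_inverse)
  then show ?thesis by simp
qed

lemma coeff_sf_simps [simp]:
  "coeff_sf 0 m = 0" "coeff_sf (f + g) m = coeff_sf f m + coeff_sf g m"
  "coeff_sf (scale_sf c f) m = c * coeff_sf f m" "coeff_sf (- f) m = - coeff_sf f m"
  "coeff_sf (f - g) m = coeff_sf f m - coeff_sf g m"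
proof -
  show *: "coeff_sf 0 m = 0" "coeff_sf (f + g) m = coeff_sf f m + coeff_sf g m" for f g
    by (simp_all add: zero_symfun.rep_eq plus_symfun.rep_eq)
  show "coeff_sf (scale_sf c f) m = c * coeff_sf f m" "coeff_sf (- f) m = - coeff_sf f m" for f
    by (simp_all add: scale_sf.rep_eq uminus_symfun.rep_eq)
  then show "coeff_sf (f - g) m = coeff_sf f m - coeff_sf g m"
    using *(2)[of f "- g"] by simp
qed

lemma coeff_sf_sum: "coeff_sf (sum f A) m = (\<Sum>i\<in>A. coeff_sf (f i) m)"
  by (induction A rule: infinite_finite_induct) auto

lemma in_span_msym:
  fixes f :: "'a :: field symfun"
  assumes "\<And>m. coeff_sf f m \<noteq> 0 \<Longrightarrow> shape m \<in> J"
  shows "f \<in> sf.span (msym ` J)"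
proof -
  obtain d where d: "\<And>m. size m > d \<Longrightarrow> coeff_sf f m = 0"
    using coeff_sf[of f] by auto
  define L where "L = {\<mu> \<in> J. is_partition \<mu> \<and> sum_list \<mu> \<le> d}"
  have fin: "finite L" by (rule finite_subset[OF _ finite_partitions_le[of d]]) (auto simp: L_def)
  have "f = (\<Sum>\<mu>\<in>L. scale_sf (coeff_sf f (monomial_of \<mu>)) (msym \<mu>))"
  proof (rule symfun_eqI)
    fix m
    have "coeff_sf (\<Sum>\<mu>\<in>L. scale_sf (coeff_sf f (monomial_of \<mu>)) (msym \<mu>)) m
        = (\<Sum>\<mu>\<in>L. if \<mu> = shape m then coeff_sf f (monomial_of \<mu>) else 0)"
      by (auto simp: coeff_sf_sum coeff_sf_msym intro!: sum.cong)
    also have "\<dots> = (if shape m \<in> L then coeff_sf f (monomial_of (shape m)) else 0)"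
      using fin by simp
    also have "coeff_sf f (monomial_of (shape m)) = coeff_sf f m"
      by (rule coeff_sf_shape_eq) (simp add: shape_monomial_of is_partition_shape)
    also have "(if shape m \<in> L then coeff_sf f m else 0) = coeff_sf f m"
      using assms[of m] d[of m] by (force simp: L_def is_partition_shape sum_list_shape)
    finally show "coeff_sf f m = coeff_sf (\<Sum>\<mu>\<in>L. scale_sf (coeff_sf f (monomial_of \<mu>)) (msym \<mu>)) m" ..
  qed
  also have "\<dots> \<in> sf.span (msym ` J)"
    by (intro sf.span_sum sf.span_scale sf.span_base) (auto simp: L_def)
  finally show ?thesis .
qed

lemma msym_basis: "basis_family partitions (msym :: _ \<Rightarrow> 'a :: field symfun)"
proof (rule basis_familyI)
  show "sf.span (msym ` partitions) = (UNIV :: 'a symfun set)"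
    using in_span_msym[of _ partitions] by (auto simp: is_partition_shape)
  fix J :: "nat list set" and x :: "nat list \<Rightarrow> 'a" and \<mu>
  assume J: "finite J" "J \<subseteq> partitions" "(\<Sum>\<nu>\<in>J. scale_sf (x \<nu>) (msym \<nu>)) = 0" "\<mu> \<in> J"
  have \<mu>: "shape (monomial_of \<mu>) = \<mu>" using J by (intro shape_monomial_of) auto
  have "0 = coeff_sf (\<Sum>\<nu>\<in>J. scale_sf (x \<nu>) (msym \<nu>)) (monomial_of \<mu>)" using J(3) by simp
  also have "\<dots> = (\<Sum>\<nu>\<in>J. if \<nu> = \<mu> then x \<nu> else 0)"
    by (auto simp: coeff_sf_sum coeff_sf_msym \<mu> intro!: sum.cong)
  also have "\<dots> = x \<mu>" using J by simp
  finally show "x \<mu> = 0" by simp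
qed

text \<open>For r > 0 a monomial of \<open>psym r\<close> determines its variable, so the
  contributing splittings of \<open>m\<close> correspond to the variables with exponent at least
  \<open>r\<close>.\<close>

lemma coeff_sf_psym_mult:
  fixes f :: "'a :: comm_ring_1 symfun"
  assumes "r > 0"
  shows "coeff_sf (psym r * f) m = (\<Sum>i | count m i \<ge> r. coeff_sf f (m - replicate_mset r i))"
proof -
  define \<Phi> where "\<Phi> i = (replicate_mset r i, m - replicate_mset r i)" for i
  have fin: "finite {i. count m i \<ge> r}"
    using assms by (intro finite_subset[OF _ finite_set_mset[of m]]) (auto simp: count_greater_zero_iff[symmetric] simp del: count_greater_zero_iff)
  have sub: "\<Phi> ` {i. count m i \<ge> r} \<subseteq> {(a, b). a + b = m}"
    by (auto simp: \<Phi>_def count_le_replicate_mset_subset_eq)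
  have inj: "inj_on \<Phi> {i. count m i \<ge> r}"
    using assms by (auto simp: \<Phi>_def inj_on_def dest: arg_cong[where f = set_mset])
  have "coeff_sf (psym r * f) m = (\<Sum>(a, b) | a + b = m. coeff_sf (psym r) a * coeff_sf f b)"
    by (simp add: times_symfun.rep_eq)
  also have "\<dots> = (\<Sum>(a, b) \<in> \<Phi> ` {i. count m i \<ge> r}. coeff_sf (psym r) a * coeff_sf f b)"
  proof (rule sum.mono_neutral_right[OF finite_mset_splits sub], clarify)
    fix a b assume m: "m = a + b" and not: "(a, b) \<notin> \<Phi> ` {i. count (a + b) i \<ge> r}"
    have "a \<noteq> replicate_mset r i" for i
    proof
      assume "a = replicate_mset r i"
      then have "(a, b) = \<Phi> i" "count (a + b) i \<ge> r" by (auto simp: \<Phi>_def m)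
      then show False using not by auto
    qed
    then show "coeff_sf (psym r) a * coeff_sf f b = 0" by (simp add: psym.rep_eq)
  qed
  also have "\<dots> = (\<Sum>i | count m i \<ge> r. coeff_sf f (m - replicate_mset r i))"
    unfolding sum.reindex[OF inj] by (intro sum.cong refl) (simp add: \<Phi>_def psym.rep_eq, blast)
  finally show ?thesis .
qed

section \<open>The basis of power sum products\<close>

definition plist :: "nat list \<Rightarrow> 'a :: comm_ring_1 symfun" where
  "plist \<mu> = prod_list (map psym \<mu>)"

lemma exponents_remove:
  assumes "count m i = r" "r > 0"
  shows "exponents m = add_mset r (exponents (m - replicate_mset r i))"
proof -
  define m' where "m' = m - replicate_mset r i"
  have i: "i \<in># m" using assms by (auto simp: count_greater_zero_iff[symmetric] simp del: count_greater_zero_iff)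
  have cnt: "count m' j = (if j = i then 0 else count m j)" for j
    using assms by (auto simp: m'_def)
  have set: "set_mset m = insert i (set_mset m')" "i \<notin># m'"
    using i cnt by (auto simp: set_eq_iff simp flip: count_greater_zero_iff)
  have "image_mset (count m) (mset_set (set_mset m')) = image_mset (count m') (mset_set (set_mset m'))"
    using cnt set(2) by (intro image_mset_cong) auto
  then show ?thesis using assms set(2) unfolding exponents_def m'_def[symmetric] set(1) by simp
qed

text \<open>Expanding the product assigns a variable to each factor. Either all variables differ,
  and the exponents are the parts, or factors merge and fewer variables occur. Writing the
  coefficient as a natural number excludes cancellation.\<close>

lemma coeff_sf_plist:
  assumes "0 \<notin> set \<mu>"
  obtains k where "coeff_sf (plist \<mu> :: 'a :: comm_ring_1 symfun) m = of_nat k"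
    and "exponents m = mset \<mu> \<Longrightarrow> k > 0"
    and "k > 0 \<Longrightarrow> size m = sum_list \<mu> \<and> (card (set_mset m) < length \<mu> \<or> exponents m = mset \<mu>)"
proof -
  have "\<exists>k. coeff_sf (plist \<mu> :: 'a symfun) m = of_nat k \<and> (exponents m = mset \<mu> \<longrightarrow> k > 0) \<and>
    (k > 0 \<longrightarrow> size m = sum_list \<mu> \<and> (card (set_mset m) < length \<mu> \<or> exponents m = mset \<mu>))"
    using assms
  proof (induction \<mu> arbitrary: m)
    case Nil
    then show ?case
      by (intro exI[of _ "if m = {#} then 1 else 0"])
        (auto simp: plist_def one_symfun.rep_eq exponents_def mset_set_empty_iff)
  next
    case (Cons r \<mu>)
    then have r: "r > 0" and \<mu>: "0 \<notin> set \<mu>" by auto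
    obtain K where K: "\<And>m. coeff_sf (plist \<mu> :: 'a symfun) m = of_nat (K m)"
        "\<And>m. exponents m = mset \<mu> \<Longrightarrow> K m > 0"
        "\<And>m. K m > 0 \<Longrightarrow> size m = sum_list \<mu> \<and> (card (set_mset m) < length \<mu> \<or> exponents m = mset \<mu>)"
      using Cons.IH[OF \<mu>] by metis
    define S where "S = {i. count m i \<ge> r}"
    define k where "k = (\<Sum>i\<in>S. K (m - replicate_mset r i))"
    have fin: "finite S" unfolding S_def
      using r by (intro finite_subset[OF _ finite_set_mset[of m]]) (auto simp: count_greater_zero_iff[symmetric] simp del: count_greater_zero_iff)
    have "coeff_sf (plist (r # \<mu>) :: 'a symfun) m = of_nat k"
      using coeff_sf_psym_mult[OF r, of "plist \<mu> :: 'a symfun"] by (simp add: plist_def k_def S_def K(1)[unfolded plist_def])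
    moreover have "k > 0" if "exponents m = mset (r # \<mu>)"
    proof -
      have "r \<in># exponents m" using that by simp
      then obtain i where i: "count m i = r" by (auto simp: exponents_def)
      then have "exponents (m - replicate_mset r i) = mset \<mu>"
        using exponents_remove[OF i r] that by simp
      then have "K (m - replicate_mset r i) > 0" by (rule K(2))
      moreover have "i \<in> S" using i by (simp add: S_def)
      ultimately show ?thesis using fin unfolding k_def by (meson sum_pos2 zero_le)
    qed
    moreover have "size m = sum_list (r # \<mu>) \<and> (card (set_mset m) < length (r # \<mu>) \<or> exponents m = mset (r # \<mu>))"
      if "k > 0"
    proof -
      have "\<exists>i\<in>S. K (m - replicate_mset r i) > 0"
      proof (rule ccontr)
        assume "\<not> ?thesis"
        then have "k = 0" unfolding k_def by (intro sum.neutral) auto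
        then show False using that by simp
      qed
      then obtain i where i: "i \<in> S" "K (m - replicate_mset r i) > 0" by blast
      define m' where "m' = m - replicate_mset r i"
      have m: "m = m' + replicate_mset r i" using i(1) by (simp add: m'_def S_def count_le_replicate_mset_subset_eq)
      note K' = K(3)[OF i(2), folded m'_def]
      have size: "size m = sum_list (r # \<mu>)" using K' by (simp add: m)
      show ?thesis
      proof (cases "i \<in># m'")
        case True
        then have "set_mset m = set_mset m'" by (auto simp: m)
        then have "card (set_mset m) \<le> length \<mu>"
          using K' size_exponents[of m'] by auto
        then show ?thesis using size by simp
      next
        case False
        then have "count m i = r" by (simp add: m not_in_iff)
        then have ex: "exponents m = add_mset r (exponents m')" using exponents_remove[OF _ r] by (simp add: m'_def)
        then have "card (set_mset m) = Suc (card (set_mset m'))"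
          using size_exponents[of m] size_exponents[of m'] by simp
        then show ?thesis using K' size ex by auto
      qed
    qed
    ultimately show ?case by blast
  qed
  then show ?thesis using that by blast
qed

text \<open>Triangular over the monomial functions for the order "same weight, fewer parts". The
  leading coefficient is a positive integer, hence invertible in characteristic 0.\<close>

lemma plist_basis: "basis_family partitions (plist :: _ \<Rightarrow> 'a :: field_char_0 symfun)"
proof -
  define R where "R \<mu> \<nu> \<longleftrightarrow> sum_list \<nu> = sum_list \<mu> \<and> length \<nu> < length \<mu>" for \<mu> \<nu> :: "nat list"
  define c where "c \<mu> = coeff_sf (plist \<mu> :: 'a symfun) (monomial_of \<mu>)" for \<mu>
  have ex: "exponents m = mset \<mu> \<longleftrightarrow> shape m = \<mu>" if "\<mu> \<in> partitions" for m \<mu>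
    using that by (metis CollectD is_partition_shape mset_shape partition_eqI)
  have z: "0 \<notin> set \<mu>" if "\<mu> \<in> partitions" for \<mu> using that by (simp add: is_partition_def)
  have "finite {\<nu> \<in> partitions. R \<mu> \<nu>}" for \<mu>
    by (rule finite_subset[OF _ finite_partitions_le[of "sum_list \<mu>"]]) (auto simp: R_def)
  moreover have "c \<mu> \<noteq> 0" if "\<mu> \<in> partitions" for \<mu>
  proof -
    have "exponents (monomial_of \<mu>) = mset \<mu>" using ex[OF that] that by (simp add: shape_monomial_of)
    then show ?thesis
      unfolding c_def by (metis coeff_sf_plist[OF z[OF that]] less_irrefl of_nat_eq_0_iff)
  qed
  moreover have "plist \<mu> - scale_sf (c \<mu>) (msym \<mu>) \<in> sf.span (msym ` {\<nu> \<in> partitions. R \<mu> \<nu>})"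
    if \<mu>: "\<mu> \<in> partitions" for \<mu>
  proof (rule in_span_msym)
    fix m assume m: "coeff_sf (plist \<mu> - scale_sf (c \<mu>) (msym \<mu>)) m \<noteq> 0"
    have ne: "shape m \<noteq> \<mu>"
      using m coeff_sf_shape_eq[of m "monomial_of \<mu>" "plist \<mu>"] \<mu>
      by (auto simp: coeff_sf_msym shape_monomial_of c_def)
    obtain k where k: "coeff_sf (plist \<mu> :: 'a symfun) m = of_nat k"
      "k > 0 \<Longrightarrow> size m = sum_list \<mu> \<and> (card (set_mset m) < length \<mu> \<or> exponents m = mset \<mu>)"
      using coeff_sf_plist[OF z[OF \<mu>], of m] by metis
    have "k > 0" using m ne k(1) by (intro gr0I) (simp add: coeff_sf_msym)
    then show "shape m \<in> {\<nu> \<in> partitions. R \<mu> \<nu>}"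
      using k(2) ne ex[OF \<mu>] by (simp add: is_partition_shape sum_list_shape length_shape R_def)
  qed
  moreover have "\<not> R \<mu> \<mu>" "R \<mu> \<nu> \<Longrightarrow> R \<nu> \<rho> \<Longrightarrow> R \<mu> \<rho>" for \<mu> \<nu> \<rho> by (auto simp: R_def)
  ultimately show ?thesis
    by (rule_tac triangular_basis(1)[OF msym_basis, where R = R and c = c]) blast+
qed

section \<open>Homomorphisms from the ring of symmetric functions\<close>

lemma scale_sf_mult: "scale_sf c f * g = scale_sf c (f * g)"
  by transfer (auto simp: fun_eq_iff sum_distrib_left mult.assoc intro!: sum.cong)

lemma mult_scale_sf: "f * scale_sf c g = scale_sf c (f * g)"
  by (metis mult.commute scale_sf_mult)

lemma of_nat_mult_sf: "of_nat n * f = scale_sf (of_nat n) (f :: 'a :: field symfun)"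
  by (induction n) (simp_all add: algebra_simps)

definition subring_set :: "'a :: ring_1 set \<Rightarrow> bool" where
  "subring_set R \<longleftrightarrow> 1 \<in> R \<and> (\<forall>x\<in>R. \<forall>y\<in>R. x - y \<in> R \<and> x * y \<in> R)"

lemma subring_setD:
  assumes "subring_set R"
  shows "1 \<in> R" "x \<in> R \<Longrightarrow> y \<in> R \<Longrightarrow> x - y \<in> R" "x \<in> R \<Longrightarrow> y \<in> R \<Longrightarrow> x * y \<in> R"
    "0 \<in> R" "x \<in> R \<Longrightarrow> y \<in> R \<Longrightarrow> x + y \<in> R" "x \<in> R \<Longrightarrow> - x \<in> R" "x \<in> R \<Longrightarrow> x ^ n \<in> R"
proof -
  show *: "1 \<in> R" "\<And>x y. x \<in> R \<Longrightarrow> y \<in> R \<Longrightarrow> x - y \<in> R" "\<And>x y. x \<in> R \<Longrightarrow> y \<in> R \<Longrightarrow> x * y \<in> R"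
    using assms by (auto simp: subring_set_def)
  show z: "0 \<in> R" using *(2)[OF *(1) *(1)] by simp
  show n: "- x \<in> R" if "x \<in> R" for x using *(2)[OF z that] by simp
  show "x + y \<in> R" if "x \<in> R" "y \<in> R" for x y using *(2)[OF that(1) n[OF that(2)]] by simp
  show "x ^ n \<in> R" if "x \<in> R" by (induction n) (auto intro: * that)
qed

lemma subring_set_UNIV [simp]: "subring_set UNIV"
  by (simp add: subring_set_def)

lemma subring_set_sum: "subring_set R \<Longrightarrow> (\<And>i. i \<in> I \<Longrightarrow> f i \<in> R) \<Longrightarrow> sum f I \<in> R"
  by (induction I rule: infinite_finite_induct) (auto intro: subring_setD)

lemma subring_set_prod: "subring_set R \<Longrightarrow> (\<And>i. i \<in> I \<Longrightarrow> f i \<in> R) \<Longrightarrow> prod f I \<in> R"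
  by (induction I rule: infinite_finite_induct) (auto intro: subring_setD)

lemma subring_set_of_nat: "subring_set R \<Longrightarrow> of_nat n \<in> R"
  by (induction n) (auto intro: subring_setD)

lemma prod_list_mset_cong:
  fixes g :: "'a \<Rightarrow> 'b :: comm_monoid_mult"
  assumes "mset xs = mset ys"
  shows "prod_list (map g xs) = prod_list (map g ys)"
proof -
  have "prod_mset (mset (map g xs)) = prod_mset (mset (map g ys))" by (simp only: mset_map assms)
  then show ?thesis by (simp only: prod_mset_prod_list)
qed

lemma plist_partition_of:
  assumes "0 \<notin> set \<mu>"
  shows "plist (partition_of \<mu>) = plist \<mu>"
proof -
  have "\<forall>x \<in># mset \<mu>. x \<noteq> 0" using assms by (auto intro!: gr0I)
  then have "mset (partition_of \<mu>) = mset \<mu>" unfolding mset_partition_of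
    by (simp add: filter_mset_eq_conv)
  then show ?thesis unfolding plist_def by (rule prod_list_mset_cong)
qed

lemma plist_simps [simp]: "plist [] = 1" "plist (r # \<mu>) = psym r * plist \<mu>"
  by (simp_all add: plist_def)

lemma plist_append: "plist (\<mu> @ \<nu>) = plist \<mu> * plist \<nu>"
  by (simp add: plist_def)

lemma symfun_plist_induct [consumes 0, case_names scale add]:
  fixes F :: "'a :: field_char_0 symfun"
  assumes "\<And>c \<mu>. is_partition \<mu> \<Longrightarrow> P (scale_sf c (plist \<mu>))"
    and "\<And>F G. P F \<Longrightarrow> P G \<Longrightarrow> P (F + G)"
  shows "P F"
proof -
  have sum: "P (\<Sum>i\<in>A. f i)" if "finite A" "\<And>i. i \<in> A \<Longrightarrow> P (f i)" for A :: "nat list set" and f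
    using that
  proof (induction A)
    case empty
    then show ?case using assms(1)[of "[]" 0] by (simp add: is_partition_def)
  qed (auto intro: assms(2))
  have "P (\<Sum>\<mu> | coordinate partitions plist F \<mu> \<noteq> 0. scale_sf (coordinate partitions plist F \<mu>) (plist \<mu>))"
  proof (rule sum[OF finite_coordinate[OF plist_basis]])
    fix \<mu> assume "\<mu> \<in> {\<mu>. coordinate partitions plist F \<mu> \<noteq> 0}"
    then show "P (scale_sf (coordinate partitions plist F \<mu>) (plist \<mu>))"
      using coordinate_in[OF plist_basis, of F \<mu>] by (intro assms(1)) simp
  qed
  then show ?thesis by (subst coordinate_expand[OF plist_basis])
qed

lemma symfun_induct [consumes 0, case_names one psym scale add]:
  fixes F :: "'a :: field_char_0 symfun"
  assumes "P 1" "\<And>r F. r > 0 \<Longrightarrow> P F \<Longrightarrow> P (psym r * F)" "\<And>c F. P F \<Longrightarrow> P (scale_sf c F)"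
    and "\<And>F G. P F \<Longrightarrow> P G \<Longrightarrow> P (F + G)"
  shows "P F"
proof (induction F rule: symfun_plist_induct)
  case (scale c \<mu>)
  then have "0 \<notin> set \<mu>" by (simp add: is_partition_def)
  then have "P (plist \<mu>)" by (induction \<mu>) (auto intro: assms)
  then show ?case by (rule assms(3))
qed (rule assms(4))

text \<open>One construction serves three targets: symmetric functions (scaling of the alphabet),
  polynomials over them (shift of the alphabet) and the field itself (evaluations).
  \<open>\<iota>\<close> embeds the scalars.\<close>

locale scalar_map =
  fixes \<iota> :: "'a :: field_char_0 \<Rightarrow> 'b :: comm_ring_1"
  assumes one: "\<iota> 1 = 1" and add: "\<iota> (x + y) = \<iota> x + \<iota> y" and mult: "\<iota> (x * y) = \<iota> x * \<iota> y"
begin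

lemma zero: "\<iota> 0 = 0"
  using add[of 0 0] by simp

text \<open>The homomorphism of algebras with \<open>psym r\<close> going to \<open>g r\<close>; it
  exists because the power sums are free generators, which is the content of
  \<open>plist_basis\<close>.\<close>

definition psym_hom :: "(nat \<Rightarrow> 'b) \<Rightarrow> 'a symfun \<Rightarrow> 'b" where
  "psym_hom g F = (\<Sum>\<mu> | coordinate partitions plist F \<mu> \<noteq> 0.
     \<iota> (coordinate partitions plist F \<mu>) * prod_list (map g \<mu>))"

lemma psym_hom_superset:
  assumes "finite L" "{\<mu>. coordinate partitions plist F \<mu> \<noteq> 0} \<subseteq> L"
  shows "psym_hom g F = (\<Sum>\<mu>\<in>L. \<iota> (coordinate partitions plist F \<mu>) * prod_list (map g \<mu>))"
  unfolding psym_hom_def using assms by (intro sum.mono_neutral_left) (auto simp: zero)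

lemma psym_hom_add: "psym_hom g (F + G) = psym_hom g F + psym_hom g G"
proof -
  let ?s = "\<lambda>F. {\<mu>. coordinate partitions plist F \<mu> \<noteq> 0}"
  have fin: "finite (?s F \<union> ?s G)" using finite_coordinate[OF plist_basis] by auto
  have "?s (F + G) \<subseteq> ?s F \<union> ?s G" by (auto simp: coordinate_add[OF plist_basis])
  then show ?thesis
    using fin by (simp add: psym_hom_superset[OF fin] coordinate_add[OF plist_basis] add distrib_right sum.distrib)
qed

lemma psym_hom_scale: "psym_hom g (scale_sf c F) = \<iota> c * psym_hom g F"
proof -
  let ?s = "\<lambda>F. {\<mu>. coordinate partitions plist F \<mu> \<noteq> 0}"
  have fin: "finite (?s F)" using finite_coordinate[OF plist_basis] by auto
  have "?s (scale_sf c F) \<subseteq> ?s F" by (auto simp: coordinate_scale[OF plist_basis])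
  then show ?thesis
    by (simp add: psym_hom_superset[OF fin] coordinate_scale[OF plist_basis] mult sum_distrib_left mult.assoc)
qed

lemma psym_hom_plist:
  assumes "0 \<notin> set \<mu>"
  shows "psym_hom g (plist \<mu>) = prod_list (map g \<mu>)"
proof -
  let ?\<nu> = "partition_of \<mu>"
  have "\<forall>x \<in># mset \<mu>. x \<noteq> 0" using assms by (auto intro!: gr0I)
  then have ms: "mset ?\<nu> = mset \<mu>" unfolding mset_partition_of by (simp add: filter_mset_eq_conv)
  have c: "coordinate partitions plist (plist \<mu> :: 'a symfun) \<rho> = (if \<rho> = ?\<nu> then 1 else 0)" for \<rho>
    unfolding plist_partition_of[OF assms, symmetric]
    by (rule coordinate_basis[OF plist_basis]) (simp add: is_partition_partition_of)
  have "psym_hom g (plist \<mu>) = prod_list (map g ?\<nu>)"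
    by (subst psym_hom_superset[of "{?\<nu>}"]) (auto simp: c one)
  also have "\<dots> = prod_list (map g \<mu>)" using ms by (rule prod_list_mset_cong)
  finally show ?thesis .
qed

lemma psym_hom_one: "psym_hom g 1 = 1"
  using psym_hom_plist[of "[]"] by simp

lemma psym_hom_psym: "r > 0 \<Longrightarrow> psym_hom g (psym r) = g r"
  using psym_hom_plist[of "[r]"] by simp

lemma psym_hom_zero: "psym_hom g 0 = 0"
  using psym_hom_add[of g 0 0] by simp

lemma psym_hom_mult: "psym_hom g (F * G) = psym_hom g F * psym_hom g G"
proof (induction F rule: symfun_plist_induct)
  case (scale c \<mu>)
  note \<mu> = scale
  show ?case
  proof (induction G rule: symfun_plist_induct)
    case (scale d \<nu>)
    have "0 \<notin> set \<mu>" "0 \<notin> set \<nu>" using \<mu> scale by (auto simp: is_partition_def)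
    then have "psym_hom g (plist (\<mu> @ \<nu>)) = psym_hom g (plist \<mu>) * psym_hom g (plist \<nu>)"
      by (simp add: psym_hom_plist del: plist_simps)
    then show ?case
      by (simp add: scale_sf_mult mult_scale_sf psym_hom_scale plist_append mult mult_ac)
  next
    case (add G H)
    then show ?case by (simp add: distrib_left psym_hom_add)
  qed
next
  case (add F H)
  then show ?case by (simp add: distrib_right psym_hom_add)
qed

lemma psym_hom_sum: "psym_hom g (sum f I) = (\<Sum>i\<in>I. psym_hom g (f i))"
  by (induction I rule: infinite_finite_induct) (auto simp: psym_hom_zero psym_hom_add)

text \<open>Power sums generate the algebra. Composites of homomorphisms are identified through this
  lemma by comparing their values on power sums.\<close>

lemma psym_hom_unique:
  assumes "\<phi> 1 = 1" "\<And>F G. \<phi> (F + G) = \<phi> F + \<phi> G" "\<And>F G. \<phi> (F * G) = \<phi> F * \<phi> G"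
    and "\<And>c F. \<phi> (scale_sf c F) = \<iota> c * \<phi> F" "\<And>r. r > 0 \<Longrightarrow> \<phi> (psym r) = g r"
  shows "\<phi> = psym_hom g"
proof
  fix F show "\<phi> F = psym_hom g F"
    by (induction F rule: symfun_induct)
      (simp_all add: assms psym_hom_one psym_hom_add psym_hom_mult psym_hom_scale psym_hom_psym)
qed

end

interpretation scale_one: scalar_map "\<lambda>c :: 'a :: field_char_0. scale_sf c 1"
  by unfold_locales (simp_all add: sf.scale_left_distrib scale_sf_mult)

abbreviation alphabet_scaling :: "(nat \<Rightarrow> 'a :: field_char_0) \<Rightarrow> 'a symfun \<Rightarrow> 'a symfun" where
  "alphabet_scaling c \<equiv> scale_one.psym_hom (\<lambda>r. scale_sf (c r) (psym r))"

lemma alphabet_scaling_scale: "alphabet_scaling c (scale_sf a F) = scale_sf a (alphabet_scaling c F)"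
  by (simp add: scale_one.psym_hom_scale scale_sf_mult)

lemma alphabet_scaling_compose:
  "alphabet_scaling c (alphabet_scaling d F) = alphabet_scaling (\<lambda>r. c r * d r) F"
  by (induction F rule: symfun_induct)
    (simp_all add: scale_one.psym_hom_one scale_one.psym_hom_add scale_one.psym_hom_mult
      alphabet_scaling_scale scale_one.psym_hom_psym mult.commute)

lemma alphabet_scaling_id:
  assumes "\<And>r. r > 0 \<Longrightarrow> c r = 1"
  shows "alphabet_scaling c F = F"
  by (induction F rule: symfun_induct)
    (simp_all add: scale_one.psym_hom_one scale_one.psym_hom_add scale_one.psym_hom_mult
      alphabet_scaling_scale scale_one.psym_hom_psym assms)

text \<open>Existence and uniqueness for the definite description; from here on plethysm is computed
  with \<open>alphabet_scaling\<close>.\<close>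

lemma psym_scaling_eq: "psym_scaling c = (alphabet_scaling c :: 'a :: field_char_0 symfun \<Rightarrow> _)"
  unfolding psym_scaling_def
proof (rule the_equality)
  show "is_psym_scaling c (alphabet_scaling c)"
    unfolding is_psym_scaling_def
    by (auto simp: Vector_Spaces.linear_iff vector_space_scale_sf
      scale_one.psym_hom_one scale_one.psym_hom_add scale_one.psym_hom_mult
      alphabet_scaling_scale scale_one.psym_hom_psym)
next
  fix \<phi> assume "is_psym_scaling c \<phi>"
  then show "\<phi> = alphabet_scaling c"
    unfolding is_psym_scaling_def Vector_Spaces.linear_iff
    by (intro scale_one.psym_hom_unique) (auto simp: scale_sf_mult)
qed

section \<open>Newton's identities\<close>

text \<open>Newton's identities between power sums \<open>y\<close> and complete homogeneous functions \<open>x\<close>, that is,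
  \<open>\<Sum>\<^sub>n x\<^sub>n w\<^sup>n = exp (\<Sum>\<^sub>r y\<^sub>r w\<^sup>r / r)\<close>.\<close>

definition newton :: "(nat \<Rightarrow> 'b :: comm_ring_1) \<Rightarrow> (nat \<Rightarrow> 'b) \<Rightarrow> bool" where
  "newton y x \<longleftrightarrow> x 0 = 1 \<and> (\<forall>n. of_nat n * x n = (\<Sum>r=1..n. y r * x (n - r)))"

lemma newtonD:
  assumes "newton y x"
  shows "x 0 = 1" "of_nat n * x n = (\<Sum>r=1..n. y r * x (n - r))"
  using assms unfolding newton_def by (blast, blast)

lemma newtonI:
  "x 0 = 1 \<Longrightarrow> (\<And>n. of_nat n * x n = (\<Sum>r=1..n. y r * x (n - r))) \<Longrightarrow> newton y x"
  unfolding newton_def by blast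

text \<open>Newton's identities determine only n times the n-th term. Cancelling n must also be
  possible for symmetric functions and for polynomials over them, which do not form fields.\<close>

definition torsion_free :: "'b :: comm_ring_1 itself \<Rightarrow> bool" where
  "torsion_free _ \<longleftrightarrow> (\<forall>n (x :: 'b). n > 0 \<longrightarrow> of_nat n * x = 0 \<longrightarrow> x = 0)"

lemma newton_unique:
  fixes x x' :: "nat \<Rightarrow> 'b :: comm_ring_1"
  assumes "torsion_free TYPE('b)" "newton y x" "newton y' x'" "\<And>r. r > 0 \<Longrightarrow> y r = y' r"
  shows "x n = x' n"
proof (induction n rule: less_induct)
  case (less n)
  show ?case
  proof (cases "n = 0")
    case False
    have "of_nat n * x n = (\<Sum>r=1..n. y r * x (n - r))" by (rule newtonD(2)[OF assms(2)])
    also have "\<dots> = (\<Sum>r=1..n. y' r * x' (n - r))"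
      by (intro sum.cong refl arg_cong2[where f = "(*)"] assms less.IH) auto
    also have "\<dots> = of_nat n * x' n" by (rule newtonD(2)[OF assms(3), symmetric])
    finally have "of_nat n * (x n - x' n) = 0" by (simp add: algebra_simps)
    then show ?thesis
      using assms(1)[unfolded torsion_free_def, rule_format, of n "x n - x' n"] False by simp
  qed (simp add: newtonD(1)[OF assms(2)] newtonD(1)[OF assms(3)])
qed

text \<open>In terms of generating series the identities say that w times the logarithmic derivative
  of the series of \<open>x\<close> is the series of \<open>y\<close>, which makes products and
  inverses easy.\<close>

lemma newton_fps:
  "newton y x \<longleftrightarrow> x 0 = 1 \<and>
     fps_X * fps_deriv (Abs_fps x) = Abs_fps (\<lambda>r. if r = 0 then 0 else y r) * Abs_fps x"
proof -
  have "fps_nth (fps_X * fps_deriv (Abs_fps x)) n = of_nat n * x n" for n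
    by (cases n) (simp_all add: fps_X_mult_nth)
  moreover have "fps_nth (Abs_fps (\<lambda>r. if r = 0 then 0 else y r) * Abs_fps x) n = (\<Sum>r=1..n. y r * x (n - r))" for n
  proof -
    have "fps_nth (Abs_fps (\<lambda>r. if r = 0 then 0 else y r) * Abs_fps x) n
        = (\<Sum>r=0..n. (if r = 0 then 0 else y r) * x (n - r))"
      by (simp add: fps_mult_nth)
    also have "\<dots> = (\<Sum>r=1..n. y r * x (n - r))"
      by (intro sum.mono_neutral_cong_right) auto
    finally show ?thesis .
  qed
  ultimately show ?thesis by (simp only: newton_def fps_eq_iff)
qed

text \<open>Logarithmic derivatives of a product add. In plethystic terms this is the expansion of
  h_n of a sum of two alphabets.\<close>

lemma newton_mult:
  assumes "newton y x" "newton y' x'"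
  shows "newton (\<lambda>r. y r + y' r) (\<lambda>n. \<Sum>i=0..n. x i * x' (n - i))"
proof -
  define X X' where "X = Abs_fps x" and "X' = Abs_fps x'"
  define Y Y' where "Y = Abs_fps (\<lambda>r. if r = 0 then 0 else y r)" and "Y' = Abs_fps (\<lambda>r. if r = 0 then 0 else y' r)"
  have eq: "Abs_fps (\<lambda>n. \<Sum>i=0..n. x i * x' (n - i)) = X * X'"
    by (simp add: fps_eq_iff fps_mult_nth X_def X'_def)
  have Y: "Abs_fps (\<lambda>r. if r = 0 then 0 else y r + y' r) = Y + Y'"
    by (simp add: fps_eq_iff Y_def Y'_def)
  have X: "fps_X * fps_deriv X = Y * X" "fps_X * fps_deriv X' = Y' * X'"
    using assms by (simp_all only: newton_fps X_def X'_def Y_def Y'_def)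
  have "fps_X * fps_deriv (X * X') = X * (fps_X * fps_deriv X') + (fps_X * fps_deriv X) * X'"
    by (simp only: fps_deriv_mult distrib_left mult_ac add_ac)
  also have "\<dots> = (Y + Y') * (X * X')"
    unfolding X by (simp only: distrib_right distrib_left mult_ac add_ac)
  finally show ?thesis
    unfolding newton_fps eq Y using newtonD(1)[OF assms(1)] newtonD(1)[OF assms(2)] by simp
qed

text \<open>Differentiating the relation between mutually inverse series negates the logarithmic
  derivative. It transfers Newton's identities from \<open>hsym\<close> to the signed
  \<open>esym\<close>.\<close>

lemma newton_inverse:
  assumes "newton y x" and 0: "x' 0 = 1" "\<And>n. n > 0 \<Longrightarrow> (\<Sum>i=0..n. x' i * x (n - i)) = 0"
  shows "newton (\<lambda>r. - y r) x'"
proof -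
  define X X' Y where "X = Abs_fps x" "X' = Abs_fps x'" "Y = Abs_fps (\<lambda>r. if r = 0 then 0 else y r)"
  have "X' * X = 1"
    using assms(2,3) newtonD(1)[OF assms(1)] by (auto simp: fps_eq_iff fps_mult_nth X_X'_Y_def)
  then have "fps_deriv (X' * X) = fps_deriv 1" by (simp only:)
  then have "fps_deriv X' * X + X' * fps_deriv X = 0" unfolding fps_deriv_mult by (simp add: add.commute)
  then have "fps_X * (fps_deriv X' * X + X' * fps_deriv X) * X' = 0" by simp
  moreover have "fps_X * (fps_deriv X' * X + X' * fps_deriv X) * X'
      = fps_X * fps_deriv X' * (X' * X) + X' * (fps_X * fps_deriv X) * X'"
    by (simp only: distrib_left distrib_right mult_ac add_ac)
  moreover have "fps_X * fps_deriv X = Y * X" using assms(1) by (simp only: newton_fps X_X'_Y_def)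
  moreover have "X' * (Y * X) * X' = Y * X' * (X' * X)" by (simp only: mult_ac)
  ultimately have "fps_X * fps_deriv X' + Y * X' = 0" using \<open>X' * X = 1\<close> by simp
  then have "fps_X * fps_deriv X' = - Y * X'" by (simp add: eq_neg_iff_add_eq_0)
  moreover have "- Y = Abs_fps (\<lambda>r. if r = 0 then 0 else - y r)" by (simp add: fps_eq_iff X_X'_Y_def)
  ultimately show ?thesis using 0(1) by (simp only: newton_fps X_X'_Y_def simp_thms)
qed

lemma newton_map:
  assumes "newton y x" "f 1 = 1" "\<And>x y. f (x + y) = f x + f y" "\<And>x y. f (x * y) = f x * f y"
  shows "newton (\<lambda>r. f (y r)) (\<lambda>n. f (x n))"
proof -
  have f0: "f 0 = 0" using assms(3)[of 0 0] by simp
  have fs: "f (sum g A) = (\<Sum>i\<in>A. f (g i))" for g and A :: "nat set"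
    by (induction A rule: infinite_finite_induct) (auto simp: f0 assms)
  have fn: "f (of_nat n) = of_nat n" for n by (induction n) (auto simp: f0 assms)
  show ?thesis
  proof (rule newtonI)
    fix n
    have "of_nat n * f (x n) = f (of_nat n * x n)" by (simp add: assms fn)
    also have "\<dots> = (\<Sum>r = 1..n. f (y r) * f (x (n - r)))"
      by (simp only: newtonD(2)[OF assms(1)] fs assms(4))
    finally show "of_nat n * f (x n) = (\<Sum>r = 1..n. f (y r) * f (x (n - r)))" .
  qed (simp add: newtonD(1)[OF assms(1)] assms(2))
qed

lemma newton_dilate: "newton y x \<Longrightarrow> newton (\<lambda>r. a ^ r * y r) (\<lambda>n. a ^ n * x n)"
proof -
  assume *: "newton y x"
  have "of_nat n * (a ^ n * x n) = (\<Sum>r=1..n. a ^ r * y r * (a ^ (n - r) * x (n - r)))" for n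
  proof -
    have "of_nat n * (a ^ n * x n) = a ^ n * (of_nat n * x n)" by (simp add: mult_ac)
    also have "of_nat n * x n = (\<Sum>r=1..n. y r * x (n - r))" by (rule newtonD(2)[OF *])
    also have "a ^ n * \<dots> = (\<Sum>r=1..n. a ^ r * y r * (a ^ (n - r) * x (n - r)))"
      unfolding sum_distrib_left
    proof (intro sum.cong refl)
      fix r assume "r \<in> {1..n}"
      then have "a ^ n = a ^ r * a ^ (n - r)" by (simp flip: power_add)
      then show "a ^ n * (y r * x (n - r)) = a ^ r * y r * (a ^ (n - r) * x (n - r))" by (simp add: mult_ac)
    qed
    finally show ?thesis .
  qed
  then show ?thesis using newtonD(1)[OF *] by (intro newtonI) simp_all
qed

lemma torsion_free_symfun: "torsion_free TYPE('a :: field_char_0 symfun)"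
  by (auto simp: torsion_free_def of_nat_mult_sf)

lemma torsion_free_field: "torsion_free TYPE('a :: field_char_0)"
  by (auto simp: torsion_free_def)

section \<open>Newton's identities for complete and elementary functions\<close>

lemma hsym_0 [simp]: "hsym 0 = 1"
  by transfer auto

lemma esym_0 [simp]: "esym 0 = 1"
  by transfer auto

lemma coeff_sf_of_nat_mult: "coeff_sf (of_nat n * f) m = of_nat n * coeff_sf (f :: 'a :: comm_ring_1 symfun) m"
  by (induction n) (simp_all add: distrib_right)

text \<open>At a monomial of degree n, the right side counts pairs of a variable and a number r
  between 1 and its exponent. There are as many such pairs as the degree.\<close>

lemma newton_hsym: "newton (psym :: _ \<Rightarrow> 'a :: comm_ring_1 symfun) hsym"
  unfolding newton_def
proof (intro conjI allI symfun_eqI)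
  fix n m
  have "coeff_sf (\<Sum>r=1..n. psym r * (hsym (n - r) :: 'a symfun)) m
      = (\<Sum>r=1..n. \<Sum>i | count m i \<ge> r. if size m - r = n - r then 1 else 0)"
    unfolding coeff_sf_sum
  proof (intro sum.cong refl)
    fix r assume r: "r \<in> {1..n}"
    have "size (m - replicate_mset r i) = size m - r" if "count m i \<ge> r" for i
      using that by (subst size_Diff_submset) (auto simp: count_le_replicate_mset_subset_eq)
    then show "coeff_sf (psym r * hsym (n - r)) m = (\<Sum>i | count m i \<ge> r. if size m - r = n - r then 1 else (0 :: 'a))"
      using r by (subst coeff_sf_psym_mult) (auto simp: hsym.rep_eq intro!: sum.cong)
  qed
  also have "\<dots> = (\<Sum>r=1..n. \<Sum>i\<in>{i \<in> set_mset m. count m i \<ge> r}. if size m = n then 1 else 0)"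
  proof (intro sum.cong)
    fix r assume r: "r \<in> {1..n}"
    show "{i. count m i \<ge> r} = {i \<in> set_mset m. count m i \<ge> r}"
      using r by (auto simp flip: count_greater_zero_iff)
    fix i assume "i \<in> {i \<in> set_mset m. count m i \<ge> r}"
    then have "r \<le> size m" using count_le_size[of m i] by auto
    then show "(if size m - r = n - r then 1 else 0) = (if size m = n then 1 else (0 :: 'a))" using r by auto
  qed simp
  also have "\<dots> = (if size m = n then of_nat (\<Sum>r=1..n. card {i \<in> set_mset m. count m i \<ge> r}) else 0)"
    by (auto)
  also have "\<dots> = (if size m = n then of_nat n else 0)"
  proof (cases "size m = n")
    case True
    have "(\<Sum>r=1..n. card {i \<in> set_mset m. count m i \<ge> r}) = (\<Sum>r=1..n. \<Sum>i\<in>set_mset m. if r \<le> count m i then 1 else 0)"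
      by (intro sum.cong refl) (simp add: sum.If_cases Int_def)
    also have "\<dots> = (\<Sum>i\<in>set_mset m. \<Sum>r=1..n. if r \<le> count m i then 1 else 0)" by (rule sum.swap)
    also have "\<dots> = (\<Sum>i\<in>set_mset m. count m i)"
    proof (intro sum.cong refl)
      fix i
      have "{1..n} \<inter> {r. r \<le> count m i} = {1..count m i}" using count_le_size[of m i] True by auto
      then show "(\<Sum>r=1..n. if r \<le> count m i then 1 else 0) = count m i" by (simp add: sum.If_cases)
    qed
    also have "\<dots> = n" using True by (simp add: size_multiset_overloaded_eq)
    finally show ?thesis by simp
  qed simp
  also have "\<dots> = coeff_sf (of_nat n * hsym n) m" by (simp add: coeff_sf_of_nat_mult hsym.rep_eq)
  finally show "coeff_sf (of_nat n * hsym n) m = coeff_sf (\<Sum>r=1..n. psym r * (hsym (n - r) :: 'a symfun)) m" by simp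
qed simp

text \<open>The squarefree factor is a choice of \<open>i\<close> of the distinct variables of
  \<open>m\<close>; the rest is then determined and has coefficient 1 in
  \<open>hsym\<close>.\<close>

lemma coeff_sf_esym_hsym:
  fixes i n :: nat
  assumes "i \<le> n"
  shows "coeff_sf (esym i * hsym (n - i) :: 'a :: comm_ring_1 symfun) m
       = (if size m = n then of_nat (card (set_mset m) choose i) else 0)"
proof -
  define \<Phi> where "\<Phi> A = (mset_set A, m - mset_set A)" for A :: "nat set"
  let ?S = "{A. A \<subseteq> set_mset m \<and> card A = i}"
  have sub: "mset_set A \<subseteq># m" if "A \<subseteq> set_mset m" for A
  proof -
    have "finite A" using that finite_subset by blast
    then show ?thesis using that by (auto simp: subseteq_mset_def count_mset_set' intro: Suc_leI)
  qed
  have "coeff_sf (esym i * hsym (n - i) :: 'a symfun) m = (\<Sum>(a, b) | a + b = m. coeff_sf (esym i) a * coeff_sf (hsym (n - i)) b)"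
    by (simp add: times_symfun.rep_eq)
  also have "\<dots> = (\<Sum>(a, b) \<in> \<Phi> ` ?S. coeff_sf (esym i) a * coeff_sf (hsym (n - i)) b)"
  proof (rule sum.mono_neutral_right[OF finite_mset_splits])
    show "\<Phi> ` ?S \<subseteq> {(a, b). a + b = m}" using sub by (auto simp: \<Phi>_def)
    show "\<forall>x\<in>{(a, b). a + b = m} - \<Phi> ` ?S. (case x of (a, b) \<Rightarrow> coeff_sf (esym i) a * coeff_sf (hsym (n - i)) b) = (0 :: 'a)"
    proof clarify
      fix a b assume m: "m = a + b" and not: "(a, b) \<notin> \<Phi> ` {A. A \<subseteq> set_mset (a + b) \<and> card A = i}"
      have "\<not> (size a = i \<and> (\<forall>j. count a j \<le> 1))"
      proof
        assume a: "size a = i \<and> (\<forall>j. count a j \<le> 1)"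
        have "count a j = count (mset_set (set_mset a)) j" for j
          using a[THEN conjunct2, rule_format, of j] by (cases "j \<in># a") (auto simp: not_in_iff count_greater_zero_iff[symmetric] simp del: count_greater_zero_iff)
        then have eq: "a = mset_set (set_mset a)" by (rule multiset_eqI)
        then have "card (set_mset a) = i" using a by (metis size_mset_set)
        then have "(a, b) \<in> \<Phi> ` {A. A \<subseteq> set_mset (a + b) \<and> card A = i}"
          using eq by (intro image_eqI[of _ _ "set_mset a"]) (auto simp: \<Phi>_def m)
        then show False using not by blast
      qed
      then have "coeff_sf (esym i) a = (0 :: 'a)" by (auto simp: esym.rep_eq)
      then show "coeff_sf (esym i) a * coeff_sf (hsym (n - i)) b = (0 :: 'a)" by simp
    qed
  qed
  also have "\<dots> = (\<Sum>A\<in>?S. if size m = n then 1 else 0)"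
  proof -
    have "inj_on \<Phi> ?S"
      by (auto simp: inj_on_def \<Phi>_def) (metis finite_set_mset finite_set_mset_mset_set finite_subset)+
    moreover have "coeff_sf (esym i) (mset_set A) * coeff_sf (hsym (n - i)) (m - mset_set A) = (if size m = n then 1 else (0 :: 'a))"
      if A: "A \<in> ?S" for A
    proof -
      have "size (m - mset_set A) = size m - i" using A sub[of A] by (simp add: size_Diff_submset)
      moreover have "i \<le> size m" using A sub[of A] size_mset_mono by fastforce
      ultimately show ?thesis using A assms by (auto simp: esym.rep_eq hsym.rep_eq count_mset_set')
    qed
    ultimately show ?thesis by (subst sum.reindex) (auto simp: \<Phi>_def intro!: sum.cong)
  qed
  also have "\<dots> = (if size m = n then of_nat (card (set_mset m) choose i) else 0)"
    by (auto simp: n_subsets)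
  finally show ?thesis .
qed

text \<open>At each monomial of degree n this is an alternating sum of binomials over its number of
  distinct variables, which is positive because n > 0 and at most n, so that no term is cut
  off.\<close>

lemma sum_esym_hsym:
  assumes "n > 0"
  shows "(\<Sum>i=0..n. (-1) ^ i * esym i * hsym (n - i)) = (0 :: 'a :: comm_ring_1 symfun)"
proof (rule symfun_eqI)
  fix m
  have sign: "coeff_sf ((-1) ^ i * F) m = (-1) ^ i * coeff_sf F m" for i and F :: "'a symfun"
    by (cases "even i") simp_all
  have "coeff_sf (\<Sum>i=0..n. (-1) ^ i * esym i * hsym (n - i) :: 'a symfun) m
      = (\<Sum>i=0..n. (-1) ^ i * (if size m = n then of_nat (card (set_mset m) choose i) else 0))"
    unfolding coeff_sf_sum mult.assoc sign by (intro sum.cong refl) (simp add: coeff_sf_esym_hsym)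
  also have "\<dots> = 0"
  proof (cases "size m = n")
    case True
    let ?c = "card (set_mset m)"
    have "0 \<notin> set (shape m)" using is_partition_shape[of m] by (simp add: is_partition_def)
    then have c: "?c \<le> n"
      using length_partition_le[of "shape m"] True by (simp add: length_shape sum_list_shape)
    have "m \<noteq> {#}" using True assms by auto
    then have c0: "?c > 0" by (simp add: card_gt_0_iff)
    have "(\<Sum>i=0..n. (-1) ^ i * (if size m = n then of_nat (?c choose i) else 0)) = (\<Sum>i=0..n. (-1) ^ i * of_nat (?c choose i) :: 'a)"
      using True by simp
    also have "\<dots> = (\<Sum>i\<le>?c. (-1) ^ i * of_nat (?c choose i))"
      using c by (intro sum.mono_neutral_right) (auto simp: binomial_eq_0)
    also have "\<dots> = 0" by (rule choose_alternating_sum[OF c0])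
    finally show ?thesis .
  qed simp
  finally show "coeff_sf (\<Sum>i=0..n. (-1) ^ i * esym i * hsym (n - i) :: 'a symfun) m = coeff_sf 0 m" by simp
qed

lemma newton_esym: "newton (\<lambda>r. - psym r) (\<lambda>n. (-1) ^ n * esym n :: 'a :: comm_ring_1 symfun)"
  by (rule newton_inverse[OF newton_hsym]) (simp_all add: sum_esym_hsym)

section \<open>Lattices and the basis of complete homogeneous functions\<close>

text \<open>The coefficients may form a ring of rational functions regular at given points, which
  gives a lattice that can be specialized, or only an ideal in such a ring. Hence an additive span
  of multiples instead of a linear span.\<close>

definition rspan :: "'a :: field set \<Rightarrow> 'a symfun set \<Rightarrow> 'a symfun set" where
  "rspan R B = additive_span {scale_sf c b | c b. c \<in> R \<and> b \<in> B}"

lemma rspan_zero [simp]: "0 \<in> rspan R B"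
  unfolding rspan_def by (rule additive_span.zero)

lemma rspan_plus: "x \<in> rspan R B \<Longrightarrow> y \<in> rspan R B \<Longrightarrow> x + y \<in> rspan R B"
  unfolding rspan_def by (rule additive_span_plus)

lemma rspan_sum: "(\<And>i. i \<in> I \<Longrightarrow> f i \<in> rspan R B) \<Longrightarrow> sum f I \<in> rspan R B"
  unfolding rspan_def by (rule additive_span_sum)

lemma rspan_gen: "c \<in> R \<Longrightarrow> b \<in> B \<Longrightarrow> scale_sf c b \<in> rspan R B"
  unfolding rspan_def by (intro additive_span_base) blast

lemma rspan_base: "subring_set R \<Longrightarrow> b \<in> B \<Longrightarrow> b \<in> rspan R B"
  using rspan_gen[of 1 R b B] subring_setD(1)[of R] by simp

lemma rspan_image:
  assumes "\<And>x y. f (x + y) = f x + f y" "f 0 = 0"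
    and "\<And>c b. c \<in> R \<Longrightarrow> b \<in> B \<Longrightarrow> f (scale_sf c b) \<in> rspan R' B'" and "x \<in> rspan R B"
  shows "f x \<in> rspan R' B'"
  using assms(4) unfolding rspan_def
  by (rule additive_span_image[where f = f, OF assms(1,2), rotated])
    (use assms(3) in \<open>auto simp: rspan_def\<close>)

lemma rspan_scale_general:
  assumes "\<And>d. d \<in> R \<Longrightarrow> c * d \<in> R'" "x \<in> rspan R B"
  shows "scale_sf c x \<in> rspan R' B"
  by (rule rspan_image[where f = "scale_sf c", OF _ _ _ assms(2)])
    (auto simp: sf.scale_right_distrib intro: rspan_gen assms(1))

lemma rspan_scale: "subring_set R \<Longrightarrow> c \<in> R \<Longrightarrow> x \<in> rspan R B \<Longrightarrow> scale_sf c x \<in> rspan R B"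
  by (rule rspan_scale_general) (auto intro: subring_setD(3))

lemma rspan_uminus: "subring_set R \<Longrightarrow> x \<in> rspan R B \<Longrightarrow> - x \<in> rspan R B"
  using rspan_scale[of R "-1" x B] subring_setD(6)[of R 1] subring_setD(1)[of R] by simp

lemma rspan_diff: "subring_set R \<Longrightarrow> x \<in> rspan R B \<Longrightarrow> y \<in> rspan R B \<Longrightarrow> x - y \<in> rspan R B"
  using rspan_plus[of x R B "- y"] rspan_uminus[of R y B] by simp

lemma rspan_mono: "x \<in> rspan R B \<Longrightarrow> R \<subseteq> R' \<Longrightarrow> B \<subseteq> B' \<Longrightarrow> x \<in> rspan R' B'"
  by (rule rspan_image[of "\<lambda>x. x", OF _ _ _]) (auto intro: rspan_gen)

lemma rspan_subset:
  assumes "subring_set R" "\<And>b. b \<in> B \<Longrightarrow> b \<in> rspan R B'" "x \<in> rspan R B"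
  shows "x \<in> rspan R B'"
  by (rule rspan_image[of "\<lambda>x. x", OF _ _ _ assms(3)]) (auto intro: rspan_scale assms)

lemma rspan_UNIV: "rspan UNIV B = sf.span B"
proof (intro subset_antisym subsetI)
  show "x \<in> sf.span B" if "x \<in> rspan UNIV B" for x
    using that unfolding rspan_def
    by induction (auto intro: sf.span_zero sf.span_add sf.span_scale sf.span_base)
  show "x \<in> rspan UNIV B" if "x \<in> sf.span B" for x
    using that
  proof (induction rule: sf.span_induct_alt)
    case (step c b y)
    then show ?case by (intro rspan_plus rspan_gen) auto
  qed simp
qed

section \<open>Products of generators, filtered by length\<close>

definition glist :: "(nat \<Rightarrow> 'b :: comm_monoid_mult) \<Rightarrow> nat list \<Rightarrow> 'b" where
  "glist g \<mu> = prod_list (map g \<mu>)"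

lemma glist_simps [simp]: "glist g [] = 1" "glist g (r # \<mu>) = g r * glist g \<mu>"
  by (simp_all add: glist_def)

lemma glist_append: "glist g (\<mu> @ \<nu>) = glist g \<mu> * glist g \<nu>"
  by (simp add: glist_def)

lemma plist_eq_glist: "plist = glist psym"
  by (simp add: fun_eq_iff plist_def glist_def)

lemma mset_partition_of_nonzero:
  assumes "0 \<notin> set \<mu>"
  shows "mset (partition_of \<mu>) = mset \<mu>"
proof -
  have "\<forall>x \<in># mset \<mu>. x \<noteq> 0" using assms by (auto intro!: gr0I)
  then show ?thesis unfolding mset_partition_of by (simp add: filter_mset_eq_conv)
qed

lemma glist_partition_of:
  assumes "0 \<notin> set \<mu> \<or> g 0 = 1"
  shows "glist g (partition_of \<mu>) = glist g \<mu>"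
  using assms
proof
  assume "0 \<notin> set \<mu>"
  then show ?thesis unfolding glist_def by (intro prod_list_mset_cong mset_partition_of_nonzero)
next
  assume "g 0 = 1"
  then show ?thesis unfolding glist_def by (rule prod_list_partition_of)
qed

lemma length_partition_of: "0 \<notin> set \<mu> \<Longrightarrow> length (partition_of \<mu>) = length \<mu>"
  by (metis mset_partition_of_nonzero size_mset)

text \<open>The length bound serves as a filtration for leading terms, as in \<open>hsym n\<close>
  being \<open>psym n\<close> divided by n up to products of at least two factors. With bound 0 the
  set indexes the whole component of degree \<open>n\<close>.\<close>

definition long_partitions :: "nat \<Rightarrow> nat \<Rightarrow> nat list set" where
  "long_partitions n k = {\<mu>. is_partition \<mu> \<and> sum_list \<mu> = n \<and> k \<le> length \<mu>}"

lemma rspan_glist_mult: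
  assumes R: "subring_set R" and f: "f \<in> rspan R (glist g ` long_partitions n k)"
    and h: "h \<in> rspan R (glist g ` long_partitions m l)"
  shows "f * h \<in> rspan R (glist g ` long_partitions (n + m) (k + l))"
proof (rule rspan_image[where f = "\<lambda>f. f * h", OF _ _ _ f])
  fix c b assume c: "c \<in> R" and "b \<in> glist g ` long_partitions n k"
  then obtain \<mu> where \<mu>: "\<mu> \<in> long_partitions n k" "b = glist g \<mu>" by blast
  have "scale_sf c (b * h) \<in> rspan R (glist g ` long_partitions (n + m) (k + l))"
  proof (intro rspan_scale R c rspan_image[where f = "\<lambda>h. b * h", OF _ _ _ h])
    fix d b' assume d: "d \<in> R" and "b' \<in> glist g ` long_partitions m l"
    then obtain \<nu> where \<nu>: "\<nu> \<in> long_partitions m l" "b' = glist g \<nu>" by blast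
    have z: "0 \<notin> set (\<mu> @ \<nu>)" using \<mu> \<nu> by (simp add: long_partitions_def is_partition_def)
    have "partition_of (\<mu> @ \<nu>) \<in> long_partitions (n + m) (k + l)"
      using \<mu> \<nu> length_partition_of[OF z]
      by (simp add: long_partitions_def is_partition_partition_of sum_list_partition_of)
    moreover have "b * b' = glist g (partition_of (\<mu> @ \<nu>))"
      using z by (simp add: \<mu> \<nu> glist_partition_of glist_append)
    ultimately show "b * scale_sf d b' \<in> rspan R (glist g ` long_partitions (n + m) (k + l))"
      unfolding mult_scale_sf using d by (intro rspan_gen) auto
  qed (auto simp: distrib_left)
  then show "scale_sf c b * h \<in> rspan R (glist g ` long_partitions (n + m) (k + l))"
    by (simp add: scale_sf_mult)
qed (auto simp: distrib_right)

lemma rspan_glist_one: "subring_set R \<Longrightarrow> 1 \<in> rspan R (glist g ` long_partitions 0 0)"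
  by (intro rspan_base) (auto simp: long_partitions_def is_partition_def image_iff intro!: exI[of _ "[]"])

lemma rspan_glist_single:
  "subring_set R \<Longrightarrow> n > 0 \<Longrightarrow> g n \<in> rspan R (glist g ` long_partitions n 1)"
  by (intro rspan_base) (auto simp: long_partitions_def is_partition_def image_iff intro!: exI[of _ "[n]"])

lemma rspan_long_mono:
  "x \<in> rspan R (glist g ` long_partitions n k) \<Longrightarrow> l \<le> k \<Longrightarrow> x \<in> rspan R (glist g ` long_partitions n l)"
  by (rule rspan_mono) (auto simp: long_partitions_def)

text \<open>Solving Newton's identities for \<open>hsym\<close> or \<open>esym\<close> divides by
  positive integers.\<close>

definition rational_subring :: "'a :: field_char_0 set \<Rightarrow> bool" where
  "rational_subring R \<longleftrightarrow> subring_set R \<and> (\<forall>n>0. 1 / of_nat n \<in> R)"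

lemma rational_subringD: "rational_subring R \<Longrightarrow> subring_set R" "rational_subring R \<Longrightarrow> n > 0 \<Longrightarrow> 1 / of_nat n \<in> R"
  by (auto simp: rational_subring_def)

lemma rational_subring_UNIV [simp]: "rational_subring UNIV"
  by (simp add: rational_subring_def)

lemma newton_solve:
  fixes x :: "nat \<Rightarrow> 'a :: field_char_0 symfun"
  assumes "newton y x" "n > 0"
  shows "x n = scale_sf (1 / of_nat n) (\<Sum>r=1..n. y r * x (n - r))"
proof -
  have "scale_sf (of_nat n) (x n) = (\<Sum>r=1..n. y r * x (n - r))"
    using newtonD(2)[OF assms(1), of n] by (simp only: of_nat_mult_sf)
  then have "scale_sf (1 / of_nat n) (scale_sf (of_nat n) (x n)) = scale_sf (1 / of_nat n) (\<Sum>r=1..n. y r * x (n - r))"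
    by (simp only:)
  then show ?thesis using assms(2) by simp
qed

text \<open>In Newton's identity for n the term r = n is \<open>y n\<close>, while every other term
  is a product of two factors of positive degree and so has at least two parts.\<close>

lemma newton_lattice:
  fixes x :: "nat \<Rightarrow> 'a :: field_char_0 symfun"
  assumes R: "rational_subring R" and xy: "newton y x"
    and y: "\<And>r. r > 0 \<Longrightarrow> y r \<in> rspan R (glist g ` long_partitions r 1)"
  shows "x n \<in> rspan R (glist g ` long_partitions n (if n = 0 then 0 else 1))"
    and "n > 0 \<Longrightarrow> x n - scale_sf (1 / of_nat n) (y n) \<in> rspan R (glist g ` long_partitions n 2)"
proof -
  note R' = rational_subringD(1)[OF R]
  have sum: "(\<Sum>r=1..<n. y r * x (n - r)) \<in> rspan R (glist g ` long_partitions n 2)"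
    if "\<And>k. k < n \<Longrightarrow> x k \<in> rspan R (glist g ` long_partitions k (if k = 0 then 0 else 1))" for n
  proof (rule rspan_sum)
    fix r assume r: "r \<in> {1..<n}"
    have "x (n - r) \<in> rspan R (glist g ` long_partitions (n - r) 1)"
      using that[of "n - r"] r by (simp)
    then have "y r * x (n - r) \<in> rspan R (glist g ` long_partitions (r + (n - r)) (1 + 1))"
      using r by (intro rspan_glist_mult R' y) auto
    then show "y r * x (n - r) \<in> rspan R (glist g ` long_partitions n 2)" using r by (simp add: numeral_2_eq_2)
  qed
  have split: "x n = scale_sf (1 / of_nat n) (y n) + scale_sf (1 / of_nat n) (\<Sum>r=1..<n. y r * x (n - r))"
    if "n > 0" for n
  proof -
    have "(\<Sum>r=1..n. y r * x (n - r)) = y n + (\<Sum>r=1..<n. y r * x (n - r))"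
      using that newtonD(1)[OF xy] by (simp add: sum.last_plus)
    then show ?thesis using newton_solve[OF xy that] by (simp add: sf.scale_right_distrib)
  qed
  have all: "x n \<in> rspan R (glist g ` long_partitions n (if n = 0 then 0 else 1))" for n
  proof (induction n rule: less_induct)
    case (less n)
    show ?case
    proof (cases "n = 0")
      case True
      then show ?thesis using newtonD(1)[OF xy] rspan_glist_one[OF R'] by simp
    next
      case False
      then have "scale_sf (1 / of_nat n) (y n) + scale_sf (1 / of_nat n) (\<Sum>r=1..<n. y r * x (n - r))
          \<in> rspan R (glist g ` long_partitions n 1)"
        by (intro rspan_plus rspan_scale R' rational_subringD(2)[OF R] y rspan_long_mono[OF sum[OF less.IH]]) auto
      then show ?thesis using False split[of n] by (simp)
    qed
  qed
  then show "x n \<in> rspan R (glist g ` long_partitions n (if n = 0 then 0 else 1))" .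
  assume n: "n > 0"
  have "x n - scale_sf (1 / of_nat n) (y n) = scale_sf (1 / of_nat n) (\<Sum>r=1..<n. y r * x (n - r))"
    using split[OF n] by simp
  then show "x n - scale_sf (1 / of_nat n) (y n) \<in> rspan R (glist g ` long_partitions n 2)"
    using rspan_scale[OF R' rational_subringD(2)[OF R n] sum[OF all]] by simp
qed

lemma rspan_long_weaken:
  "x \<in> rspan R (glist g ` long_partitions n (if n = 0 then 0 else 1)) \<Longrightarrow> x \<in> rspan R (glist g ` long_partitions n 0)"
  by (erule rspan_long_mono) simp

lemma hsym_lattice:
  assumes "rational_subring R"
  shows "hsym n \<in> rspan R (glist psym ` long_partitions n (if n = 0 then 0 else 1))"
    and "n > 0 \<Longrightarrow> hsym n - scale_sf (1 / of_nat n) (psym n) \<in> rspan R (glist psym ` long_partitions n 2)"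
  using newton_lattice[OF assms newton_hsym, of psym n] rspan_glist_single[OF rational_subringD(1)[OF assms], of _ psym]
  by auto

lemma esym_lattice:
  fixes R :: "'a :: field_char_0 set"
  assumes R: "rational_subring R"
  shows "esym n \<in> rspan R (glist psym ` long_partitions n 0)"
proof -
  note R' = rational_subringD(1)[OF R]
  have "(-1) ^ n * esym n \<in> rspan R (glist psym ` long_partitions n 0)"
    by (intro rspan_long_weaken newton_lattice(1)[OF R newton_esym] rspan_uminus R' rspan_glist_single)
  moreover have "esym n = (-1 :: 'a symfun) ^ n * ((-1) ^ n * esym n)"
    by (simp flip: mult.assoc power_mult_distrib)
  moreover have "(-1) ^ n * F \<in> rspan R B" if "F \<in> rspan R B" for F :: "'a symfun" and B
    using that by (cases "even n") (auto intro: rspan_uminus R')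
  ultimately show ?thesis by metis
qed

lemma glist_lattice:
  assumes R: "subring_set R" and x: "\<And>n. n > 0 \<Longrightarrow> x n \<in> rspan R (glist g ` long_partitions n 1)"
    and "0 \<notin> set \<mu>"
  shows "glist x \<mu> \<in> rspan R (glist g ` long_partitions (sum_list \<mu>) (length \<mu>))"
  using assms(3)
proof (induction \<mu>)
  case Nil
  then show ?case using rspan_glist_one[OF R] by simp
next
  case (Cons r \<mu>)
  then have "x r * glist x \<mu> \<in> rspan R (glist g ` long_partitions (r + sum_list \<mu>) (1 + length \<mu>))"
    by (intro rspan_glist_mult R x) auto
  then show ?case by simp
qed

text \<open>In this direction Newton's identity is solved for the power sum, which occurs with
  coefficient 1, so nothing is divided.\<close>

lemma psym_lattice:
  fixes R :: "'a :: field_char_0 set"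
  assumes "subring_set R" "n > 0"
  shows "psym n \<in> rspan R (glist hsym ` long_partitions n 1)"
  using assms(2)
proof (induction n rule: less_induct)
  case (less n)
  have "(\<Sum>r=1..n. psym r * hsym (n - r) :: 'a symfun) = psym n + (\<Sum>r=1..<n. psym r * hsym (n - r))"
    using less.prems by (simp add: sum.last_plus)
  moreover have "of_nat n * (hsym n :: 'a symfun) = (\<Sum>r=1..n. psym r * hsym (n - r))"
    by (rule newtonD(2)[OF newton_hsym])
  ultimately have "(psym n :: 'a symfun) = scale_sf (of_nat n) (hsym n) - (\<Sum>r=1..<n. psym r * hsym (n - r))"
    by (simp add: of_nat_mult_sf)
  also have "\<dots> \<in> rspan R (glist hsym ` long_partitions n 1)"
  proof (intro rspan_diff rspan_scale rspan_sum assms rspan_glist_single less.prems subring_set_of_nat)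
    fix r assume r: "r \<in> {1..<n}"
    then have "psym r * hsym (n - r) \<in> rspan R (glist hsym ` long_partitions (r + (n - r)) (1 + 1))"
      by (intro rspan_glist_mult assms less.IH rspan_glist_single) auto
    then show "psym r * hsym (n - r) \<in> rspan R (glist hsym ` long_partitions n 1)"
      using r by (intro rspan_long_mono[where k = 2 and l = 1]) (auto simp: numeral_2_eq_2)
  qed
  finally show ?case .
qed

text \<open>The two generating sets serve different purposes: scalings of the alphabet are diagonal
  on power sums, whereas dominance triangularity is visible on complete functions.\<close>

lemma rspan_psym_eq_hsym:
  fixes R :: "'a :: field_char_0 set"
  assumes "rational_subring R"
  shows "rspan R (glist psym ` long_partitions n 0) = rspan R (glist hsym ` long_partitions n 0)"
proof (intro subset_antisym subsetI)
  note R = rational_subringD(1)[OF assms]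
  fix x :: "'a symfun"
  show "x \<in> rspan R (glist hsym ` long_partitions n 0)" if "x \<in> rspan R (glist psym ` long_partitions n 0)"
    using that
  proof (rule rspan_subset[OF R, rotated])
    fix b :: "'a symfun" assume "b \<in> glist psym ` long_partitions n 0"
    then obtain \<mu> where "0 \<notin> set \<mu>" "sum_list \<mu> = n" "b = glist psym \<mu>"
      by (auto simp: long_partitions_def is_partition_def)
    then show "b \<in> rspan R (glist hsym ` long_partitions n 0)"
      using glist_lattice[OF R psym_lattice[OF R], of \<mu>] by (auto intro: rspan_long_mono)
  qed
  show "x \<in> rspan R (glist psym ` long_partitions n 0)" if "x \<in> rspan R (glist hsym ` long_partitions n 0)"
    using that
  proof (rule rspan_subset[OF R, rotated])
    fix b :: "'a symfun" assume "b \<in> glist hsym ` long_partitions n 0"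
    then obtain \<mu> where "0 \<notin> set \<mu>" "sum_list \<mu> = n" "b = glist hsym \<mu>"
      by (auto simp: long_partitions_def is_partition_def)
    moreover have "hsym k \<in> rspan R (glist psym ` long_partitions k 1)" if "k > 0" for k
      using hsym_lattice(1)[OF assms, of k] that by (simp)
    ultimately show "b \<in> rspan R (glist psym ` long_partitions n 0)"
      using glist_lattice[OF R, of hsym psym \<mu>] by (auto intro: rspan_long_mono)
  qed
qed

text \<open>Relative to power sums, h_\<mu> has leading term p_\<mu> divided by the product of the
  parts, and the remaining terms have more parts.\<close>

lemma hsym_basis: "basis_family partitions (glist hsym :: _ \<Rightarrow> 'a :: field_char_0 symfun)"
proof -
  define L where "L \<mu> \<nu> \<longleftrightarrow> sum_list \<nu> = sum_list \<mu> \<and> length \<nu> > length \<mu>" for \<mu> \<nu> :: "nat list"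
  define c :: "nat list \<Rightarrow> 'a" where "c \<mu> = glist (\<lambda>r. 1 / of_nat r) \<mu>" for \<mu>
  have z: "0 \<notin> set \<mu>" if "\<mu> \<in> partitions" for \<mu> using that by (simp add: is_partition_def)
  have "finite {\<nu> \<in> partitions. L \<mu> \<nu>}" for \<mu>
    by (rule finite_subset[OF _ finite_partitions_le[of "sum_list \<mu>"]]) (auto simp: L_def)
  moreover have c0: "c \<mu> \<noteq> 0" if "\<mu> \<in> partitions" for \<mu>
    using z[OF that] by (induction \<mu>) (auto simp: c_def)
  have eq: "long_partitions (sum_list \<mu>) (Suc (length \<mu>)) = {\<nu> \<in> partitions. L \<mu> \<nu>}" for \<mu>
    by (auto simp: long_partitions_def L_def)
  moreover have "glist hsym \<mu> - scale_sf (c \<mu>) (glist psym \<mu>) \<in> sf.span (glist psym ` {\<nu> \<in> partitions. L \<mu> \<nu>})"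
    if "\<mu> \<in> partitions" for \<mu>
    unfolding rspan_UNIV[symmetric] eq[symmetric] using z[OF that]
  proof (induction \<mu>)
    case Nil
    then show ?case by (simp add: c_def)
  next
    case (Cons r \<mu>)
    have "(hsym k :: 'a symfun) \<in> rspan UNIV (glist psym ` long_partitions k 1)" if "k > 0" for k
      using hsym_lattice(1)[of UNIV k] that by (simp)
    then have "(glist hsym \<mu> :: 'a symfun) \<in> rspan UNIV (glist psym ` long_partitions (sum_list \<mu>) (length \<mu>))"
      using Cons.prems by (intro glist_lattice) auto
    then have "(hsym r - scale_sf (1 / of_nat r) (psym r)) * (glist hsym \<mu> :: 'a symfun)
        \<in> rspan UNIV (glist psym ` long_partitions (r + sum_list \<mu>) (2 + length \<mu>))"
      using Cons.prems by (intro rspan_glist_mult hsym_lattice(2)) auto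
    moreover have "scale_sf (1 / of_nat r) (psym r) * (glist hsym \<mu> - scale_sf (c \<mu>) (glist psym \<mu>))
        \<in> rspan UNIV (glist psym ` long_partitions (r + sum_list \<mu>) (1 + Suc (length \<mu>)))"
      using Cons by (intro rspan_glist_mult rspan_scale rspan_glist_single) auto
    \<comment> \<open>The error of a product telescopes: ab - a'b' = (a - a') b + a' (b -
      b').\<close>
    moreover have "glist hsym (r # \<mu>) - scale_sf (c (r # \<mu>)) (glist psym (r # \<mu>))
        = (hsym r - scale_sf (1 / of_nat r) (psym r)) * glist hsym \<mu>
        + scale_sf (1 / of_nat r) (psym r) * (glist hsym \<mu> - scale_sf (c \<mu>) (glist psym \<mu>))"
      by (simp add: c_def algebra_simps scale_sf_mult mult_scale_sf)
    ultimately show ?case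
      using rspan_plus by (simp del: glist_simps)
  qed
  moreover have "\<not> L \<mu> \<mu>" "L \<mu> \<nu> \<Longrightarrow> L \<nu> \<rho> \<Longrightarrow> L \<mu> \<rho>" for \<mu> \<nu> \<rho> by (auto simp: L_def)
  ultimately show ?thesis
    by (intro triangular_basis(1)[OF plist_basis[unfolded plist_eq_glist], where R = L and c = c]) (use c0 in blast)+
qed

text \<open>Relates the lattices to \<open>homogeneous_sf\<close>, on which the branches of
  \<open>Theta\<close> depend.\<close>

lemma homogeneous_psym_span:
  assumes "F \<in> rspan R (glist psym ` long_partitions n k)"
  shows "homogeneous_sf n (F :: 'a :: field_char_0 symfun)"
  unfolding homogeneous_sf_def
proof (intro allI impI)
  fix m assume "coeff_sf F m \<noteq> 0"
  with assms show "size m = n"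
    unfolding rspan_def
  proof (induction rule: additive_span.induct)
    case (add x y)
    show ?case
    proof (cases "coeff_sf y m = 0")
      case True
      then have "coeff_sf x m \<noteq> 0" using add.prems by simp
      then obtain \<mu> where \<mu>: "0 \<notin> set \<mu>" "sum_list \<mu> = n" "coeff_sf (plist \<mu> :: 'a symfun) m \<noteq> 0"
        using add.hyps(1) by (auto simp: long_partitions_def is_partition_def plist_eq_glist)
      then show ?thesis
        using coeff_sf_plist[OF \<mu>(1), where 'a = 'a, of m] by (metis gr0I of_nat_0)
    qed (use add in simp)
  qed simp
qed

section \<open>Evaluations\<close>

interpretation scalar_id: scalar_map "\<lambda>c :: 'a :: field_char_0. c"
  by unfold_locales auto

text \<open>Specialization to a single variable with value 1. In degree n it turns out to be the
  pairing with h_n.\<close>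

definition eval_h :: "'a :: field_char_0 symfun \<Rightarrow> 'a" where
  "eval_h = scalar_id.psym_hom (\<lambda>r. 1)"

text \<open>The involution exchanging e and h, followed by specialization to one variable with value
  1; the value at p_r is (-1)^(r-1), written without subtraction in the exponent. In degree n it is
  the pairing with e_n.\<close>

definition eval_e :: "'a :: field_char_0 symfun \<Rightarrow> 'a" where
  "eval_e = scalar_id.psym_hom (\<lambda>r. - ((-1) ^ r))"

lemmas eval_h_simps = scalar_id.psym_hom_one[of "\<lambda>r. 1", folded eval_h_def]
  scalar_id.psym_hom_zero[of "\<lambda>r. 1", folded eval_h_def]
  scalar_id.psym_hom_add[of "\<lambda>r. 1", folded eval_h_def]
  scalar_id.psym_hom_mult[of "\<lambda>r. 1", folded eval_h_def]
  scalar_id.psym_hom_scale[of "\<lambda>r. 1", folded eval_h_def]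
  scalar_id.psym_hom_sum[of "\<lambda>r. 1", folded eval_h_def]

lemmas eval_e_simps = scalar_id.psym_hom_one[of "\<lambda>r. - ((-1) ^ r)", folded eval_e_def]
  scalar_id.psym_hom_zero[of "\<lambda>r. - ((-1) ^ r)", folded eval_e_def]
  scalar_id.psym_hom_add[of "\<lambda>r. - ((-1) ^ r)", folded eval_e_def]
  scalar_id.psym_hom_mult[of "\<lambda>r. - ((-1) ^ r)", folded eval_e_def]
  scalar_id.psym_hom_scale[of "\<lambda>r. - ((-1) ^ r)", folded eval_e_def]
  scalar_id.psym_hom_sum[of "\<lambda>r. - ((-1) ^ r)", folded eval_e_def]

lemma newton_cong:
  assumes "newton y x" "\<And>r. r > 0 \<Longrightarrow> y r = y' r"
  shows "newton y' x"
proof (rule newtonI)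
  fix n
  have "of_nat n * x n = (\<Sum>r=1..n. y r * x (n - r))" by (rule newtonD(2)[OF assms(1)])
  also have "\<dots> = (\<Sum>r=1..n. y' r * x (n - r))" using assms(2) by (intro sum.cong) auto
  finally show "of_nat n * x n = (\<Sum>r=1..n. y' r * x (n - r))" .
qed (rule newtonD(1)[OF assms(1)])

context scalar_map
begin

lemma newton_psym_hom_hsym: "newton g (\<lambda>n. psym_hom g (hsym n))"
  by (rule newton_cong[OF newton_map[OF newton_hsym, of "psym_hom g"]])
    (auto simp: psym_hom_one psym_hom_add psym_hom_mult psym_hom_psym)

lemma newton_psym_hom_esym: "newton (\<lambda>r. - g r) (\<lambda>n. psym_hom g ((-1) ^ n * esym n))"
proof (rule newton_cong[OF newton_map[OF newton_esym, of "psym_hom g"]])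
  fix r :: nat assume "r > 0"
  moreover have "psym_hom g (- F) = - psym_hom g F" for F
    using psym_hom_add[of g F "- F"] psym_hom_zero[of g] by (simp add: eq_neg_iff_add_eq_0 add.commute)
  ultimately show "psym_hom g (- psym r) = - g r" by (simp add: psym_hom_psym)
qed (auto simp: psym_hom_one psym_hom_add psym_hom_mult psym_hom_psym)

end

lemma eval_h_hsym: "eval_h (hsym n) = 1"
proof (rule newton_unique[OF torsion_free_field scalar_id.newton_psym_hom_hsym[of "\<lambda>r. 1", folded eval_h_def]])
  show "newton (\<lambda>r. 1) (\<lambda>n. 1 :: 'a)" by (rule newtonI) auto
qed simp

text \<open>The value is e_n in one variable. In Newton's identity for n \<ge> 2 only the terms r =
  n-1 and r = n survive, and they cancel.\<close>

lemma eval_e_hsym: "eval_e (hsym n) = (if n \<le> 1 then 1 else 0)"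
proof (rule newton_unique[OF torsion_free_field scalar_id.newton_psym_hom_hsym[of "\<lambda>r. - ((-1) ^ r)", folded eval_e_def]])
  show "newton (\<lambda>r. - ((-1) ^ r)) (\<lambda>n. if n \<le> 1 then 1 else 0 :: 'a)"
  proof (rule newtonI)
    fix n :: nat
    show "of_nat n * (if n \<le> 1 then 1 else 0) = (\<Sum>r=1..n. - ((-1) ^ r) * (if n - r \<le> 1 then 1 else 0 :: 'a))"
    proof (cases "n \<le> 1")
      case True
      then consider "n = 0" | "n = 1" by linarith
      then show ?thesis by cases auto
    next
      case False
      then have "(\<Sum>r=1..n. - ((-1) ^ r) * (if n - r \<le> 1 then 1 else 0 :: 'a))
          = (\<Sum>r\<in>{n - 1, n}. - ((-1) ^ r) * (if n - r \<le> 1 then 1 else 0 :: 'a))"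
        by (intro sum.mono_neutral_right) auto
      also have "\<dots> = - ((-1) ^ (n - 1)) - (-1) ^ n" using False by simp
      also have "\<dots> = 0" using False by (cases n) auto
      finally show ?thesis using False by simp
    qed
  qed simp
qed simp

lemma eval_e_uminus: "eval_e (- F) = - eval_e F"
  using eval_e_simps(5)[of "-1" F] by simp

lemma eval_e_sign_esym: "eval_e ((-1) ^ n * esym n) = (-1) ^ n"
proof (rule newton_unique[OF torsion_free_field scalar_id.newton_psym_hom_esym[of "\<lambda>r. - ((-1) ^ r)", folded eval_e_def]])
  show "newton (\<lambda>r. (-1) ^ r) (\<lambda>n. (-1) ^ n :: 'a)"
    by (rule newtonI) (auto simp flip: power_add)
qed simp

lemma eval_e_esym: "eval_e (esym n) = (1 :: 'a :: field_char_0)"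
  using eval_e_sign_esym[of n, where 'a = 'a] by (cases "even n") (simp_all add: eval_e_uminus)

section \<open>Dominance order and Schur functions\<close>

definition part :: "nat list \<Rightarrow> nat \<Rightarrow> nat" where
  "part \<mu> i = (if i < length \<mu> then \<mu> ! i else 0)"

lemma sum_list_take_Suc: "sum_list (take (Suc k) \<mu>) = sum_list (take k \<mu>) + part \<mu> k"
  by (simp add: part_def take_Suc_conv_app_nth)

lemma sum_list_take: "sum_list (take k \<mu>) = (\<Sum>i<k. part \<mu> i)"
  by (induction k) (simp_all add: sum_list_take_Suc del: take_Suc)

lemma partition_eq_partI:
  assumes "is_partition \<mu>" "is_partition \<nu>" "\<And>i. part \<mu> i = part \<nu> i"
  shows "\<mu> = \<nu>"
proof -
  have *: "i < length \<rho> \<longleftrightarrow> part \<rho> i > 0" if "is_partition \<rho>" for \<rho> i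
    using that unfolding is_partition_def part_def by (metis less_numeral_extra(3) nth_mem gr0I)
  have "i < length \<mu> \<longleftrightarrow> i < length \<nu>" for i using assms * by simp
  then have len: "length \<mu> = length \<nu>" by (metis linorder_neqE_nat less_irrefl)
  show ?thesis
    by (rule nth_equalityI[OF len]) (use assms(3) len in \<open>simp add: part_def split: if_splits\<close>, metis)
qed

lemma part_antimono:
  assumes "is_partition \<mu>" "i \<le> j"
  shows "part \<mu> j \<le> part \<mu> i"
proof (cases "i = j \<or> j \<ge> length \<mu>")
  case False
  then show ?thesis using assms sorted_wrt_nth_less[of "(\<ge>)" \<mu> i j] by (auto simp: is_partition_def part_def)
qed (auto simp: part_def)

text \<open>The order of the arguments matches \<open>triangular_basis\<close>: the second partition
  is the higher one and occurs in the error of the first.\<close>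

definition below :: "nat list \<Rightarrow> nat list \<Rightarrow> bool" where
  "below \<mu> \<nu> \<longleftrightarrow> is_partition \<mu> \<and> is_partition \<nu> \<and> dominates \<nu> \<mu> \<and> \<nu> \<noteq> \<mu>"

lemma dominates_antisym:
  assumes "is_partition \<mu>" "is_partition \<nu>" "dominates \<mu> \<nu>" "dominates \<nu> \<mu>"
  shows "\<mu> = \<nu>"
proof (rule partition_eq_partI[OF assms(1,2)])
  have eq: "sum_list (take k \<mu>) = sum_list (take k \<nu>)" for k
    using assms(3,4) by (simp add: dominates_def antisym)
  show "part \<mu> i = part \<nu> i" for i
  proof -
    have "sum_list (take i \<mu>) + part \<mu> i = sum_list (take i \<nu>) + part \<nu> i"
      using eq[of "Suc i"] unfolding sum_list_take_Suc .
    then show ?thesis using eq[of i] by linarith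
  qed
qed

lemma dominates_refl: "dominates \<mu> \<mu>"
  by (simp add: dominates_def)

lemma dominates_trans: "dominates \<rho> \<nu> \<Longrightarrow> dominates \<nu> \<mu> \<Longrightarrow> dominates \<rho> \<mu>"
  unfolding dominates_def by (metis order_trans)

lemma below_irrefl: "\<not> below \<mu> \<mu>"
  by (simp add: below_def)

lemma below_trans: "below \<mu> \<nu> \<Longrightarrow> below \<nu> \<rho> \<Longrightarrow> below \<mu> \<rho>"
  unfolding below_def by (metis dominates_antisym dominates_trans)

lemma sum_list_below: "below \<mu> \<nu> \<Longrightarrow> sum_list \<nu> = sum_list \<mu>"
  by (simp add: below_def dominates_def)

lemma finite_below: "finite {\<nu> \<in> partitions. below \<mu> \<nu>}"
  by (rule finite_subset[OF _ finite_partitions_le[of "sum_list \<mu>"]]) (auto dest: sum_list_below)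

lemma dominating_set_eq:
  "is_partition \<mu> \<Longrightarrow> {\<nu>. is_partition \<nu> \<and> dominates \<nu> \<mu>} = {\<nu> \<in> partitions. \<nu> = \<mu> \<or> below \<mu> \<nu>}"
  by (auto simp: below_def dominates_refl)

text \<open>An exchange against the largest part \<open>x\<close>: if \<open>x\<close> belongs to
  \<open>A\<close> it is removed there, otherwise any element of \<open>A\<close> is removed, being
  at most \<open>x\<close> and leaving a submultiset of the tail.\<close>

lemma sum_mset_le_take:
  fixes \<nu> :: "nat list"
  assumes "sorted_wrt (\<ge>) \<nu>" "A \<subseteq># mset \<nu>" "size A \<le> k"
  shows "sum_mset A \<le> sum_list (take k \<nu>)"
  using assms
proof (induction \<nu> arbitrary: A k)
  case (Cons x \<nu>)
  show ?case
  proof (cases "A = {#}")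
    case False
    then obtain k' where k: "k = Suc k'" using Cons.prems(3) by (cases k) auto
    have "\<exists>y. y \<in># A \<and> y \<le> x \<and> A - {#y#} \<subseteq># mset \<nu>"
    proof (cases "x \<in># A")
      case True
      then show ?thesis
        using Cons.prems(2) by (intro exI[of _ x]) (auto simp: subset_eq_diff_conv)
    next
      case False
      then have sub: "A \<subseteq># mset \<nu>"
        using Cons.prems(2) by (metis diff_single_trivial mset.simps(2) subset_eq_diff_conv add_mset_add_single)
      obtain y where y: "y \<in># A" using \<open>A \<noteq> {#}\<close> by blast
      then have "y \<in> set \<nu>" using sub by (metis mset_subset_eqD set_mset_mset)
      then show ?thesis
        using y Cons.prems(1) sub by (intro exI[of _ y]) (auto intro: subset_mset.order_trans[OF diff_subset_eq_self])
    qed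
    then obtain y where y: "y \<in># A" "y \<le> x" "A - {#y#} \<subseteq># mset \<nu>" by blast
    have "sum_mset (A - {#y#}) \<le> sum_list (take k' \<nu>)"
      using Cons.prems(1,3) y k by (intro Cons.IH) (auto simp: size_Diff_singleton)
    moreover have "sum_mset A = y + sum_mset (A - {#y#})"
    proof -
      have "sum_mset (add_mset y (A - {#y#})) = y + sum_mset (A - {#y#})" by simp
      then show ?thesis unfolding insert_DiffM[OF y(1)] .
    qed
    ultimately show ?thesis using y(2) k by simp
  qed simp
qed simp

lemma sum_list_take_le_partition_of: "sum_list (take k \<alpha>) \<le> sum_list (take k (partition_of \<alpha>))"
proof -
  let ?A = "filter_mset (\<lambda>x. x \<noteq> 0) (mset (take k \<alpha>))"
  have "mset (take k \<alpha>) \<subseteq># mset \<alpha>"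
    by (metis append_take_drop_id mset_append mset_subset_eq_add_left)
  then have "?A \<subseteq># mset (partition_of \<alpha>)" unfolding mset_partition_of by (rule multiset_filter_mono)
  moreover have "size ?A \<le> k"
    using size_filter_mset_lesseq[of _ "mset (take k \<alpha>)"] by (rule order_trans) simp
  ultimately have "sum_mset ?A \<le> sum_list (take k (partition_of \<alpha>))"
    using is_partition_partition_of[of \<alpha>] by (intro sum_mset_le_take) (auto simp: is_partition_def)
  moreover have "sum_mset (filter_mset (\<lambda>x. x \<noteq> 0) (mset \<beta>)) = sum_list \<beta>" for \<beta> :: "nat list"
    by (induction \<beta>) auto
  ultimately show ?thesis by metis
qed

text \<open>Sorting can only enlarge partial sums, so comparisons made with an unsorted composition
  survive; the strict inequality rules out equality.\<close>

lemma below_partition_of: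
  assumes \<mu>: "is_partition \<mu>" and len: "sum_list \<alpha> = sum_list \<mu>"
    and le: "\<And>k. sum_list (take k \<mu>) \<le> sum_list (take k \<alpha>)"
    and less: "sum_list (take r \<mu>) < sum_list (take r \<alpha>)"
  shows "below \<mu> (partition_of \<alpha>)"
proof -
  have "dominates (partition_of \<alpha>) \<mu>"
    unfolding dominates_def
    using len le sum_list_take_le_partition_of by (auto simp: sum_list_partition_of intro: order_trans)
  moreover have "partition_of \<alpha> \<noteq> \<mu>"
    using less sum_list_take_le_partition_of[of r \<alpha>] by auto
  ultimately show ?thesis using \<mu> by (simp add: below_def is_partition_partition_of)
qed

text \<open>Induction on finite sets of naturals: the maximum of a set with k+1 elements is at least
  k.\<close>

lemma sum_le_sum_inj:
  fixes p :: "nat \<Rightarrow> nat"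
  assumes "inj_on p {..<k}"
  shows "(\<Sum>i<k. i) \<le> (\<Sum>i<k. p i)"
proof -
  have *: "(\<Sum>i<card S. i) \<le> \<Sum> S" if "finite S" for S :: "nat set"
    using that
  proof (induction "card S" arbitrary: S)
    case (Suc k)
    then have ne: "S \<noteq> {}" by auto
    then have M: "Max S \<in> S" using Suc by simp
    have "S \<subseteq> {..Max S}" using Suc.prems by auto
    then have "Suc k \<le> Suc (Max S)" using card_mono[of "{..Max S}" S] Suc.hyps(2) by simp
    moreover have "card (S - {Max S}) = k" using Suc M by simp
    then have "(\<Sum>i<k. i) \<le> \<Sum> (S - {Max S})" using Suc.hyps(1)[of "S - {Max S}"] Suc.prems by auto
    moreover have "\<Sum> S = Max S + \<Sum> (S - {Max S})" by (rule sum.remove[OF Suc.prems M])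
    moreover have "(\<Sum>i<card S. i) = (\<Sum>i<k. i) + k" unfolding Suc.hyps(2)[symmetric] by simp
    ultimately show ?case by linarith
  qed simp
  have "(\<Sum>i<k. p i) = \<Sum> (p ` {..<k})" using assms by (simp add: sum.reindex)
  then show ?thesis using *[of "p ` {..<k}"] assms by (simp add: card_image)
qed

text \<open>In the Jacobi-Trudi determinant a permutation p contributes h of the composition with
  entries \<mu>_i + p(i) - i. Its partial sums are at least those of \<mu>, with a strict gain at
  the first index moved by p.\<close>

lemma schur_triangular:
  assumes \<mu>: "is_partition \<mu>"
  shows "schur \<mu> - glist hsym \<mu> \<in> rspan UNIV (glist hsym ` {\<nu> \<in> partitions. below \<mu> \<nu>} :: 'a :: field symfun set)"
proof -
  define n where "n = length \<mu>"
  define A :: "'a symfun mat" where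
    "A = mat n n (\<lambda>(i, j). if i \<le> \<mu> ! i + j then hsym (\<mu> ! i + j - i) else 0)"
  define tm where "tm p = signof p * (\<Prod>i = 0..<n. A $$ (i, p i))" for p
  have "schur \<mu> = det A" by (simp add: schur_def A_def n_def)
  also have "\<dots> = (\<Sum>p | p permutes {0..<n}. tm p)"
    unfolding tm_def by (rule det_def'[of A n]) (simp add: A_def)
  also have "\<dots> = tm id + (\<Sum>p\<in>{p. p permutes {0..<n}} - {id}. tm p)"
    by (rule sum.remove) (simp_all add: finite_permutations permutes_id)
  also have "tm id = glist hsym \<mu>"
  proof -
    have "tm id = (\<Prod>i = 0..<n. hsym (\<mu> ! i))" by (simp add: tm_def A_def)
    also have "\<dots> = glist hsym (map ((!) \<mu>) [0..<n])" by (simp add: glist_def prod.list_conv_set_nth)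
    finally show ?thesis by (simp add: n_def map_nth)
  qed
  finally have schur: "schur \<mu> = glist hsym \<mu> + (\<Sum>p\<in>{p. p permutes {0..<n}} - {id}. tm p)" .
  have "schur \<mu> - glist hsym \<mu> = (\<Sum>p\<in>{p. p permutes {0..<n}} - {id}. tm p)"
    unfolding schur by (rule add_diff_cancel_left')
  also have "\<dots> \<in> rspan UNIV (glist hsym ` {\<nu> \<in> partitions. below \<mu> \<nu>})"
  proof (rule rspan_sum)
    fix p assume "p \<in> {p. p permutes {0..<n}} - {id}"
    then have p: "p permutes {0..<n}" "p \<noteq> id" by auto
    show "tm p \<in> rspan UNIV (glist hsym ` {\<nu> \<in> partitions. below \<mu> \<nu>})"
    proof (cases "\<forall>i<n. i \<le> \<mu> ! i + p i")
      \<comment> \<open>Here the product contains an entry with negative index, which is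
        zero.\<close>
      case False
      then obtain i where i: "i < n" "\<not> i \<le> \<mu> ! i + p i" by blast
      then have "A $$ (i, p i) = 0" using permutes_in_image[OF p(1), of i] by (simp add: A_def)
      then have "(\<Prod>i = 0..<n. A $$ (i, p i)) = 0" using i(1) by (intro prod_zero) auto
      then show ?thesis by (simp add: tm_def)
    next
      case True
      define \<alpha> where "\<alpha> = map (\<lambda>i. \<mu> ! i + p i - i) [0..<n]"
      have prod: "(\<Prod>i = 0..<n. A $$ (i, p i)) = glist hsym \<alpha>"
      proof -
        have "(\<Prod>i = 0..<n. A $$ (i, p i)) = (\<Prod>i = 0..<n. hsym (\<mu> ! i + p i - i))"
          using True permutes_in_image[OF p(1)] by (intro prod.cong) (auto simp: A_def)
        also have "\<dots> = glist hsym \<alpha>" by (simp add: glist_def \<alpha>_def prod.list_conv_set_nth)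
        finally show ?thesis .
      qed
      have take: "sum_list (take k \<alpha>) + (\<Sum>i<k. i) = sum_list (take k \<mu>) + (\<Sum>i<k. p i)" if "k \<le> n" for k
      proof -
        have "sum_list (take k \<alpha>) + (\<Sum>i<k. i) = (\<Sum>i<k. \<mu> ! i + p i - i + i)"
          using that by (simp add: sum_list_take part_def \<alpha>_def sum.distrib)
        also have "\<dots> = (\<Sum>i<k. \<mu> ! i + p i)" using True that by (intro sum.cong) auto
        also have "\<dots> = sum_list (take k \<mu>) + (\<Sum>i<k. p i)"
          using that by (simp add: sum_list_take part_def sum.distrib n_def)
        finally show ?thesis .
      qed
      have inj: "inj_on p {..<k}" for k using permutes_inj[OF p(1)] by (rule inj_on_subset) simp
      have le: "sum_list (take k \<mu>) \<le> sum_list (take k \<alpha>)" if "k \<le> n" for k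
        using take[OF that] sum_le_sum_inj[OF inj, of k] by linarith
      have "(\<Sum>i<n. p i) = (\<Sum>i<n. i)"
        using sum.permute[OF p(1), of "\<lambda>i. i"] by (simp add: lessThan_atLeast0)
      then have total: "sum_list \<alpha> = sum_list \<mu>" using take[of n] by (simp add: n_def \<alpha>_def)
      have le': "sum_list (take k \<mu>) \<le> sum_list (take k \<alpha>)" for k
        using le[of k] total by (cases "k \<le> n") (simp_all add: n_def \<alpha>_def)
      define i where "i = (LEAST i. p i \<noteq> i)"
      have "\<exists>i. p i \<noteq> i" using p(2) by auto
      then have i: "p i \<noteq> i" unfolding i_def by (rule LeastI_ex)
      have less_i: "p j = j" if "j < i" for j using not_less_Least[of j "\<lambda>i. p i \<noteq> i"] that by (simp add: i_def)
      have "i < n" using i p(1) by (meson atLeastLessThan_iff permutes_not_in zero_le)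
      \<comment> \<open>Smaller values are already taken by the fixed points before
        \<open>i\<close>.\<close>
      have "p i > i"
      proof (rule ccontr)
        assume "\<not> p i > i"
        then have "p i < i" using i by simp
        then have "p (p i) = p i" by (rule less_i)
        then show False using i permutes_inj[OF p(1)] by (metis injD)
      qed
      then have "sum_list (take (Suc i) \<mu>) < sum_list (take (Suc i) \<alpha>)"
        using take[of "Suc i"] \<open>i < n\<close> less_i by simp
      then have "below \<mu> (partition_of \<alpha>)"
        by (rule below_partition_of[OF \<mu> total le'])
      then have "glist hsym (partition_of \<alpha>) \<in> rspan UNIV (glist hsym ` {\<nu> \<in> partitions. below \<mu> \<nu>} :: 'a symfun set)"
        by (intro rspan_base) (auto simp: is_partition_partition_of)
      then have *: "glist hsym \<alpha> \<in> rspan UNIV (glist hsym ` {\<nu> \<in> partitions. below \<mu> \<nu>} :: 'a symfun set)"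
        by (simp add: glist_partition_of)
      then show ?thesis
        unfolding tm_def prod by (cases "sign p = 1") (auto simp: sign_def intro: rspan_uminus)
    qed
  qed
  finally show ?thesis .
qed

text \<open>The statement on spans lets the flags in the definition of Macdonald polynomials be
  described by products of \<open>hsym\<close>.\<close>

lemma schur_basis: "basis_family partitions (schur :: _ \<Rightarrow> 'a :: field_char_0 symfun)"
  and span_schur_eq: "is_partition \<mu> \<Longrightarrow>
    sf.span (schur ` {\<nu> \<in> partitions. \<nu> = \<mu> \<or> below \<mu> \<nu>})
    = sf.span (glist hsym ` {\<nu> \<in> partitions. \<nu> = \<mu> \<or> below \<mu> \<nu>} :: 'a symfun set)"
proof -
  have tri: "schur \<mu> - scale_sf 1 (glist hsym \<mu>) \<in> sf.span (glist hsym ` {\<nu> \<in> partitions. below \<mu> \<nu>} :: 'a symfun set)"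
    if "\<mu> \<in> partitions" for \<mu>
    using schur_triangular[of \<mu>] that by (simp add: rspan_UNIV)
  note * = triangular_basis[OF hsym_basis below_irrefl below_trans finite_below _ tri]
  show "basis_family partitions (schur :: _ \<Rightarrow> 'a :: field_char_0 symfun)"
    by (rule *(1)) auto
  show "sf.span (schur ` {\<nu> \<in> partitions. \<nu> = \<mu> \<or> below \<mu> \<nu>})
    = sf.span (glist hsym ` {\<nu> \<in> partitions. \<nu> = \<mu> \<or> below \<mu> \<nu>} :: 'a symfun set)" if "is_partition \<mu>"
    by (rule *(2)) (use that in auto)
qed

lemma span_schur_degree:
  "sf.span (glist hsym ` long_partitions n 0) \<subseteq> sf.span (schur ` long_partitions n 0 :: 'a :: field_char_0 symfun set)"
proof (rule sf.span_minimal)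
  show "glist hsym ` long_partitions n 0 \<subseteq> sf.span (schur ` long_partitions n 0 :: 'a symfun set)"
  proof clarify
    fix \<mu> assume \<mu>: "\<mu> \<in> long_partitions n 0"
    then have p: "is_partition \<mu>" by (simp add: long_partitions_def)
    have "glist hsym \<mu> \<in> sf.span (schur ` {\<nu> \<in> partitions. \<nu> = \<mu> \<or> below \<mu> \<nu>} :: 'a symfun set)"
      unfolding span_schur_eq[OF p] using p by (intro sf.span_base) auto
    moreover have "{\<nu> \<in> partitions. \<nu> = \<mu> \<or> below \<mu> \<nu>} \<subseteq> long_partitions n 0"
      using \<mu> by (auto simp: long_partitions_def dest: sum_list_below)
    ultimately show "glist hsym \<mu> \<in> sf.span (schur ` long_partitions n 0 :: 'a symfun set)"
      using sf.span_mono[OF image_mono] by blast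
  qed
qed (rule sf.subspace_span)

section \<open>Evaluations of Schur functions, and the one-row and one-column cases\<close>

lemma det_zero_row:
  fixes A :: "'a :: comm_ring_1 mat"
  assumes "A \<in> carrier_mat n n" "i < n" "\<And>j. j < n \<Longrightarrow> A $$ (i, j) = 0"
  shows "det A = 0"
  unfolding det_def'[OF assms(1)]
proof (intro sum.neutral ballI)
  fix p assume "p \<in> {p. p permutes {0..<n}}"
  then have "p i < n" using assms(2) permutes_in_image[of p "{0..<n}" i] by simp
  then have "A $$ (i, p i) = 0" by (rule assms(3))
  then have "(\<Prod>i = 0..<n. A $$ (i, p i)) = 0" using assms(2) by (intro prod_zero) auto
  then show "signof p * (\<Prod>i = 0..<n. A $$ (i, p i)) = 0" by simp
qed

text \<open>Every h of nonnegative index becomes 1, so with at least two parts the first two rows of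
  the determinant are both constant 1.\<close>

lemma eval_h_schur:
  assumes "is_partition \<mu>"
  shows "eval_h (schur \<mu> :: 'a :: field_char_0 symfun) = (if length \<mu> \<le> 1 then 1 else 0)"
proof -
  interpret hom: comm_ring_hom "eval_h :: 'a symfun \<Rightarrow> 'a"
    by unfold_locales (auto simp: eval_h_simps)
  define n where "n = length \<mu>"
  define A :: "'a mat" where "A = mat n n (\<lambda>(i, j). if i \<le> \<mu> ! i + j then 1 else 0)"
  have "eval_h (schur \<mu> :: 'a symfun) = det A"
    unfolding schur_def hom.hom_det[symmetric]
    by (rule arg_cong[where f = det], rule eq_matI) (auto simp: A_def n_def eval_h_hsym)
  also have "\<dots> = (if n \<le> 1 then 1 else 0)"
  proof (cases "n \<le> 1")
    case True
    then consider "n = 0" | "n = 1" by linarith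
    then show ?thesis
    proof cases
      case 2
      have "det A = prod_list (diag_mat A)"
        by (rule det_lower_triangular[of n]) (auto simp: A_def 2)
      then show ?thesis by (simp add: A_def diag_mat_def 2)
    qed (simp add: A_def)
  next
    case False
    have "\<mu> ! 1 \<ge> 1" using assms False unfolding is_partition_def n_def
      by (metis Suc_leI gr0I nth_mem One_nat_def not_le)
    then have "row A 0 = row A 1" using False by (intro eq_vecI) (auto simp: A_def)
    then have "det A = 0" using False by (intro det_identical_rows[of A n 0 1]) (auto simp: A_def)
    then show ?thesis using False by simp
  qed
  finally show ?thesis by (simp add: n_def)
qed

text \<open>Only h_0 and h_1 survive. If the first part is at least 2 the first row vanishes; for a
  single column the matrix is lower triangular with unit diagonal.\<close>

lemma eval_e_schur:
  assumes "is_partition \<mu>"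
  shows "eval_e (schur \<mu> :: 'a :: field_char_0 symfun) = (if \<mu> = replicate (length \<mu>) 1 then 1 else 0)"
proof -
  interpret hom: comm_ring_hom "eval_e :: 'a symfun \<Rightarrow> 'a"
    by unfold_locales (auto simp: eval_e_simps)
  define n where "n = length \<mu>"
  define A :: "'a mat" where "A = mat n n (\<lambda>(i, j). if i \<le> \<mu> ! i + j \<and> \<mu> ! i + j \<le> Suc i then 1 else 0)"
  have "eval_e (schur \<mu> :: 'a symfun) = det A"
    unfolding schur_def hom.hom_det[symmetric]
    by (rule arg_cong[where f = det], rule eq_matI) (auto simp: A_def n_def eval_e_hsym eval_e_simps)
  also have "\<dots> = (if \<mu> = replicate n 1 then 1 else 0)"
  proof (cases "\<mu> = replicate n 1")
    case True
    then have m: "\<mu> ! i = 1" if "i < n" for i using that by (metis nth_replicate)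
    have "det A = prod_list (diag_mat A)"
      by (rule det_lower_triangular[of n]) (auto simp: A_def m)
    also have "diag_mat A = replicate n 1"
      by (rule nth_equalityI) (auto simp: A_def diag_mat_def m)
    finally show ?thesis using True by simp
  next
    case False
    have pos: "\<mu> ! i > 0" if "i < n" for i
      using assms that unfolding is_partition_def n_def by (metis gr0I nth_mem)
    obtain i where i: "i < n" "\<mu> ! i \<noteq> 1"
      using False by (metis n_def nth_replicate length_replicate nth_equalityI)
    then have "\<mu> ! i \<ge> 2" using pos[of i] by simp
    moreover have "\<mu> ! i \<le> \<mu> ! 0" using part_antimono[OF assms, of 0 i] i(1) by (auto simp: part_def n_def split: if_splits)
    ultimately have "\<mu> ! 0 \<ge> 2" by simp
    then have "det A = 0" using i by (intro det_zero_row[of A n 0]) (auto simp: A_def)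
    then show ?thesis using False by simp
  qed
  finally show ?thesis by (simp add: n_def)
qed

lemma schur_single: "schur [n] = hsym n"
proof -
  let ?A = "mat 1 1 (\<lambda>(i, j). if i \<le> [n] ! i + j then hsym ([n] ! i + j - i) else 0)"
  have "det ?A = prod_list (diag_mat ?A)"
    by (rule det_lower_triangular[of 1]) auto
  then show ?thesis by (simp add: schur_def diag_mat_def)
qed

lemma schur_Nil: "schur [] = 1"
  by (simp add: schur_def)

text \<open>Cramer's rule for the last unknown of a system whose right side is concentrated in row
  0. Expanding along the replaced column leaves e_n times a unitriangular minor, and the two signs
  cancel.\<close>

lemma schur_column: "schur (replicate n 1) = (esym n :: 'a :: comm_ring_1 symfun)"
proof (cases "n = 0")
  case False
  define A :: "'a symfun mat" where "A = mat n n (\<lambda>(i, j). if i \<le> 1 + j then hsym (1 + j - i) else 0)"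
  \<comment> \<open>The last entry is e_0 = 1, so Cramer's rule returns the determinant of
    \<open>A\<close> itself.\<close>
  define x where "x = vec n (\<lambda>j. (-1) ^ (n - 1 - j) * (esym (n - 1 - j) :: 'a symfun))"
  have A: "A \<in> carrier_mat n n" by (simp add: A_def)
  have Ax: "A *\<^sub>v x = vec n (\<lambda>i. if i = 0 then (-1) ^ (n - 1) * esym n else 0)"
  proof (rule eq_vecI)
    fix i assume "i < dim_vec (vec n (\<lambda>i. if i = 0 then (-1) ^ (n - 1) * (esym n :: 'a symfun) else 0))"
    then have i: "i < n" by simp
    let ?f = "\<lambda>b. (-1) ^ b * (esym b :: 'a symfun) * hsym (n - i - b)"
    have "(A *\<^sub>v x) $ i = (\<Sum>j = 0..<n. (if i \<le> 1 + j then hsym (1 + j - i) else 0) * ((-1) ^ (n - 1 - j) * esym (n - 1 - j)))"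
      using i by (simp add: A_def x_def scalar_prod_def)
    \<comment> \<open>With b = n-1-j, row i becomes the alternating sum of degree n-i. In row 0 the
      range stops at n-1, and the missing term b = n is the only source of a nonzero entry.\<close>
    also have "\<dots> = (\<Sum>b = 0..<n. (if b \<le> n - i then ?f b else 0))"
      by (rule sum.reindex_bij_witness[of _ "\<lambda>b. n - 1 - b" "\<lambda>j. n - 1 - j"])
        (use i in \<open>auto simp: mult_ac Suc_diff_le intro!: arg_cong[where f = hsym]\<close>)
    also have "\<dots> = (if i = 0 then (-1) ^ (n - 1) * esym n else 0)"
    proof (cases "i = 0")
      case True
      have "(\<Sum>b = 0..<n. (if b \<le> n - i then ?f b else 0)) = (\<Sum>b = 0..<n. (-1) ^ b * esym b * hsym (n - b))"
        using True by (intro sum.cong) auto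
      also have "\<dots> = - ((-1) ^ n * esym n)"
        using sum_esym_hsym[of n, where 'a = 'a] False by (simp add: sum.last_plus add_eq_0_iff)
      also have "\<dots> = (-1) ^ (n - 1) * esym n" using False by (cases n) simp_all
      finally show ?thesis using True by simp
    next
      case False
      have "(\<Sum>b = 0..<n. (if b \<le> n - i then ?f b else 0)) = (\<Sum>b = 0..n - i. ?f b)"
        using False i by (intro sum.mono_neutral_cong_right) auto
      also have "\<dots> = 0" using i by (intro sum_esym_hsym) simp
      finally show ?thesis using False by simp
    qed
    finally show "(A *\<^sub>v x) $ i = vec n (\<lambda>i. if i = 0 then (-1) ^ (n - 1) * esym n else 0) $ i" using i by simp
  qed (simp add: A_def)
  define B where "B = replace_col A (A *\<^sub>v x) (n - 1)"
  have dim: "dim_row A = n" "dim_col A = n" using A by auto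
  have B: "B \<in> carrier_mat n n" unfolding B_def replace_col_def dim by simp
  have last: "B $$ (i, n - 1) = (if i = 0 then (-1) ^ (n - 1) * esym n else 0)" if "i < n" for i
    using that False unfolding B_def replace_col_def dim Ax by simp
  have other: "B $$ (i, j) = A $$ (i, j)" if "i < n" "j < n - 1" for i j
    using that unfolding B_def replace_col_def dim by simp
  define C where "C = mat_delete B 0 (n - 1)"
  have C: "C \<in> carrier_mat (n - 1) (n - 1)" using B by (simp add: C_def mat_delete_def)
  have C_entry: "C $$ (i, j) = (if i \<le> j then hsym (j - i) else 0)" if "i < n - 1" "j < n - 1" for i j
  proof -
    have "C $$ (i, j) = B $$ (Suc i, j)" using that B by (auto simp: C_def mat_delete_def)
    then show ?thesis using that other[of "Suc i" j] by (auto simp: A_def)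
  qed
  have "det C = prod_list (diag_mat C)"
    by (rule det_upper_triangular[OF _ C]) (use C C_entry in \<open>auto simp: upper_triangular_def\<close>)
  also have "diag_mat C = replicate (n - 1) 1"
    by (rule nth_equalityI) (use C C_entry in \<open>auto simp: diag_mat_def\<close>)
  finally have C1: "det C = 1" by simp
  have "det B = x $ (n - 1) * det A"
    unfolding B_def using False by (intro cramer_lemma_mat[OF A]) (auto simp: x_def)
  also have "x $ (n - 1) = 1" using False by (simp add: x_def)
  finally have dB: "det B = det A" by simp
  have "det B = (\<Sum>i<n. B $$ (i, n - 1) * cofactor B i (n - 1))"
    using False by (intro laplace_expansion_column[OF B]) simp
  also have "\<dots> = (\<Sum>i\<in>{0}. B $$ (i, n - 1) * cofactor B i (n - 1))"
    using False by (intro sum.mono_neutral_right) (auto simp: last[unfolded One_nat_def])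
  also have "\<dots> = (-1) ^ (n - 1) * esym n * (-1) ^ (n - 1)"
    using False C1 by (simp add: cofactor_def last[unfolded One_nat_def] C_def)
  also have "\<dots> = esym n" by (cases "even (n - 1)") simp_all
  finally have "det B = esym n" .
  moreover have "schur (replicate n 1) = det A"
    unfolding schur_def by (rule arg_cong[where f = det]) (auto simp: A_def)
  ultimately show ?thesis using dB by simp
qed (simp add: schur_Nil)

section \<open>The Hall product with h_n and e_n\<close>

lemma vector_space_field: "vector_space ((*) :: 'a :: field \<Rightarrow> 'a \<Rightarrow> 'a)"
  by unfold_locales (simp_all add: algebra_simps)

text \<open>The form given by the dot product of Schur coordinates satisfies the definition, and
  bilinearity together with the Schur expansion forces every candidate to equal it.\<close>

lemma hall_schur:
  fixes F :: "'a :: field_char_0 symfun"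
  assumes \<mu>: "is_partition \<mu>"
  shows "hall F (schur \<mu>) = coordinate partitions schur F \<mu>"
proof -
  let ?c = "coordinate partitions (schur :: _ \<Rightarrow> 'a symfun)"
  note sb = schur_basis[where 'a = 'a]
  define B where "B F G = (\<Sum>\<mu> | ?c G \<mu> \<noteq> 0. ?c F \<mu> * ?c G \<mu>)" for F G
  have B_sup: "B F G = (\<Sum>\<mu>\<in>L. ?c F \<mu> * ?c G \<mu>)" if "finite L" "{\<mu>. ?c G \<mu> \<noteq> 0} \<subseteq> L" for F G L
    unfolding B_def using that by (intro sum.mono_neutral_left) auto
  have B_schur: "B F (schur \<mu>) = ?c F \<mu>" if "is_partition \<mu>" for F \<mu>
    using that by (subst B_sup[of "{\<mu>}"]) (auto simp: coordinate_basis[OF sb] split: if_splits)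
  have "is_hall_product B"
    unfolding is_hall_product_def Vector_Spaces.linear_iff
  proof (intro conjI allI impI vector_space_scale_sf vector_space_field)
    fix F G H and c
    have fin: "finite ({\<mu>. ?c G \<mu> \<noteq> 0} \<union> {\<mu>. ?c H \<mu> \<noteq> 0})" using finite_coordinate[OF sb] by blast
    have "{\<mu>. ?c (G + H) \<mu> \<noteq> 0} \<subseteq> {\<mu>. ?c G \<mu> \<noteq> 0} \<union> {\<mu>. ?c H \<mu> \<noteq> 0}"
        "{\<mu>. ?c (scale_sf c G) \<mu> \<noteq> 0} \<subseteq> {\<mu>. ?c G \<mu> \<noteq> 0} \<union> {\<mu>. ?c H \<mu> \<noteq> 0}"
      by (auto simp: coordinate_add[OF sb] coordinate_scale[OF sb])
    note sup = B_sup[OF fin this(1)] B_sup[OF fin this(2)] B_sup[OF fin Un_upper1] B_sup[OF fin Un_upper2]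
    show "B F (G + H) = B F G + B F H" "B F (scale_sf c G) = c * B F G"
      unfolding sup by (simp_all add: coordinate_add[OF sb] coordinate_scale[OF sb] distrib_left
          sum.distrib sum_distrib_left mult_ac)
    show "B (G + H) F = B G F + B H F" "B (scale_sf c G) F = c * B G F"
      by (auto simp: B_def coordinate_add[OF sb] coordinate_scale[OF sb] algebra_simps sum.distrib sum_distrib_left)
  next
    fix \<nu> \<mu> assume "is_partition \<nu>" "is_partition \<mu>"
    then show "B (schur \<nu>) (schur \<mu>) = (if \<nu> = \<mu> then 1 else 0)"
      by (simp add: B_schur coordinate_basis[OF sb])
  qed
  moreover have "B' = B" if "is_hall_product B'" for B'
  proof (intro ext)
    fix F G
    have lin: "B' F (G + H) = B' F G + B' F H" "B' F (scale_sf c G) = c * B' F G"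
      "B' (G + H) F = B' G F + B' H F" "B' (scale_sf c G) F = c * B' G F" for F G H c
      using that unfolding is_hall_product_def Vector_Spaces.linear_iff by blast+
    have zero: "B' F 0 = 0" "B' 0 F = 0" for F using lin(2)[of F 0 0] lin(4)[of 0 0 F] by simp_all
    have sum: "B' F (sum f I) = (\<Sum>i\<in>I. B' F (f i))" "B' (sum f I) F = (\<Sum>i\<in>I. B' (f i) F)" for F f and I :: "nat list set"
      by (induction I rule: infinite_finite_induct) (auto simp: zero lin)
    have one: "B' F (schur \<mu>) = ?c F \<mu>" if \<mu>: "is_partition \<mu>" for F \<mu>
    proof -
      have "B' F (schur \<mu>) = (\<Sum>\<nu> | ?c F \<nu> \<noteq> 0. ?c F \<nu> * B' (schur \<nu>) (schur \<mu>))"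
        by (subst (1) coordinate_expand[OF sb, of F]) (simp add: sum lin)
      also have "\<dots> = (\<Sum>\<nu> | ?c F \<nu> \<noteq> 0. if \<nu> = \<mu> then ?c F \<nu> else 0)"
        using \<open>is_hall_product B'\<close> \<mu> coordinate_in[OF sb, of F]
        by (intro sum.cong) (auto simp: is_hall_product_def)
      also have "\<dots> = ?c F \<mu>" using finite_coordinate[OF sb, of F] by simp
      finally show ?thesis .
    qed
    have "B' F G = (\<Sum>\<mu> | ?c G \<mu> \<noteq> 0. ?c G \<mu> * B' F (schur \<mu>))"
      by (subst (1) coordinate_expand[OF sb, of G]) (simp add: sum lin)
    also have "\<dots> = B F G"
      unfolding B_def using coordinate_in[OF sb, of G] by (intro sum.cong) (auto simp: one)
    finally show "B' F G = B F G" .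
  qed
  ultimately have "hall = B" unfolding hall_def by (rule the_equality)
  then show ?thesis using B_schur[OF \<mu>] by simp
qed

text \<open>A linear functional on the degree n component is determined by its values on the Schur
  functions of that degree.\<close>

lemma coordinate_schur_eq:
  fixes F :: "'a :: field_char_0 symfun"
  assumes F: "F \<in> rspan UNIV (glist hsym ` long_partitions n 0)"
    and E: "\<And>F G. E (F + G) = E F + E G" "\<And>c F. E (scale_sf c F) = c * E F"
    and \<mu>: "is_partition \<mu>"
    and ES: "\<And>\<nu>. \<nu> \<in> long_partitions n 0 \<Longrightarrow> E (schur \<nu>) = (if \<nu> = \<mu> then 1 else 0)"
  shows "hall F (schur \<mu>) = E F"
proof -
  have "F \<in> sf.span (schur ` long_partitions n 0)"
    using F span_schur_degree unfolding rspan_UNIV by blast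
  then show ?thesis
  proof (induction rule: sf.span_induct_alt)
    case base
    show ?case using E(2)[of 0 0] by (simp add: hall_schur[OF \<mu>] coordinate_zero[OF schur_basis])
  next
    case (step c S y)
    then obtain \<nu> where \<nu>: "\<nu> \<in> long_partitions n 0" "S = schur \<nu>" by blast
    then have "coordinate partitions schur S \<mu> = E S"
      by (simp add: ES coordinate_basis[OF schur_basis] long_partitions_def)
    then show ?case
      using step.IH by (simp add: E hall_schur[OF \<mu>] coordinate_add[OF schur_basis] coordinate_scale[OF schur_basis])
  qed
qed

lemma hall_hsym:
  fixes F :: "'a :: field_char_0 symfun"
  assumes "F \<in> rspan UNIV (glist hsym ` long_partitions n 0)"
  shows "hall F (hsym n) = eval_h F"
proof -
  \<comment> \<open>The list \<open>[0]\<close> is not a partition, so degree 0 is represented by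
    the empty list.\<close>
  define \<mu> where "\<mu> = (if n = 0 then [] else [n])"
  have \<mu>: "is_partition \<mu>" by (simp add: \<mu>_def is_partition_def)
  have "hall F (schur \<mu>) = eval_h F"
  proof (rule coordinate_schur_eq[OF assms _ _ \<mu>])
    fix \<nu> assume \<nu>: "\<nu> \<in> long_partitions n 0"
    have "length \<nu> \<le> 1 \<longleftrightarrow> \<nu> = \<mu>"
    proof (cases \<nu> rule: list.exhaust[case_names Nil Cons])
      case Nil
      then show ?thesis using \<nu> by (simp add: \<mu>_def long_partitions_def)
    next
      case (Cons x xs)
      then show ?thesis using \<nu> by (cases xs) (auto simp: \<mu>_def long_partitions_def is_partition_def)
    qed
    then show "eval_h (schur \<nu>) = (if \<nu> = \<mu> then 1 else (0 :: 'a))"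
      using \<nu> by (simp add: eval_h_schur long_partitions_def)
  qed (simp_all add: eval_h_simps)
  then show ?thesis by (simp add: \<mu>_def schur_single schur_Nil split: if_splits)
qed

lemma hall_esym:
  fixes F :: "'a :: field_char_0 symfun"
  assumes "F \<in> rspan UNIV (glist hsym ` long_partitions n 0)"
  shows "hall F (esym n) = eval_e F"
proof -
  have \<mu>: "is_partition (replicate n 1)" by (simp add: is_partition_def sorted_wrt_iff_nth_less)
  have "hall F (schur (replicate n 1)) = eval_e F"
  proof (rule coordinate_schur_eq[OF assms _ _ \<mu>])
    fix \<nu> assume \<nu>: "\<nu> \<in> long_partitions n 0"
    have "\<nu> = replicate (length \<nu>) 1 \<longleftrightarrow> \<nu> = replicate n 1"
    proof
      assume *: "\<nu> = replicate (length \<nu>) 1"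
      have "sum_list \<nu> = sum_list (replicate (length \<nu>) 1)" using * by (rule arg_cong)
      then have "sum_list \<nu> = length \<nu>" by (simp add: sum_list_replicate)
      then have "length \<nu> = n" using \<nu> by (simp add: long_partitions_def)
      with * show "\<nu> = replicate n 1" by simp
    qed simp
    then show "eval_e (schur \<nu>) = (if \<nu> = replicate n 1 then 1 else (0 :: 'a))"
      using \<nu> by (simp add: eval_e_schur long_partitions_def)
  qed (simp_all add: eval_e_simps)
  then show ?thesis unfolding schur_column .
qed

section \<open>The vertex operator\<close>

lemma coeff_of_nat_mult: "coeff (of_nat n * p) k = of_nat n * coeff (p :: 'b :: comm_ring_1 poly) k"
  by (induction n) (simp_all add: distrib_right)

lemma torsion_free_symfun_poly: "torsion_free TYPE('a :: field_char_0 symfun poly)"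
  unfolding torsion_free_def
proof (intro allI impI)
  fix n :: nat and p :: "'a symfun poly"
  assume n: "n > 0" and p: "of_nat n * p = 0"
  have "of_nat n * coeff p k = 0" for k using arg_cong[OF p, of "\<lambda>p. coeff p k"] by (simp add: coeff_of_nat_mult)
  then have "coeff p k = 0" for k using torsion_free_symfun[unfolded torsion_free_def, rule_format, OF n] by blast
  then show "p = 0" by (simp add: poly_eq_iff)
qed

abbreviation poly_const :: "'a :: field_char_0 \<Rightarrow> 'a symfun poly" where
  "poly_const c \<equiv> [:scale_sf c 1:]"

interpretation poly_scalar: scalar_map "poly_const :: 'a :: field_char_0 \<Rightarrow> _"
  by unfold_locales (simp_all add: sf.scale_left_distrib scale_sf_mult one_pCons)

lemma coeff_poly_const_mult: "coeff (poly_const c * f) k = scale_sf c (coeff f k)"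
  by (simp add: scale_sf_mult)

text \<open>Plethystic addition: for \<open>c\<^sub>r = C[p\<^sub>r]\<close> this is \<open>F[X + C w]\<close> as a polynomial in \<open>w\<close>.\<close>

definition shift_hom :: "(nat \<Rightarrow> 'a :: field_char_0) \<Rightarrow> 'a symfun \<Rightarrow> 'a symfun poly" where
  "shift_hom c = poly_scalar.psym_hom (\<lambda>r. [:psym r:] + monom (scale_sf (c r) 1) r)"

lemmas shift_hom_simps =
  poly_scalar.psym_hom_one[of "\<lambda>r. [:psym r:] + monom (scale_sf (c r) 1) r" for c, folded shift_hom_def]
  poly_scalar.psym_hom_add[of "\<lambda>r. [:psym r:] + monom (scale_sf (c r) 1) r" for c, folded shift_hom_def]
  poly_scalar.psym_hom_mult[of "\<lambda>r. [:psym r:] + monom (scale_sf (c r) 1) r" for c, folded shift_hom_def]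
  poly_scalar.psym_hom_scale[of "\<lambda>r. [:psym r:] + monom (scale_sf (c r) 1) r" for c, folded shift_hom_def]
  poly_scalar.psym_hom_psym[of _ "\<lambda>r. [:psym r:] + monom (scale_sf (c r) 1) r" for c, folded shift_hom_def]

text \<open>The constant term in w of \<open>f\<close> times the series of the g_k w^(-k), expressed
  without negative powers.\<close>

definition pairing :: "(nat \<Rightarrow> 'b :: comm_ring_1) \<Rightarrow> 'b poly \<Rightarrow> 'b" where
  "pairing g f = (\<Sum>k\<le>degree f. g k * coeff f k)"

lemma pairing_bound: "degree f \<le> N \<Longrightarrow> pairing g f = (\<Sum>k\<le>N. g k * coeff f k)"
  unfolding pairing_def by (intro sum.mono_neutral_left) (auto simp: coeff_eq_0)

lemma pairing_add: "pairing g (f + h) = pairing g f + pairing g h"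
proof -
  define N where "N = max (degree f) (degree h)"
  have "degree (f + h) \<le> N" "degree f \<le> N" "degree h \<le> N"
    by (auto simp: N_def degree_add_le)
  then show ?thesis by (simp add: pairing_bound[where N = N] distrib_left sum.distrib)
qed

lemma pairing_0: "pairing g 0 = 0"
  by (simp add: pairing_def)

lemma pairing_sum: "pairing g (sum f I) = (\<Sum>i\<in>I. pairing g (f i))"
  by (induction I rule: infinite_finite_induct) (simp_all add: pairing_0 pairing_add)

lemma pairing_const_mult: "pairing g ([:x:] * f) = x * pairing g f"
proof -
  have "degree ([:x:] * f) \<le> degree f" by (simp add: degree_smult_le)
  then show ?thesis
    by (subst pairing_bound) (auto simp: pairing_def sum_distrib_left mult_ac)
qed

lemma pairing_monom: "pairing g (monom x k) = g k * x"
  by (subst pairing_bound[of _ k]) (auto simp: degree_monom_le if_distrib cong: if_cong)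

text \<open>General in both arguments, because conjugation by a scaling of the alphabet turns one
  such operator into another: D_0 and its triangular form are both instances.\<close>

definition vertex_op :: "(nat \<Rightarrow> 'a :: field_char_0) \<Rightarrow> (nat \<Rightarrow> 'a symfun) \<Rightarrow> 'a symfun \<Rightarrow> 'a symfun" where
  "vertex_op c g F = pairing g (shift_hom c F)"

lemma vertex_op_add: "vertex_op c g (F + G) = vertex_op c g F + vertex_op c g G"
  by (simp add: vertex_op_def shift_hom_simps pairing_add)

lemma vertex_op_scale: "vertex_op c g (scale_sf a F) = scale_sf a (vertex_op c g F)"
  unfolding vertex_op_def shift_hom_simps pairing_const_mult by (simp add: scale_sf_mult)

lemma vertex_op_0: "vertex_op c g 0 = 0"
  using vertex_op_scale[of c g 0 0] by simp

lemma alphabet_scaling_simps: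
  "alphabet_scaling s 1 = 1" "alphabet_scaling s 0 = 0"
  "alphabet_scaling s (F + G) = alphabet_scaling s F + alphabet_scaling s G"
  "alphabet_scaling s (F * G) = alphabet_scaling s F * alphabet_scaling s G"
  "alphabet_scaling s (scale_sf a F) = scale_sf a (alphabet_scaling s F)"
  "alphabet_scaling s (sum f I) = (\<Sum>i\<in>I. alphabet_scaling s (f i))"
  "r > 0 \<Longrightarrow> alphabet_scaling s (psym r) = scale_sf (s r) (psym r)"
  by (simp_all add: scale_one.psym_hom_one scale_one.psym_hom_zero scale_one.psym_hom_add
      scale_one.psym_hom_mult alphabet_scaling_scale scale_one.psym_hom_sum scale_one.psym_hom_psym)

text \<open>On a generator both sides are s_r p_r + c_r w^r, the right one factored as s_r (p_r +
  (c_r / s_r) w^r).\<close>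

lemma alphabet_scaling_shift:
  assumes s: "\<And>r. r > 0 \<Longrightarrow> s r \<noteq> (0 :: 'a :: field_char_0)"
  shows "alphabet_scaling s (coeff (shift_hom c F) k) = coeff (shift_hom (\<lambda>r. c r / s r) (alphabet_scaling s F)) k"
proof (induction F arbitrary: k rule: symfun_induct)
  case one
  show ?case by (simp add: shift_hom_simps alphabet_scaling_simps coeff_1)
next
  case (psym r F)
  have *: "alphabet_scaling s (coeff (shift_hom c (psym r)) i)
      = coeff (shift_hom (\<lambda>r. c r / s r) (alphabet_scaling s (psym r))) i" for i
    using psym(1) s[of r]
    by (cases i) (auto simp: shift_hom_simps alphabet_scaling_simps coeff_poly_const_mult
        sf.scale_right_distrib simp del: mult_pCons_left)
  show ?case
    by (simp add: alphabet_scaling_simps shift_hom_simps(3) coeff_mult * psym(2))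
next
  case (scale a F)
  then show ?case
    by (simp add: alphabet_scaling_simps shift_hom_simps(4) coeff_poly_const_mult del: mult_pCons_left)
next
  case (add F G)
  then show ?case by (simp add: alphabet_scaling_simps shift_hom_simps(2))
qed

text \<open>Applied with s_r = 1 - q^r, this turns the shift by M into the shift by 1 - t and the
  signed e_k into \<open>gamma q k\<close>.\<close>

lemma alphabet_scaling_vertex_op:
  assumes s: "\<And>r. r > 0 \<Longrightarrow> s r \<noteq> (0 :: 'a :: field_char_0)"
  shows "alphabet_scaling s (vertex_op c g F)
    = vertex_op (\<lambda>r. c r / s r) (\<lambda>k. alphabet_scaling s (g k)) (alphabet_scaling s F)"
proof -
  let ?f = "shift_hom c F" and ?h = "shift_hom (\<lambda>r. c r / s r) (alphabet_scaling s F)"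
  define N where "N = max (degree ?f) (degree ?h)"
  have "degree ?f \<le> N" "degree ?h \<le> N" by (simp_all add: N_def)
  then show ?thesis
    by (simp add: vertex_op_def pairing_bound[where N = N] alphabet_scaling_simps alphabet_scaling_shift[OF s])
qed

text \<open>This is h_n[X + w] as a polynomial in w.\<close>

definition hpoly :: "nat \<Rightarrow> 'a :: field_char_0 symfun poly" where
  "hpoly n = (\<Sum>k\<le>n. monom (hsym (n - k)) k)"

lemma hpoly_0: "hpoly 0 = 1"
  by (simp add: hpoly_def monom_0 one_pCons)

lemma hpoly_Suc: "hpoly (Suc n) = [:hsym (Suc n):] + monom 1 1 * hpoly n"
  unfolding hpoly_def sum.atMost_Suc_shift
  by (simp add: monom_0 sum_distrib_left mult_monom)

text \<open>Multiplication of \<open>hpoly m\<close> by w gives \<open>hpoly (Suc m)\<close> up to a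
  constant in w. Each use moves one box from the second factor to the first, and the induction
  collects moves of \<open>s\<close> boxes.\<close>

lemma hpoly_mult:
  "hpoly m * hpoly n = [:hsym n:] * hpoly m
     + (\<Sum>s=1..n. [:hsym (n - s):] * hpoly (m + s) - [:hsym (m + s):] * hpoly (n - s))"
proof (induction n arbitrary: m)
  case 0
  show ?case by (simp add: hpoly_0 one_pCons)
next
  case (Suc n)
  let ?f = "\<lambda>s. [:hsym (Suc n - s):] * hpoly (m + s) - [:hsym (m + s):] * hpoly (Suc n - s) :: 'a symfun poly"
  have "hpoly m * hpoly (Suc n) = [:hsym (Suc n):] * hpoly m + (monom 1 1 * hpoly m) * hpoly n"
    unfolding hpoly_Suc[of n] by (simp only: distrib_left mult_ac)
  also have "monom 1 1 * hpoly m = hpoly (Suc m) - [:hsym (Suc m):]"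
    unfolding hpoly_Suc by simp
  also have "(hpoly (Suc m) - [:hsym (Suc m):]) * hpoly n = hpoly (Suc m) * hpoly n - [:hsym (Suc m):] * hpoly n"
    by (simp only: left_diff_distrib)
  also have "hpoly (Suc m) * hpoly n = [:hsym n:] * hpoly (Suc m) + (\<Sum>s=1..n. ?f (Suc s))"
    unfolding Suc.IH[of "Suc m"] by simp
  also have "(\<Sum>s=1..n. ?f (Suc s)) = (\<Sum>s=Suc 1..Suc n. ?f s)"
    by (rule sum.shift_bounds_cl_Suc_ivl[symmetric])
  also have "[:hsym (Suc n):] * hpoly m + ([:hsym n:] * hpoly (Suc m) + (\<Sum>s=Suc 1..Suc n. ?f s) - [:hsym (Suc m):] * hpoly n)
      = [:hsym (Suc n):] * hpoly m + (?f 1 + (\<Sum>s=Suc 1..Suc n. ?f s))"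
    by simp
  also have "?f 1 + (\<Sum>s=Suc 1..Suc n. ?f s) = (\<Sum>s=1..Suc n. ?f s)"
    by (rule sum.atLeast_Suc_atMost[symmetric]) simp
  finally show ?case .
qed

text \<open>The generating series of h_n[1 - t] is (1 - t w) / (1 - w), whose coefficients after the
  first are all 1 - t.\<close>

lemma newton_one_minus_power:
  fixes t :: "'a :: field_char_0"
  shows "newton (\<lambda>r. 1 - t ^ r) (\<lambda>n. if n = 0 then 1 else 1 - t)"
proof (rule newtonI)
  fix n
  have *: "(\<Sum>r=1..k. (1 - t ^ r) * (1 - t)) = of_nat k * (1 - t) - t * (1 - t ^ k)" for k
    by (induction k) (simp_all add: algebra_simps)
  show "of_nat n * (if n = 0 then 1 else 1 - t) = (\<Sum>r=1..n. (1 - t ^ r) * (if n - r = 0 then 1 else 1 - t))"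
  proof (cases n)
    case (Suc k)
    let ?f = "\<lambda>r. (1 - t ^ r) * (if n - r = 0 then 1 else 1 - t)"
    have "(\<Sum>r=1..n. ?f r) = (\<Sum>r=1..k. ?f r) + ?f (Suc k)" unfolding Suc by simp
    also have "(\<Sum>r=1..k. ?f r) = (\<Sum>r=1..k. (1 - t ^ r) * (1 - t))"
      by (intro sum.cong) (auto simp: Suc)
    also have "?f (Suc k) = 1 - t ^ n" by (simp add: Suc)
    finally have "(\<Sum>r=1..n. ?f r) = (\<Sum>r=1..k. (1 - t ^ r) * (1 - t)) + (1 - t ^ n)" .
    then show ?thesis unfolding * Suc by (simp add: algebra_simps)
  qed simp
qed simp

text \<open>Addition of the alphabets X and (1 - t) w. All coefficients h_i[1 - t] equal 1 - t
  except the one at i = 0, where 1 = t + (1 - t) produces the extra term.\<close>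

lemma shift_hom_hsym:
  fixes t :: "'a :: field_char_0"
  shows "shift_hom (\<lambda>r. 1 - t ^ r) (hsym n) = poly_const t * [:hsym n:] + poly_const (1 - t) * hpoly n"
proof -
  define w where "w = (monom 1 1 :: 'a symfun poly)"
  have wp: "w ^ i * [:x:] = monom x i" for i x
    by (simp add: w_def monom_power mult.commute smult_monom)
  have "newton (\<lambda>r. poly_const (1 - t ^ r)) (\<lambda>n. poly_const (if n = 0 then 1 else 1 - t))"
    by (rule newton_map[OF newton_one_minus_power])
      (simp_all add: poly_scalar.one poly_scalar.add poly_scalar.mult del: mult_pCons_left)
  from newton_dilate[OF this, of w]
  have 1: "newton (\<lambda>r. monom (scale_sf (1 - t ^ r) 1) r) (\<lambda>n. monom (scale_sf (if n = 0 then 1 else 1 - t) 1) n :: 'a symfun poly)"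
    unfolding wp .
  have 2: "newton (\<lambda>r. [:psym r:]) (\<lambda>n. [:hsym n:] :: 'a symfun poly)"
    by (rule newton_map[OF newton_hsym]) (simp_all add: one_pCons)
  note 3 = newton_mult[OF 1 2]
  have "newton (\<lambda>r. [:psym r:] + monom (scale_sf (1 - t ^ r) 1) r) (\<lambda>n. shift_hom (\<lambda>r. 1 - t ^ r) (hsym n))"
    unfolding shift_hom_def by (rule poly_scalar.newton_psym_hom_hsym)
  then have "shift_hom (\<lambda>r. 1 - t ^ r) (hsym n)
      = (\<Sum>i=0..n. monom (scale_sf (if i = 0 then 1 else 1 - t) 1) i * [:hsym (n - i):])"
    by (rule newton_unique[OF torsion_free_symfun_poly _ 3]) (rule add.commute)
  also have "\<dots> = (\<Sum>i\<le>n. monom (scale_sf (if i = 0 then 1 else 1 - t) (hsym (n - i))) i)"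
    by (intro sum.cong) (auto simp: smult_monom mult.commute mult_scale_sf)
  also have "\<dots> = poly_const t * [:hsym n:] + (\<Sum>i\<le>n. poly_const (1 - t) * monom (hsym (n - i)) i)"
  proof -
    have "monom (scale_sf (if i = 0 then 1 else 1 - t) (hsym (n - i))) i
      = (if i = 0 then poly_const t * [:hsym n:] else 0) + poly_const (1 - t) * monom (hsym (n - i)) i" for i
      by (auto simp: smult_monom scale_sf_mult mult_scale_sf monom_0 sf.scale_left_diff_distrib left_diff_distrib)
    then show ?thesis by (simp add: sum.distrib)
  qed
  finally show ?thesis by (simp only: hpoly_def sum_distrib_left)
qed

text \<open>This is (-1)^k e_k[X(1 - q)], the coefficient of w^k in the product of (1 - x w) / (1 -
  q x w) over the variables x.\<close>

definition gamma :: "'a :: field_char_0 \<Rightarrow> nat \<Rightarrow> 'a symfun" where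
  "gamma q k = alphabet_scaling (\<lambda>r. 1 - q ^ r) ((-1) ^ k * esym k)"

lemma gamma_0: "gamma q 0 = 1"
  by (simp add: gamma_def alphabet_scaling_simps)

lemma scale_sf_power: "scale_sf c 1 ^ n = scale_sf (c ^ n) (1 :: 'a :: field symfun)"
  by (induction n) (simp_all add: scale_sf_mult mult_scale_sf mult.commute)

text \<open>The series of \<open>gamma q\<close> times the series H(w) of \<open>hsym\<close> is H(q
  w).\<close>

lemma sum_gamma_hsym: "(\<Sum>i=0..n. gamma q i * hsym (n - i)) = scale_sf (q ^ n) (hsym n)"
proof -
  have neg: "alphabet_scaling s (- F) = - alphabet_scaling s F" for s and F :: "'a symfun"
    using alphabet_scaling_simps(5)[of s "-1" F] by simp
  have "newton (\<lambda>r. alphabet_scaling (\<lambda>r. 1 - q ^ r) (- psym r)) (gamma q)"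
    unfolding gamma_def[abs_def] by (rule newton_map[OF newton_esym]) (simp_all add: alphabet_scaling_simps)
  from newton_mult[OF this newton_hsym]
  have 1: "newton (\<lambda>r. alphabet_scaling (\<lambda>r. 1 - q ^ r) (- psym r) + psym r) (\<lambda>n. \<Sum>i=0..n. gamma q i * hsym (n - i))" .
  have 2: "newton (\<lambda>r. scale_sf q 1 ^ r * psym r) (\<lambda>n. scale_sf q 1 ^ n * hsym n)"
    by (rule newton_dilate[OF newton_hsym])
  have "(\<Sum>i=0..n. gamma q i * hsym (n - i)) = scale_sf q 1 ^ n * hsym n"
  proof (rule newton_unique[OF torsion_free_symfun 1 2])
    fix r :: nat assume "r > 0"
    then show "alphabet_scaling (\<lambda>r. 1 - q ^ r) (- psym r) + psym r = scale_sf q 1 ^ r * psym r"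
      unfolding neg alphabet_scaling_simps(7)[OF \<open>r > 0\<close>]
      by (simp add: scale_sf_power scale_sf_mult sf.scale_left_diff_distrib)
  qed
  then show ?thesis by (simp add: scale_sf_power scale_sf_mult)
qed

text \<open>The origin of the powers of q in the eigenvalues: a row that carries w contributes q to
  the power of its length.\<close>

lemma pairing_gamma_hpoly: "pairing (gamma q) (hpoly n) = scale_sf (q ^ n) (hsym n)"
  by (simp add: hpoly_def pairing_sum pairing_monom atMost_atLeast0 sum_gamma_hsym)

section \<open>Triangularity of the vertex operator\<close>

text \<open>The number \<open>r\<close> is a row, counted from 0, by whose end a strict gain has
  occurred. It is kept because it is tied to the exponent of t in \<open>higher\<close>.\<close>

definition raises :: "nat \<Rightarrow> nat list \<Rightarrow> nat list \<Rightarrow> bool" where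
  "raises r \<mu> \<alpha> \<longleftrightarrow> sum_list \<alpha> = sum_list \<mu> \<and> (\<forall>k. sum_list (take k \<mu>) \<le> sum_list (take k \<alpha>)) \<and>
     sum_list (take (Suc r) \<mu>) < sum_list (take (Suc r) \<alpha>)"

text \<open>The effect on partial sums of moving \<open>s\<close> boxes from the appended last row
  to row \<open>i\<close>, written additively to avoid natural subtraction.\<close>

lemma sum_list_take_move:
  fixes \<alpha> :: "nat list"
  assumes i: "i < length \<alpha>" and s: "s \<le> n"
  shows "sum_list (take k (\<alpha>[i := \<alpha> ! i + s] @ [n - s])) + (if length \<alpha> < k then s else 0)
    = sum_list (take k (\<alpha> @ [n])) + (if i < k then s else 0)"
proof (induction k)
  case (Suc k)
  have "part (\<alpha>[i := \<alpha> ! i + s] @ [n - s]) k + (if k = length \<alpha> then s else 0)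
      = part (\<alpha> @ [n]) k + (if k = i then s else 0)"
    using i s by (auto simp: part_def nth_append nth_list_update)
  then show ?case
    using Suc i unfolding sum_list_take_Suc by (auto split: if_splits)
qed simp

lemma raises_move:
  assumes i: "i < length \<alpha>" and s: "1 \<le> s" "s \<le> n"
  shows "raises i (\<alpha> @ [n]) (\<alpha>[i := \<alpha> ! i + s] @ [n - s])"
  unfolding raises_def
proof (intro conjI allI)
  let ?\<beta> = "\<alpha>[i := \<alpha> ! i + s] @ [n - s]"
  note * = sum_list_take_move[OF i s(2)]
  show "sum_list ?\<beta> = sum_list (\<alpha> @ [n])" using *[of "Suc (length \<alpha>)"] i by simp
  show "sum_list (take k (\<alpha> @ [n])) \<le> sum_list (take k ?\<beta>)" for k
    using *[of k] i by (auto split: if_splits)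
  show "sum_list (take (Suc i) (\<alpha> @ [n])) < sum_list (take (Suc i) ?\<beta>)"
    using *[of "Suc i"] i s by (auto split: if_splits)
qed

lemma raises_append:
  assumes "raises r \<mu> \<alpha>" "length \<alpha> = length \<mu>"
  shows "raises r (\<mu> @ [n]) (\<alpha> @ [n])"
proof -
  have "Suc r \<le> length \<mu>"
    using assms by (intro leI notI) (auto simp: raises_def)
  then show ?thesis using assms by (auto simp: raises_def)
qed

lemma raises_trans: "raises r \<mu> \<alpha> \<Longrightarrow> raises r' \<alpha> \<beta> \<Longrightarrow> raises r \<mu> \<beta>"
  unfolding raises_def by (metis le_trans less_le_trans)

text \<open>The shape in which the main terms of the product arise: one term without w and one for
  each row carrying w. It equals 1 - (1 - q)(1 - t) times the sum of q^j t^i over the cells.\<close>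

definition vertex_eigenvalue :: "'a :: field_char_0 \<Rightarrow> 'a \<Rightarrow> nat list \<Rightarrow> 'a" where
  "vertex_eigenvalue q t \<mu> = t ^ length \<mu> + (\<Sum>i<length \<mu>. (1 - t) * t ^ i * q ^ (\<mu> ! i))"

context
  fixes q t :: "'a :: field_char_0" and R :: "'a set"
  assumes R: "subring_set R" and qR: "q \<in> R" and tR: "t \<in> R"
begin

definition hfactor :: "nat \<Rightarrow> 'a symfun poly" where
  "hfactor n = poly_const t * [:hsym n:] + poly_const (1 - t) * hpoly n"

text \<open>The product h_\<alpha> in which only the factor of row \<open>i\<close> still carries
  the variable w.\<close>

definition hmixed :: "nat list \<Rightarrow> nat \<Rightarrow> 'a symfun poly" where
  "hmixed \<alpha> i = [:glist hsym (take i \<alpha> @ drop (Suc i) \<alpha>):] * hpoly (\<alpha> ! i)"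

text \<open>The error terms of the straightening below; the powers of \<open>1 - t\<close> and \<open>t\<close> are recorded because they
  compensate the zeros at \<open>t = 1\<close> and \<open>t = 0\<close> of the differences of eigenvalues.\<close>

definition higher :: "nat list \<Rightarrow> 'a symfun poly set" where
  "higher \<mu> = additive_span {poly_const ((1 - t) ^ 2 * t ^ r * x) * hmixed \<alpha> i | r x \<alpha> i.
     x \<in> R \<and> length \<alpha> = length \<mu> \<and> i < length \<mu> \<and> raises r \<mu> \<alpha>}"

lemma higher_gen:
  assumes "x \<in> R" "length \<alpha> = length \<mu>" "i < length \<mu>" "raises r \<mu> \<alpha>"
    and "c = (1 - t) ^ 2 * t ^ r * x"
  shows "poly_const c * hmixed \<alpha> i \<in> higher \<mu>"
  unfolding higher_def assms(5) by (rule additive_span_base) (use assms in blast)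

lemma higher_plus: "x \<in> higher \<mu> \<Longrightarrow> y \<in> higher \<mu> \<Longrightarrow> x + y \<in> higher \<mu>"
  unfolding higher_def by (rule additive_span_plus)

lemma higher_sum: "(\<And>i. i \<in> I \<Longrightarrow> f i \<in> higher \<mu>) \<Longrightarrow> sum f I \<in> higher \<mu>"
  unfolding higher_def by (rule additive_span_sum)

lemma poly_const_mult: "poly_const c * (poly_const d * f) = poly_const (c * d) * f"
  by (simp only: poly_scalar.mult mult.assoc)

text \<open>Since t = 1 - (1 - t), the new factor is h_n plus 1 - t times the difference of
  \<open>hpoly n\<close> and h_n. The product of two factors with w is straightened by
  \<open>hpoly_mult\<close>, leaving w in row \<open>i\<close> or, with opposite sign, in the new
  last row.\<close>

lemma hmixed_hfactor:
  assumes i: "i < length \<alpha>"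
  shows "hmixed \<alpha> i * hfactor n = hmixed (\<alpha> @ [n]) i
    + (\<Sum>s=1..n. poly_const (1 - t) * hmixed (\<alpha>[i := \<alpha> ! i + s] @ [n - s]) i
        + poly_const (- (1 - t)) * hmixed (\<alpha>[i := \<alpha> ! i + s] @ [n - s]) (length \<alpha>))"
proof -
  let ?\<beta> = "\<lambda>s. \<alpha>[i := \<alpha> ! i + s]"
  let ?g = "[:glist hsym (take i \<alpha> @ drop (Suc i) \<alpha>) :: 'a symfun:]" and ?m = "\<alpha> ! i"
  have split: "glist hsym \<alpha> = glist hsym (take i \<alpha> @ drop (Suc i) \<alpha>) * (hsym (\<alpha> ! i) :: 'a symfun)" if "i < length \<alpha>" for \<alpha>
    by (subst id_take_nth_drop[OF that]) (simp add: glist_append mult_ac)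
  have c: "[:x * y:] = [:x:] * [:y :: 'a symfun:]" for x y by simp
  have 1: "hmixed (?\<beta> s @ [n - s]) i = ?g * ([:hsym (n - s):] * hpoly (?m + s))" for s
    using i by (simp only: hmixed_def) (simp add: nth_append glist_append c mult_ac del: mult_pCons_left mult_pCons_right)
  have 2: "hmixed (?\<beta> s @ [n - s]) (length \<alpha>) = ?g * ([:hsym (?m + s):] * hpoly (n - s))" for s
  proof -
    have "glist hsym (?\<beta> s) = glist hsym (take i \<alpha> @ drop (Suc i) \<alpha>) * (hsym (?m + s) :: 'a symfun)"
      using split[of "?\<beta> s"] i by simp
    then show ?thesis
      using i by (simp only: hmixed_def) (simp add: nth_append c mult_ac del: mult_pCons_left mult_pCons_right)
  qed
  have 3: "hmixed (\<alpha> @ [n]) i = ?g * ([:hsym n:] * hpoly ?m)"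
    using 1[of 0] by simp
  have t1: "poly_const t = 1 - poly_const (1 - t)"
    by (simp add: sf.scale_left_diff_distrib one_pCons)
  have neg: "poly_const (- (1 - t)) = - poly_const (1 - t)" by (simp add: sf.scale_left_diff_distrib)
  have ring: "g * (c * (A - B)) = c * (g * A) + - c * (g * B)" for g c A B :: "'a symfun poly"
    by (simp add: algebra_simps)
  have "hmixed \<alpha> i * hfactor n
      = ?g * (poly_const t * ([:hsym n:] * hpoly ?m) + poly_const (1 - t) * (hpoly ?m * hpoly n))"
    by (simp only: hmixed_def hfactor_def distrib_left distrib_right mult_ac)
  also have "\<dots> = ?g * ([:hsym n:] * hpoly ?m + poly_const (1 - t) * (hpoly ?m * hpoly n - [:hsym n:] * hpoly ?m))"
    unfolding t1 by (simp only: algebra_simps) simp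
  also have "hpoly ?m * hpoly n - [:hsym n:] * hpoly ?m
      = (\<Sum>s=1..n. [:hsym (n - s):] * hpoly (?m + s) - [:hsym (?m + s):] * hpoly (n - s))"
    unfolding hpoly_mult by simp
  also have "?g * ([:hsym n:] * hpoly ?m + poly_const (1 - t) * \<dots>)
      = ?g * ([:hsym n:] * hpoly ?m) + (\<Sum>s=1..n. poly_const (1 - t) * (?g * ([:hsym (n - s):] * hpoly (?m + s)))
         + poly_const (- (1 - t)) * (?g * ([:hsym (?m + s):] * hpoly (n - s))))"
    unfolding distrib_left sum_distrib_left neg
    by (intro arg_cong2[where f = "(+)"] sum.cong refl ring)
  finally show ?thesis unfolding 1 2 3 .
qed

text \<open>Rows are appended one at a time. Before w appears each row contributes t; row i
  contributes 1 - t when it takes w; afterwards a row contributes plain h_n up to straightening.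
  That step costs another 1 - t and gains boxes in row i, hence the errors (1 - t)^2 t^i.\<close>

lemma glist_hfactor:
  "\<exists>z \<in> higher \<mu>. glist hfactor \<mu> = poly_const (t ^ length \<mu>) * [:glist hsym \<mu>:]
     + (\<Sum>i<length \<mu>. poly_const ((1 - t) * t ^ i) * hmixed \<mu> i) + z"
proof (induction \<mu> rule: rev_induct)
  case Nil
  show ?case
    by (rule bexI[of _ 0]) (simp_all add: higher_def additive_span.zero one_pCons)
next
  case (snoc n \<mu>)
  then obtain z where z: "z \<in> higher \<mu>" and eq: "glist hfactor \<mu> = poly_const (t ^ length \<mu>) * [:glist hsym \<mu>:]
     + (\<Sum>i<length \<mu>. poly_const ((1 - t) * t ^ i) * hmixed \<mu> i) + z" by blast
  let ?l = "length \<mu>"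
  let ?\<beta> = "\<lambda>\<alpha> i s. \<alpha>[i := \<alpha> ! i + s] @ [n - s]"
  define S where "S c \<alpha> i = (\<Sum>s=1..n. poly_const c * (poly_const (1 - t) * hmixed (?\<beta> \<alpha> i s) i
        + poly_const (- (1 - t)) * hmixed (?\<beta> \<alpha> i s) (length \<alpha>)))" for c \<alpha> i
  have S: "S c \<alpha> i \<in> higher (\<mu> @ [n])"
    if len: "length \<alpha> = ?l" "i < ?l" and rs: "\<And>s. s \<in> {1..n} \<Longrightarrow> raises r (\<mu> @ [n]) (?\<beta> \<alpha> i s)"
      and c: "c * (1 - t) = (1 - t) ^ 2 * t ^ r * x" "x \<in> R" for c \<alpha> i r x
    unfolding S_def distrib_left poly_const_mult
  proof (intro higher_sum higher_plus)
    fix s assume s: "s \<in> {1..n}"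
    show "poly_const (c * (1 - t)) * hmixed (?\<beta> \<alpha> i s) i \<in> higher (\<mu> @ [n])"
      using len by (intro higher_gen[OF c(2) _ _ rs[OF s] c(1)]) auto
    show "poly_const (c * - (1 - t)) * hmixed (?\<beta> \<alpha> i s) (length \<alpha>) \<in> higher (\<mu> @ [n])"
    proof (rule higher_gen[OF _ _ _ rs[OF s], where x = "- x"])
      show "c * - (1 - t) = (1 - t) ^ 2 * t ^ r * - x" unfolding mult_minus_right c(1) ..
    qed (use len c subring_setD[OF R] in auto)
  qed
  have mixed: "poly_const c * hmixed \<alpha> i * hfactor n = poly_const c * hmixed (\<alpha> @ [n]) i + S c \<alpha> i"
    if "i < length \<alpha>" for c \<alpha> i
    unfolding mult.assoc hmixed_hfactor[OF that] S_def distrib_left sum_distrib_left ..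
  have 1: "poly_const (t ^ ?l) * [:glist hsym \<mu>:] * hfactor n
    = poly_const (t ^ length (\<mu> @ [n])) * [:glist hsym (\<mu> @ [n]):] + poly_const ((1 - t) * t ^ ?l) * hmixed (\<mu> @ [n]) ?l"
  proof -
    have "poly_const (t ^ ?l) * [:glist hsym \<mu>:] * hfactor n
      = (poly_const (t ^ ?l) * poly_const t) * ([:glist hsym \<mu>:] * [:hsym n:])
        + (poly_const (1 - t) * poly_const (t ^ ?l)) * ([:glist hsym \<mu>:] * hpoly n)"
      unfolding hfactor_def by (simp only: distrib_left mult_ac)
    also have "[:glist hsym \<mu>:] * [:hsym n:] = [:glist hsym (\<mu> @ [n]) :: 'a symfun:]"
      by (simp add: glist_append)
    also have "[:glist hsym \<mu>:] * hpoly n = hmixed (\<mu> @ [n]) ?l" by (simp add: hmixed_def)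
    finally show ?thesis by (simp only: poly_scalar.mult[symmetric] length_append) (simp add: mult.commute)
  qed
  have 2: "(\<Sum>i<?l. poly_const ((1 - t) * t ^ i) * hmixed \<mu> i) * hfactor n
    = (\<Sum>i<?l. poly_const ((1 - t) * t ^ i) * hmixed (\<mu> @ [n]) i) + (\<Sum>i<?l. S ((1 - t) * t ^ i) \<mu> i)"
    unfolding sum_distrib_right sum.distrib[symmetric] by (intro sum.cong refl mixed) simp
  have S2: "(\<Sum>i<?l. S ((1 - t) * t ^ i) \<mu> i) \<in> higher (\<mu> @ [n])"
    by (intro higher_sum S[where x = 1]) (auto intro: raises_move subring_setD(1)[OF R] simp: power2_eq_square)
  have 3: "z * hfactor n \<in> higher (\<mu> @ [n])"
    using z unfolding higher_def[of \<mu>]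
  proof (induction rule: additive_span.induct)
    case zero
    show ?case by (simp add: higher_def additive_span.zero)
  next
    case (add x y)
    then obtain r o' \<alpha> i where x: "x = poly_const ((1 - t) ^ 2 * t ^ r * o') * hmixed \<alpha> i"
      and o': "o' \<in> R" and \<alpha>: "length \<alpha> = ?l" "i < ?l" "raises r \<mu> \<alpha>" by blast
    have "x * hfactor n = poly_const ((1 - t) ^ 2 * t ^ r * o') * hmixed (\<alpha> @ [n]) i + S ((1 - t) ^ 2 * t ^ r * o') \<alpha> i"
      unfolding x using \<alpha> by (intro mixed) simp
    also have "\<dots> \<in> higher (\<mu> @ [n])"
    \<comment> \<open>The additional factor 1 - t is absorbed into the coefficient in
      \<open>R\<close>, and the row \<open>r\<close> of the original gain is kept.\<close>
    proof (intro higher_plus S[where x = "o' * (1 - t)" and r = r] \<alpha>)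
      show "poly_const ((1 - t) ^ 2 * t ^ r * o') * hmixed (\<alpha> @ [n]) i \<in> higher (\<mu> @ [n])"
        using \<alpha> by (intro higher_gen[OF o' _ _ raises_append[OF \<alpha>(3,1)] refl]) auto
      show "raises r (\<mu> @ [n]) (?\<beta> \<alpha> i s)" if "s \<in> {1..n}" for s
        using \<alpha> that by (intro raises_trans[OF raises_append[OF \<alpha>(3,1)] raises_move]) auto
      show "o' * (1 - t) \<in> R" by (intro subring_setD(1,2,3)[OF R] o' tR)
    qed (simp add: mult_ac)
    finally show ?case
      unfolding distrib_right using add.IH by (intro higher_plus)
  qed
  have "glist hfactor (\<mu> @ [n]) = glist hfactor \<mu> * hfactor n" by (simp add: glist_append)
  also have "\<dots> = poly_const (t ^ length (\<mu> @ [n])) * [:glist hsym (\<mu> @ [n]):]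
      + (\<Sum>i<length (\<mu> @ [n]). poly_const ((1 - t) * t ^ i) * hmixed (\<mu> @ [n]) i)
      + ((\<Sum>i<?l. S ((1 - t) * t ^ i) \<mu> i) + z * hfactor n)"
    unfolding eq distrib_right 1 2 length_append by (simp add: add_ac)
  finally show ?case using higher_plus[OF S2 3] by blast
qed

lemma shift_hom_glist: "shift_hom (\<lambda>r. 1 - t ^ r) (glist hsym \<mu>) = glist hfactor \<mu>"
  by (induction \<mu>)
    (simp_all add: shift_hom_simps(1,3) shift_hom_hsym hfactor_def del: mult_pCons_left)

lemma pairing_hmixed:
  assumes "i < length \<alpha>"
  shows "pairing (gamma q) (hmixed \<alpha> i) = scale_sf (q ^ (\<alpha> ! i)) (glist hsym \<alpha>)"
proof -
  have "glist hsym \<alpha> = glist hsym (take i \<alpha> @ drop (Suc i) \<alpha>) * (hsym (\<alpha> ! i) :: 'a symfun)"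
    by (subst id_take_nth_drop[OF assms]) (simp add: glist_append mult_ac)
  then show ?thesis
    by (simp only: hmixed_def pairing_const_mult pairing_gamma_hpoly mult_scale_sf)
qed

text \<open>The pairing replaces w in row i by q to the length of that row, and sorting the
  composition keeps the gain in partial sums. The inequality for \<open>Suc r\<close> rows is
  retained because it justifies later division by t^p.\<close>

lemma vertex_op_triangular:
  assumes \<mu>: "is_partition \<mu>"
  shows "vertex_op (\<lambda>r. 1 - t ^ r) (gamma q) (glist hsym \<mu>) - scale_sf (vertex_eigenvalue q t \<mu>) (glist hsym \<mu>)
    \<in> additive_span {scale_sf ((1 - t) ^ 2 * t ^ r * x) (glist hsym \<nu>) | r x \<nu>.
        x \<in> R \<and> below \<mu> \<nu> \<and> sum_list (take (Suc r) \<mu>) < sum_list (take (Suc r) \<nu>)}"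
    (is "_ \<in> additive_span ?G")
proof -
  obtain z where z: "z \<in> higher \<mu>" and eq: "glist hfactor \<mu> = poly_const (t ^ length \<mu>) * [:glist hsym \<mu>:]
     + (\<Sum>i<length \<mu>. poly_const ((1 - t) * t ^ i) * hmixed \<mu> i) + z" using glist_hfactor by blast
  have c: "pairing (gamma q) (poly_const a * f) = scale_sf a (pairing (gamma q) f)" for a f
    by (simp only: pairing_const_mult scale_sf_mult mult_1)
  have one: "pairing (gamma q) [:x:] = x" for x
    using pairing_monom[of "gamma q" x 0] by (simp add: monom_0 gamma_0)
  have "vertex_op (\<lambda>r. 1 - t ^ r) (gamma q) (glist hsym \<mu>)
    = scale_sf (t ^ length \<mu>) (glist hsym \<mu>)
      + (\<Sum>i<length \<mu>. scale_sf ((1 - t) * t ^ i) (scale_sf (q ^ (\<mu> ! i)) (glist hsym \<mu>))) + pairing (gamma q) z"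
    by (simp only: vertex_op_def shift_hom_glist eq pairing_add pairing_sum c one)
      (simp add: pairing_hmixed)
  also have "\<dots> = scale_sf (vertex_eigenvalue q t \<mu>) (glist hsym \<mu>) + pairing (gamma q) z"
    by (simp add: vertex_eigenvalue_def sf.scale_left_distrib sf.scale_sum_left)
  finally have "vertex_op (\<lambda>r. 1 - t ^ r) (gamma q) (glist hsym \<mu>) - scale_sf (vertex_eigenvalue q t \<mu>) (glist hsym \<mu>)
    = pairing (gamma q) z" by simp
  also have "\<dots> \<in> additive_span ?G"
    using z unfolding higher_def
  proof (rule additive_span_image[where f = "pairing (gamma q)", OF pairing_add pairing_0, rotated])
    fix y assume "y \<in> {poly_const ((1 - t) ^ 2 * t ^ r * x) * hmixed \<alpha> i | r x \<alpha> i.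
      x \<in> R \<and> length \<alpha> = length \<mu> \<and> i < length \<mu> \<and> raises r \<mu> \<alpha>}"
    then obtain r x \<alpha> i where y: "y = poly_const ((1 - t) ^ 2 * t ^ r * x) * hmixed \<alpha> i"
      and x: "x \<in> R" and \<alpha>: "i < length \<alpha>" "raises r \<mu> \<alpha>" by auto
    let ?\<nu> = "partition_of \<alpha>"
    have "below \<mu> ?\<nu>" using \<alpha>(2) by (intro below_partition_of[OF \<mu>, of \<alpha> "Suc r"]) (auto simp: raises_def)
    moreover have "sum_list (take (Suc r) \<mu>) < sum_list (take (Suc r) ?\<nu>)"
      using \<alpha>(2) sum_list_take_le_partition_of[of "Suc r" \<alpha>] by (simp add: raises_def)
    moreover have "x * q ^ (\<alpha> ! i) \<in> R" by (intro subring_setD(3,7)[OF R] x qR)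
    moreover have "pairing (gamma q) y = scale_sf ((1 - t) ^ 2 * t ^ r * (x * q ^ (\<alpha> ! i))) (glist hsym ?\<nu>)"
      unfolding y c pairing_hmixed[OF \<alpha>(1)] by (simp add: glist_partition_of mult_ac)
    ultimately have "pairing (gamma q) y \<in> ?G" by blast
    then show "pairing (gamma q) y \<in> additive_span ?G" by (rule additive_span_base)
  qed
  finally show ?thesis .
qed

end

section \<open>Eigenvectors\<close>

lemma rspan_ideal:
  assumes "\<And>a x. a \<in> A \<Longrightarrow> x \<in> R \<Longrightarrow> a * x \<in> A'" "\<And>b. b \<in> B \<Longrightarrow> b \<in> rspan R B'" "x \<in> rspan A B"
  shows "x \<in> rspan A' B'"
  by (rule rspan_image[of "\<lambda>x. x", OF _ _ _ assms(3)])
    (auto intro: rspan_scale_general[where R = R] assms)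

text \<open>Descent from the top of the dominance order; only finitely many partitions lie above a
  given one.\<close>

lemma below_induct [consumes 1, case_names above]:
  assumes "is_partition \<mu>"
    and "\<And>\<mu>. is_partition \<mu> \<Longrightarrow> (\<And>\<nu>. below \<mu> \<nu> \<Longrightarrow> P \<nu>) \<Longrightarrow> P \<mu>"
  shows "P \<mu>"
  using assms(1)
proof (induction "card {\<nu> \<in> partitions. below \<mu> \<nu>}" arbitrary: \<mu> rule: less_induct)
  case less
  show ?case
  proof (rule assms(2)[OF less.prems])
    fix \<nu> assume \<nu>: "below \<mu> \<nu>"
    then have p: "is_partition \<nu>" by (simp add: below_def)
    have "{\<rho> \<in> partitions. below \<nu> \<rho>} \<subseteq> {\<rho> \<in> partitions. below \<mu> \<rho>}" using below_trans[OF \<nu>] by blast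
    moreover have "\<nu> \<in> {\<rho> \<in> partitions. below \<mu> \<rho>}" "\<nu> \<notin> {\<rho> \<in> partitions. below \<nu> \<rho>}"
      using \<nu> p below_irrefl by auto
    ultimately have "{\<rho> \<in> partitions. below \<nu> \<rho>} \<subset> {\<rho> \<in> partitions. below \<mu> \<rho>}" by blast
    then show "P \<nu>" using less.hyps[OF _ p] finite_below by (simp add: psubset_card_mono)
  qed
qed

text \<open>Only absorption is recorded; sums of elements of \<open>A\<close> are formed by
  \<open>additive_span\<close>.\<close>

definition ideal_set :: "'a :: comm_ring_1 set \<Rightarrow> 'a set \<Rightarrow> bool" where
  "ideal_set R A \<longleftrightarrow> subring_set R \<and> A \<subseteq> R \<and> (\<forall>a\<in>A. \<forall>x\<in>R. a * x \<in> A)"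

lemma ideal_setD:
  assumes "ideal_set R A"
  shows "subring_set R" "a \<in> A \<Longrightarrow> a \<in> R" "a \<in> A \<Longrightarrow> x \<in> R \<Longrightarrow> a * x \<in> A"
  using assms by (auto simp: ideal_set_def)

text \<open>A unitriangular change of basis with off-diagonal entries in an ideal has an inverse of
  the same kind, found by substituting from the top downwards.\<close>

lemma triangular_inverse:
  assumes A: "ideal_set R A" and \<nu>: "is_partition \<nu>"
    and w: "\<And>\<rho>. \<rho> = \<nu> \<or> below \<nu> \<rho> \<Longrightarrow> w \<rho> - h \<rho> \<in> rspan A (h ` {\<kappa>. below \<rho> \<kappa>})"
  shows "h \<nu> - w \<nu> \<in> rspan A (w ` {\<kappa>. below \<nu> \<kappa>})"
  using \<nu> w
proof (induction \<nu> rule: below_induct)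
  case (above \<nu>)
  note R = ideal_setD(1)[OF A]
  have "h \<rho> \<in> rspan R (w ` {\<kappa>. below \<nu> \<kappa>})" if \<rho>: "below \<nu> \<rho>" for \<rho>
  proof -
    have "h \<rho> - w \<rho> \<in> rspan A (w ` {\<kappa>. below \<rho> \<kappa>})"
      using \<rho> above.prems below_trans by (intro above.IH) blast+
    then have "h \<rho> - w \<rho> \<in> rspan R (w ` {\<kappa>. below \<nu> \<kappa>})"
      by (rule rspan_mono) (use \<rho> below_trans ideal_setD(2)[OF A] in blast)+
    moreover have "w \<rho> \<in> rspan R (w ` {\<kappa>. below \<nu> \<kappa>})" using \<rho> by (intro rspan_base R) blast
    ultimately have "(h \<rho> - w \<rho>) + w \<rho> \<in> rspan R (w ` {\<kappa>. below \<nu> \<kappa>})" by (rule rspan_plus)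
    then show ?thesis by simp
  qed
  then have "w \<nu> - h \<nu> \<in> rspan A (w ` {\<kappa>. below \<nu> \<kappa>})"
    using above.prems[of \<nu>] by (intro rspan_ideal[OF ideal_setD(3)[OF A], where x = "w \<nu> - h \<nu>"]) auto
  then have "scale_sf (-1) (w \<nu> - h \<nu>) \<in> rspan A (w ` {\<kappa>. below \<nu> \<kappa>})"
    by (rule rspan_scale_general[rotated])
      (use ideal_setD(3)[OF A, of _ "-1"] subring_setD(1,6)[OF R] in simp)
  then show ?case by simp
qed

text \<open>The error of h_\<mu> is expanded in the eigenvectors already built above \<mu>. On each
  of them the operator minus the eigenvalue of \<mu> is a nonzero scalar, so a correction is
  obtained by division, and \<open>quot\<close> keeps its coefficient in the ideal.\<close>

lemma vertex_eigenvector: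
  fixes q t :: "'a :: field_char_0"
  defines "D \<equiv> vertex_op (\<lambda>r. 1 - t ^ r) (gamma q)"
  assumes A: "ideal_set R A" and qR: "q \<in> R" and tR: "t \<in> R"
    and ev: "\<And>\<mu> \<nu>. is_partition \<mu> \<Longrightarrow> is_partition \<nu> \<Longrightarrow> \<mu> \<noteq> \<nu> \<Longrightarrow> vertex_eigenvalue q t \<mu> \<noteq> vertex_eigenvalue q t \<nu>"
    and quot: "\<And>\<mu> \<nu> r. below \<mu> \<nu> \<Longrightarrow> sum_list (take (Suc r) \<mu>) < sum_list (take (Suc r) \<nu>) \<Longrightarrow>
      (1 - t) ^ 2 * t ^ r / (vertex_eigenvalue q t \<mu> - vertex_eigenvalue q t \<nu>) \<in> A"
    and \<mu>: "is_partition \<mu>"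
  shows "\<exists>w. D w = scale_sf (vertex_eigenvalue q t \<mu>) w \<and>
    w - glist hsym \<mu> \<in> rspan A (glist hsym ` {\<nu>. below \<mu> \<nu>})"
  using \<mu>
proof (induction \<mu> rule: below_induct)
  case (above \<mu>)
  let ?e = "vertex_eigenvalue q t" and ?h = "glist hsym :: nat list \<Rightarrow> 'a symfun"
  note R = ideal_setD(1)[OF A]
  obtain w where Dw: "\<And>\<nu>. below \<mu> \<nu> \<Longrightarrow> D (w \<nu>) = scale_sf (?e \<nu>) (w \<nu>)"
    and wh: "\<And>\<nu>. below \<mu> \<nu> \<Longrightarrow> w \<nu> - ?h \<nu> \<in> rspan A (?h ` {\<rho>. below \<nu> \<rho>})"
    using above.IH by metis
  have hw: "?h \<nu> - w \<nu> \<in> rspan A (w ` {\<rho>. below \<nu> \<rho>})" if "below \<mu> \<nu>" for \<nu>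
  proof (rule triangular_inverse[OF A])
    show "is_partition \<nu>" using that by (simp add: below_def)
    fix \<rho> assume "\<rho> = \<nu> \<or> below \<nu> \<rho>"
    then have "below \<mu> \<rho>" using that below_trans[OF that] by auto
    then show "w \<rho> - ?h \<rho> \<in> rspan A (?h ` {\<kappa>. below \<rho> \<kappa>})" by (rule wh)
  qed
  let ?G = "{scale_sf ((1 - t) ^ 2 * t ^ r * x) (w \<nu>) | r x \<nu>.
        x \<in> R \<and> below \<mu> \<nu> \<and> sum_list (take (Suc r) \<mu>) < sum_list (take (Suc r) \<nu>)}"
  define z where "z = D (?h \<mu>) - scale_sf (?e \<mu>) (?h \<mu>)"
  have "z \<in> additive_span {scale_sf ((1 - t) ^ 2 * t ^ r * x) (?h \<nu>) | r x \<nu>.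
        x \<in> R \<and> below \<mu> \<nu> \<and> sum_list (take (Suc r) \<mu>) < sum_list (take (Suc r) \<nu>)}"
    unfolding z_def D_def by (rule vertex_op_triangular[OF R qR tR above.hyps])
  then have "z \<in> additive_span ?G"
  proof (rule additive_span_mono[rotated])
    fix y assume "y \<in> {scale_sf ((1 - t) ^ 2 * t ^ r * x) (?h \<nu>) | r x \<nu>.
        x \<in> R \<and> below \<mu> \<nu> \<and> sum_list (take (Suc r) \<mu>) < sum_list (take (Suc r) \<nu>)}"
    then obtain r x \<nu> where y: "y = scale_sf ((1 - t) ^ 2 * t ^ r * x) (?h \<nu>)" and x: "x \<in> R"
      and \<nu>: "below \<mu> \<nu>" "sum_list (take (Suc r) \<mu>) < sum_list (take (Suc r) \<nu>)" by blast
    \<comment> \<open>Passing from h_\<nu> to eigenvectors only moves upwards, where partial sums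
      are no smaller, so the same \<open>r\<close> remains admissible.\<close>
    have gen: "scale_sf ((1 - t) ^ 2 * t ^ r * x) (scale_sf c (w \<rho>)) \<in> additive_span ?G"
      if "c \<in> R" "\<rho> = \<nu> \<or> below \<nu> \<rho>" for c \<rho>
    proof -
      have "sum_list (take (Suc r) \<nu>) \<le> sum_list (take (Suc r) \<rho>)"
        using that(2) by (auto simp: below_def dominates_def)
      then have "sum_list (take (Suc r) \<mu>) < sum_list (take (Suc r) \<rho>)" using \<nu>(2) by linarith
      moreover have "below \<mu> \<rho>" using that(2) \<nu>(1) below_trans by blast
      moreover have "x * c \<in> R" by (intro subring_setD(3)[OF R] x that)
      ultimately have "scale_sf ((1 - t) ^ 2 * t ^ r * (x * c)) (w \<rho>) \<in> ?G" by blast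
      then show ?thesis by (simp add: additive_span_base mult.assoc)
    qed
    have "scale_sf ((1 - t) ^ 2 * t ^ r * x) (?h \<nu> - w \<nu>) \<in> additive_span ?G"
      using hw[OF \<nu>(1)] unfolding rspan_def
    proof (rule additive_span_image[where f = "scale_sf ((1 - t) ^ 2 * t ^ r * x)", rotated 3])
      fix y assume "y \<in> {scale_sf c b |c b. c \<in> A \<and> b \<in> w ` {\<rho>. below \<nu> \<rho>}}"
      then obtain c \<rho> where y: "y = scale_sf c (w \<rho>)" and "c \<in> A" "below \<nu> \<rho>" by blast
      then show "scale_sf ((1 - t) ^ 2 * t ^ r * x) y \<in> additive_span ?G"
        unfolding y by (intro gen ideal_setD(2)[OF A]) auto
    qed (simp_all add: sf.scale_right_distrib)
    moreover have "scale_sf ((1 - t) ^ 2 * t ^ r * x) (w \<nu>) \<in> additive_span ?G"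
      using gen[of 1 \<nu>] subring_setD(1)[OF R] by simp
    ultimately have "scale_sf ((1 - t) ^ 2 * t ^ r * x) (?h \<nu> - w \<nu>) + scale_sf ((1 - t) ^ 2 * t ^ r * x) (w \<nu>) \<in> additive_span ?G"
      by (rule additive_span_plus)
    then show "y \<in> additive_span ?G" by (simp add: y flip: sf.scale_right_distrib)
  qed
  then have "\<exists>y \<in> rspan A (w ` {\<nu>. below \<mu> \<nu>}). D y - scale_sf (?e \<mu>) y = - z"
  proof (induction rule: additive_span.induct)
    case zero
    show ?case by (rule bexI[of _ 0]) (simp_all add: D_def vertex_op_0)
  next
    case (add x y)
    then obtain y' where y': "y' \<in> rspan A (w ` {\<nu>. below \<mu> \<nu>})" "D y' - scale_sf (?e \<mu>) y' = - y" by blast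
    from add obtain r a \<nu> where x: "x = scale_sf ((1 - t) ^ 2 * t ^ r * a) (w \<nu>)" and a: "a \<in> R"
      and \<nu>: "below \<mu> \<nu>" "sum_list (take (Suc r) \<mu>) < sum_list (take (Suc r) \<nu>)" by blast
    \<comment> \<open>The coefficient for which the operator minus the eigenvalue of \<mu> sends the
      multiple of \<open>w \<nu>\<close> to \<open>- x\<close>.\<close>
    define c where "c = (1 - t) ^ 2 * t ^ r * a / (?e \<mu> - ?e \<nu>)"
    have ne: "?e \<mu> - ?e \<nu> \<noteq> 0" using ev[of \<mu> \<nu>] \<nu>(1) by (auto simp: below_def)
    have "c = (1 - t) ^ 2 * t ^ r / (?e \<mu> - ?e \<nu>) * a" by (simp add: c_def)
    then have cA: "c \<in> A" using ideal_setD(3)[OF A quot[OF \<nu>] a] by simp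
    have "D (scale_sf c (w \<nu>)) - scale_sf (?e \<mu>) (scale_sf c (w \<nu>)) = scale_sf (- ((?e \<mu> - ?e \<nu>) * c)) (w \<nu>)"
      using Dw[OF \<nu>(1)] by (simp add: D_def vertex_op_scale algebra_simps sf.scale_left_diff_distrib)
    also have "(?e \<mu> - ?e \<nu>) * c = (1 - t) ^ 2 * t ^ r * a" using ne by (simp add: c_def)
    finally have "D (scale_sf c (w \<nu>)) - scale_sf (?e \<mu>) (scale_sf c (w \<nu>)) = - x" by (simp add: x)
    moreover have "D (a + b) - scale_sf (?e \<mu>) (a + b) = (D a - scale_sf (?e \<mu>) a) + (D b - scale_sf (?e \<mu>) b)" for a b
      by (simp add: D_def vertex_op_add sf.scale_right_distrib)
    ultimately have "D (scale_sf c (w \<nu>) + y') - scale_sf (?e \<mu>) (scale_sf c (w \<nu>) + y') = - (x + y)"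
      using y'(2) by (simp only:) simp
    moreover have "scale_sf c (w \<nu>) + y' \<in> rspan A (w ` {\<nu>. below \<mu> \<nu>})"
      using \<nu>(1) by (intro rspan_plus y' rspan_gen cA) blast
    ultimately show ?case by (intro bexI[of _ "scale_sf c (w \<nu>) + y'"])
  qed
  then obtain y where y: "y \<in> rspan A (w ` {\<nu>. below \<mu> \<nu>})" "D y - scale_sf (?e \<mu>) y = - z" by blast
  have "D (?h \<mu> + y) - scale_sf (?e \<mu>) (?h \<mu> + y) = z + (D y - scale_sf (?e \<mu>) y)"
    by (simp add: z_def D_def vertex_op_add sf.scale_right_distrib)
  then have "D (?h \<mu> + y) = scale_sf (?e \<mu>) (?h \<mu> + y)" by (simp add: y(2))
  moreover have "y \<in> rspan A (?h ` {\<nu>. below \<mu> \<nu>})"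
  proof (rule rspan_ideal[OF ideal_setD(3)[OF A] _ y(1)])
    fix b assume "b \<in> w ` {\<nu>. below \<mu> \<nu>}"
    then obtain \<nu> where \<nu>: "below \<mu> \<nu>" "b = w \<nu>" by blast
    have "w \<nu> - ?h \<nu> \<in> rspan R (?h ` {\<nu>. below \<mu> \<nu>})"
      by (rule rspan_mono[OF wh[OF \<nu>(1)]]) (use \<nu> below_trans ideal_setD(2)[OF A] in blast)+
    moreover have "?h \<nu> \<in> rspan R (?h ` {\<nu>. below \<mu> \<nu>})" using \<nu> by (intro rspan_base R) blast
    ultimately have "(w \<nu> - ?h \<nu>) + ?h \<nu> \<in> rspan R (?h ` {\<nu>. below \<mu> \<nu>})" by (rule rspan_plus)
    then show "b \<in> rspan R (?h ` {\<nu>. below \<mu> \<nu>})" by (simp add: \<nu>)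
  qed
  ultimately show ?case by (intro exI[of _ "?h \<mu> + y"]) simp
qed

section \<open>Conjugate partitions\<close>

lemma finite_part_gt: "finite {i. j < part \<mu> i}"
  by (rule finite_subset[of _ "{..<length \<mu>}"]) (auto simp: part_def split: if_splits)

lemma conj_partition_props:
  assumes "is_partition \<mu>"
  shows is_partition_conj: "is_partition (conj_partition \<mu>)"
    and part_conj: "part (conj_partition \<mu>) j = card {i. j < part \<mu> i}"
proof -
  have part: "part (conj_partition \<mu>) j = card {i. j < part \<mu> i}" for j
  proof (cases \<mu>)
    case Nil
    then show ?thesis by (simp add: part_def)
  next
    case (Cons p \<nu>)
    have len: "length (filter (\<lambda>x. j < x) \<mu>) = card {i. j < part \<mu> i}"
      unfolding length_filter_conv_card by (rule arg_cong[where f = card]) (auto simp: part_def split: if_splits)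
    have le: "part \<mu> i \<le> p" for i using part_antimono[OF assms, of 0 i] Cons by (simp add: part_def)
    have "card {i. j < part \<mu> i} = 0" if "p \<le> j"
    proof -
      have "\<not> j < part \<mu> i" for i using le[of i] that by linarith
      then show ?thesis by simp
    qed
    then show ?thesis using len by (auto simp: part_def Cons)
  qed
  then show "part (conj_partition \<mu>) j = card {i. j < part \<mu> i}" .
  have nz: "conj_partition \<mu> ! j \<noteq> 0" if "j < length (conj_partition \<mu>)" for j
  proof (cases \<mu>)
    case (Cons p \<nu>)
    then have "j < p" using that by simp
    then have "0 \<in> {i. j < part \<mu> i}" by (simp add: part_def Cons)
    then have "card {i. j < part \<mu> i} \<noteq> 0" using finite_part_gt by (metis card_0_eq empty_iff)
    then show ?thesis using part[of j] that by (simp add: part_def)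
  qed (use that in simp)
  have "conj_partition \<mu> ! j \<le> conj_partition \<mu> ! i" if "i < j" "j < length (conj_partition \<mu>)" for i j
  proof -
    have "card {k. j < part \<mu> k} \<le> card {k. i < part \<mu> k}"
      using that by (intro card_mono finite_part_gt) auto
    then show ?thesis using part[of i] part[of j] that by (simp add: part_def)
  qed
  then show "is_partition (conj_partition \<mu>)"
    using nz by (auto simp: is_partition_def sorted_wrt_iff_nth_less in_set_conv_nth)
qed

text \<open>Rows decrease in length, so the rows longer than j form an initial segment and are
  described by their number.\<close>

lemma part_conj_iff:
  assumes "is_partition \<mu>"
  shows "i < part (conj_partition \<mu>) j \<longleftrightarrow> j < part \<mu> i"
proof -
  let ?S = "{i. j < part \<mu> i}"
  have down: "k \<in> ?S" if "i \<in> ?S" "k \<le> i" for i k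
    using that part_antimono[OF assms, of k i] by auto
  have "?S = {..<card ?S}"
  proof (rule card_seteq[symmetric])
    show "{..<card ?S} \<subseteq> ?S"
    proof
      fix k assume k: "k \<in> {..<card ?S}"
      show "k \<in> ?S"
      proof (rule ccontr)
        assume "k \<notin> ?S"
        then have "?S \<subseteq> {..<k}" using down by (meson lessThan_iff not_le subsetI)
        then have "card ?S \<le> k" using card_mono[of "{..<k}" ?S] by simp
        then show False using k by simp
      qed
    qed
  qed (simp_all add: finite_part_gt)
  then show ?thesis unfolding part_conj[OF assms] by (metis lessThan_iff mem_Collect_eq)
qed

lemma conj_conj:
  assumes "is_partition \<mu>"
  shows "conj_partition (conj_partition \<mu>) = \<mu>"
proof (rule partition_eq_partI)
  note p = is_partition_conj[OF assms]
  show "is_partition (conj_partition (conj_partition \<mu>))" by (rule is_partition_conj[OF p])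
  show "part (conj_partition (conj_partition \<mu>)) i = part \<mu> i" for i
  proof -
    have "k < part (conj_partition (conj_partition \<mu>)) i \<longleftrightarrow> k < part \<mu> i" for k
      by (simp add: part_conj_iff[OF p] part_conj_iff[OF assms])
    then show ?thesis by (metis linorder_neqE_nat less_irrefl)
  qed
qed (rule assms)

lemma sum_list_eq_part: "length \<mu> \<le> N \<Longrightarrow> sum_list \<mu> = (\<Sum>i<N. part \<mu> i)"
  using sum_list_take[of N \<mu>] by simp

text \<open>The cells in the first k columns, counted by rows.\<close>

lemma sum_take_conj:
  assumes "is_partition \<mu>" "length \<mu> \<le> N"
  shows "sum_list (take k (conj_partition \<mu>)) = (\<Sum>i<N. min (part \<mu> i) k)"
proof -
  have "{i. j < part \<mu> i} = {i \<in> {..<N}. j < part \<mu> i}" for j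
    using assms(2) by (auto simp: part_def split: if_splits)
  then have "sum_list (take k (conj_partition \<mu>)) = (\<Sum>j<k. \<Sum>i<N. if j < part \<mu> i then 1 else 0)"
    by (simp add: sum_list_take part_conj[OF assms(1)] sum.If_cases Int_def)
  also have "\<dots> = (\<Sum>i<N. \<Sum>j<k. if j < part \<mu> i then 1 else 0)" by (rule sum.swap)
  also have "\<dots> = (\<Sum>i<N. min (part \<mu> i) k)"
  proof (rule sum.cong[OF refl])
    fix i
    have "{..<k} \<inter> {j. j < part \<mu> i} = {..<min (part \<mu> i) k}" by auto
    then show "(\<Sum>j<k. if j < part \<mu> i then 1 else 0) = min (part \<mu> i) k" by (simp add: sum.If_cases)
  qed
  finally show ?thesis .
qed

lemma sum_list_conj:
  assumes "is_partition \<mu>"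
  shows "sum_list (conj_partition \<mu>) = sum_list \<mu>"
proof -
  define k where "k = max (length (conj_partition \<mu>)) (sum_list \<mu>)"
  have "part \<mu> i \<le> k" for i
    by (auto simp: part_def k_def intro!: max.coboundedI2 member_le_sum_list)
  then have "sum_list (take k (conj_partition \<mu>)) = (\<Sum>i<length \<mu>. part \<mu> i)"
    using assms by (subst sum_take_conj[of _ "length \<mu>"]) (auto simp: min_absorb1)
  then show ?thesis by (simp add: k_def sum_list_eq_part[of \<mu> "length \<mu>"])
qed

text \<open>The first k columns of \<nu> contain at most k cells in each of the first r rows and at
  most the whole of every later row. For \<mu> this bound is attained, and its tail is at least that
  of \<nu> by dominance.\<close>

lemma dominates_conj:
  assumes p: "is_partition \<mu>" "is_partition \<nu>" and dom: "dominates \<nu> \<mu>"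
  shows "dominates (conj_partition \<mu>) (conj_partition \<nu>)"
proof -
  define N where "N = max (length \<mu>) (length \<nu>)"
  have N: "length \<mu> \<le> N" "length \<nu> \<le> N" by (auto simp: N_def)
  have le: "(\<Sum>i<N. min (part \<nu> i) k) \<le> (\<Sum>i<N. min (part \<mu> i) k)" for k
  proof -
    \<comment> \<open>The number of rows of \<mu> longer than k, at which the minimum changes
      branch.\<close>
    define r where "r = part (conj_partition \<mu>) k"
    have r: "i < r \<longleftrightarrow> k < part \<mu> i" for i by (simp add: r_def part_conj_iff[OF p(1)])
    have "r \<le> N"
    proof (rule ccontr)
      assume "\<not> r \<le> N"
      then have "k < part \<mu> N" using r[of N] by simp
      then show False using N by (simp add: part_def split: if_splits)
    qed
    then have split: "(\<Sum>i<N. f i) = (\<Sum>i<r. f i) + (\<Sum>i=r..<N. f i)" for f :: "nat \<Rightarrow> nat"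
      by (metis lessThan_atLeast0 sum.atLeastLessThan_concat zero_le)
    have "(\<Sum>i<N. min (part \<nu> i) k) \<le> (\<Sum>i<r. k) + (\<Sum>i=r..<N. part \<nu> i)"
      unfolding split by (intro add_mono sum_mono) auto
    moreover have "(\<Sum>i<N. min (part \<mu> i) k) = (\<Sum>i<r. k) + (\<Sum>i=r..<N. part \<mu> i)"
      unfolding split using r by (intro arg_cong2[where f = "(+)"] sum.cong) (auto simp: min_def not_less[symmetric])
    moreover have "(\<Sum>i<r. part \<nu> i) + (\<Sum>i=r..<N. part \<nu> i) = (\<Sum>i<r. part \<mu> i) + (\<Sum>i=r..<N. part \<mu> i)"
      using dom N by (simp add: dominates_def sum_list_eq_part[of _ N] flip: split)
    moreover have "(\<Sum>i<r. part \<mu> i) \<le> (\<Sum>i<r. part \<nu> i)"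
      using dom by (simp add: dominates_def flip: sum_list_take)
    ultimately show ?thesis by linarith
  qed
  show ?thesis
    unfolding dominates_def
    using le p dom by (simp add: sum_take_conj[OF _ N(1)] sum_take_conj[OF _ N(2)] sum_list_conj) (simp add: dominates_def)
qed

text \<open>Conjugation reverses dominance. This is why the two triangularity conditions together
  leave a single partition.\<close>

lemma dominates_both:
  assumes "is_partition \<mu>" "is_partition \<nu>" "dominates \<nu> \<mu>" "dominates (conj_partition \<nu>) (conj_partition \<mu>)"
  shows "\<nu> = \<mu>"
proof -
  have "conj_partition \<nu> = conj_partition \<mu>"
    by (rule dominates_antisym[OF is_partition_conj[OF assms(2)] is_partition_conj[OF assms(1)] assms(4)
          dominates_conj[OF assms(1,2,3)]])
  then show ?thesis using conj_conj assms by metis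
qed

text \<open>Rows beyond the length contribute zero, which allows two partitions to be compared with
  a common bound \<open>N\<close>.\<close>

lemma vertex_eigenvalue_parts:
  assumes "length \<mu> \<le> N"
  shows "vertex_eigenvalue q t \<mu> = 1 - (1 - t) * (\<Sum>i<N. t ^ i * (1 - q ^ part \<mu> i))"
proof -
  have "(\<Sum>i<N. t ^ i * (1 - q ^ part \<mu> i)) = (\<Sum>i<length \<mu>. t ^ i * (1 - q ^ (\<mu> ! i)))"
    using assms by (intro sum.mono_neutral_cong_right) (auto simp: part_def)
  moreover have "(1 - t) * (\<Sum>i<length \<mu>. t ^ i * (1 - q ^ (\<mu> ! i)))
      = (1 - t) * (\<Sum>i<length \<mu>. t ^ i) - (\<Sum>i<length \<mu>. (1 - t) * t ^ i * q ^ (\<mu> ! i))"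
    by (simp add: right_diff_distrib sum_subtractf sum_distrib_left mult.assoc)
  moreover have "(1 - t) * (\<Sum>i<length \<mu>. t ^ i) = 1 - t ^ length \<mu>"
    by (rule one_diff_power_eq[symmetric])
  ultimately show ?thesis unfolding vertex_eigenvalue_def by (simp only:) simp
qed

text \<open>Summed over cells, the expression changes under the exchange of q and t only by
  transposing the diagram.\<close>

lemma vertex_eigenvalue_conj:
  fixes q t :: "'a :: field_char_0"
  assumes "is_partition \<mu>"
  shows "vertex_eigenvalue t q (conj_partition \<mu>) = vertex_eigenvalue q t \<mu>"
proof -
  let ?\<nu> = "conj_partition \<mu>"
  have cells: "vertex_eigenvalue q t \<mu> = 1 - (1 - t) * (1 - q) * (\<Sum>i<N. \<Sum>j<M. if j < part \<mu> i then t ^ i * q ^ j else 0)"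
    if N: "length \<mu> \<le> N" and M: "\<And>i. part \<mu> i \<le> M" for q t :: 'a and \<mu> N M
  proof -
    have "1 - q ^ part \<mu> i = (1 - q) * (\<Sum>j<M. if j < part \<mu> i then q ^ j else 0)" for i
    proof -
      have "{..<M} \<inter> {j. j < part \<mu> i} = {..<part \<mu> i}" using M[of i] by auto
      then show ?thesis by (simp add: one_diff_power_eq sum.If_cases)
    qed
    then show ?thesis
      unfolding vertex_eigenvalue_parts[OF N]
      by (simp add: sum_distrib_left mult_ac if_distrib cong: if_cong)
  qed
  \<comment> \<open>A square of this side contains the diagram and its transpose.\<close>
  define N where "N = length \<mu> + sum_list \<mu> + length ?\<nu> + sum_list ?\<nu>"
  have M: "part \<rho> i \<le> sum_list \<rho>" for \<rho> :: "nat list" and i by (auto simp: part_def member_le_sum_list)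
  have "part \<mu> i \<le> N" "part ?\<nu> i \<le> N" for i using M[of \<mu> i] M[of ?\<nu> i] by (auto simp: N_def)
  then have "vertex_eigenvalue t q ?\<nu> = 1 - (1 - q) * (1 - t) * (\<Sum>j<N. \<Sum>i<N. if i < part ?\<nu> j then q ^ j * t ^ i else 0)"
    and *: "vertex_eigenvalue q t \<mu> = 1 - (1 - t) * (1 - q) * (\<Sum>i<N. \<Sum>j<N. if j < part \<mu> i then t ^ i * q ^ j else 0)"
    by (intro cells; simp add: N_def)+
  note this(1)
  also have "(\<Sum>j<N. \<Sum>i<N. if i < part ?\<nu> j then q ^ j * t ^ i else 0) = (\<Sum>i<N. \<Sum>j<N. if j < part \<mu> i then t ^ i * q ^ j else 0)"
    unfolding part_conj_iff[OF assms] by (subst sum.swap, intro sum.cong refl) (simp add: mult.commute)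
  finally show ?thesis by (simp only: * mult.commute[of "1 - q"])
qed

section \<open>Macdonald polynomials as joint eigenvectors\<close>

text \<open>The operator \<open>D\<^sub>0\<close> of Garsia and Haiman.\<close>

abbreviation macdonald_operator :: "'a :: field_char_0 \<Rightarrow> 'a \<Rightarrow> 'a symfun \<Rightarrow> 'a symfun" where
  "macdonald_operator q t \<equiv> vertex_op (\<lambda>r. (1 - q ^ r) * (1 - t ^ r)) (\<lambda>k. (-1) ^ k * esym k)"

abbreviation divide_alphabet :: "'a :: field_char_0 \<Rightarrow> 'a symfun \<Rightarrow> 'a symfun" where
  "divide_alphabet q \<equiv> alphabet_scaling (\<lambda>r. 1 / (1 - q ^ r))"

abbreviation multiply_alphabet :: "'a :: field_char_0 \<Rightarrow> 'a symfun \<Rightarrow> 'a symfun" where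
  "multiply_alphabet q \<equiv> alphabet_scaling (\<lambda>r. 1 - q ^ r)"

lemma multiply_divide_alphabet:
  assumes "\<And>r. r > 0 \<Longrightarrow> q ^ r \<noteq> 1"
  shows "multiply_alphabet q (divide_alphabet q F) = F" "divide_alphabet q (multiply_alphabet q F) = F"
  unfolding alphabet_scaling_compose by (rule alphabet_scaling_id, use assms in simp)+

lemma macdonald_operator_commute: "macdonald_operator q t = macdonald_operator t q"
  by (simp add: mult.commute)

text \<open>The substitution X to X(1 - q) intertwines D_0 with its triangular form and is
  invertible, so eigenvectors can be carried back.\<close>

lemma macdonald_operator_eigen:
  assumes q: "\<And>r. r > 0 \<Longrightarrow> q ^ r \<noteq> 1"
    and w: "vertex_op (\<lambda>r. 1 - t ^ r) (gamma q) w = scale_sf e w"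
  shows "macdonald_operator q t (divide_alphabet q w) = scale_sf e (divide_alphabet q w)"
proof -
  have c: "(\<lambda>r. (1 - q ^ r) * (1 - t ^ r) / (1 - q ^ r)) = (\<lambda>r. 1 - t ^ r)"
  proof
    fix r show "(1 - q ^ r) * (1 - t ^ r) / (1 - q ^ r) = 1 - t ^ r"
      \<comment> \<open>At r = 0 both sides are 0, the quotient by convention.\<close>
      using q[of r] by (cases "r = 0") auto
  qed
  have "multiply_alphabet q (macdonald_operator q t (divide_alphabet q w))
    = vertex_op (\<lambda>r. (1 - q ^ r) * (1 - t ^ r) / (1 - q ^ r)) (gamma q) (multiply_alphabet q (divide_alphabet q w))"
    unfolding gamma_def[abs_def] by (rule alphabet_scaling_vertex_op) (use q in simp)
  also have "\<dots> = multiply_alphabet q (scale_sf e (divide_alphabet q w))"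
    by (simp only: c multiply_divide_alphabet[OF q] w alphabet_scaling_simps(5))
  finally have "divide_alphabet q (multiply_alphabet q (macdonald_operator q t (divide_alphabet q w)))
    = divide_alphabet q (multiply_alphabet q (scale_sf e (divide_alphabet q w)))" by (rule arg_cong)
  then show ?thesis by (simp only: multiply_divide_alphabet(2)[OF q])
qed

text \<open>A scaling acts diagonally on products of power sums, with products of the c_r as
  eigenvalues.\<close>

lemma scaling_lattice:
  fixes R :: "'a :: field_char_0 set"
  assumes R: "subring_set R" and c: "\<And>r. r > 0 \<Longrightarrow> c r \<in> R" and F: "F \<in> rspan R (glist psym ` long_partitions n k)"
  shows "alphabet_scaling c F \<in> rspan R (glist psym ` long_partitions n k)"
proof (rule rspan_image[where f = "alphabet_scaling c", OF alphabet_scaling_simps(3,2) _ F])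
  fix a and b :: "'a symfun" assume a: "a \<in> R" and "b \<in> glist psym ` long_partitions n k"
  then obtain \<mu> where \<mu>: "\<mu> \<in> long_partitions n k" "b = glist psym \<mu>" by blast
  have "0 \<notin> set \<mu>" using \<mu> by (simp add: long_partitions_def is_partition_def)
  then have "glist c \<mu> \<in> R \<and> alphabet_scaling c (glist psym \<mu>) = scale_sf (glist c \<mu>) (glist psym \<mu>)"
    by (induction \<mu>) (auto simp: alphabet_scaling_simps(1,4,7) scale_sf_mult mult_scale_sf mult.commute
        intro: c subring_setD(1,3)[OF R])
  then show "alphabet_scaling c (scale_sf a b) \<in> rspan R (glist psym ` long_partitions n k)"
    using \<mu> by (auto simp: alphabet_scaling_simps(5) intro!: rspan_gen subring_setD(3)[OF R a])
qed

lemma span_divide: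
  assumes F: "F \<in> sf.span (w ` J)"
  shows "divide_alphabet a F \<in> sf.span ((\<lambda>\<mu>. divide_alphabet a (w \<mu>)) ` J)"
  using F
proof (induction rule: sf.span_induct_alt)
  case (step c x y)
  then have "divide_alphabet a x \<in> sf.span ((\<lambda>\<mu>. divide_alphabet a (w \<mu>)) ` J)"
    by (intro sf.span_base) auto
  then show ?case
    unfolding alphabet_scaling_simps(3,5) using step.IH by (intro sf.span_add sf.span_scale)
qed (simp add: alphabet_scaling_simps sf.span_zero)

lemma basis_family_scaling:
  assumes b: "basis_family I b" and q: "\<And>r. r > 0 \<Longrightarrow> q ^ r \<noteq> 1"
  shows "basis_family I (\<lambda>i. divide_alphabet q (b i))"
proof (rule basis_familyI)
  have "F \<in> sf.span ((\<lambda>i. divide_alphabet q (b i)) ` I)" for F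
  proof -
    have "multiply_alphabet q F \<in> sf.span (b ` I)" using b by (simp add: basis_family_def)
    then have "divide_alphabet q (multiply_alphabet q F) \<in> sf.span ((\<lambda>i. divide_alphabet q (b i)) ` I)"
      by (rule span_divide)
    then show ?thesis by (simp only: multiply_divide_alphabet(2)[OF q])
  qed
  then show "sf.span ((\<lambda>i. divide_alphabet q (b i)) ` I) = UNIV" by blast
  fix J x i
  assume J: "finite J" "J \<subseteq> I" "(\<Sum>j\<in>J. scale_sf (x j) (divide_alphabet q (b j))) = 0" "i \<in> J"
  have "multiply_alphabet q (\<Sum>j\<in>J. scale_sf (x j) (divide_alphabet q (b j))) = (\<Sum>j\<in>J. scale_sf (x j) (b j))"
    by (simp only: alphabet_scaling_simps(5,6) multiply_divide_alphabet[OF q])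
  then have sum0: "(\<Sum>j\<in>J. scale_sf (x j) (b j)) = 0" using J(3) by (simp add: alphabet_scaling_simps(2))
  have "coordinate I b (\<Sum>j\<in>J. scale_sf (x j) (b j)) i = (\<Sum>j\<in>J. if j = i then x j else 0)"
    unfolding coordinate_sum[OF b] coordinate_scale[OF b]
    using J(2) by (intro sum.cong) (auto simp: coordinate_basis[OF b])
  then show "x i = 0" using J(1,4) by (simp add: sum0 coordinate_zero[OF b])
qed

lemma coordinate_single:
  assumes b: "basis_family I b" and 0: "\<And>j. j \<noteq> i \<Longrightarrow> coordinate I b F j = 0"
  shows "F = scale_sf (coordinate I b F i) (b i)"
proof -
  have "F = (\<Sum>j | coordinate I b F j \<noteq> 0. scale_sf (coordinate I b F j) (b j))"
    by (rule coordinate_expand[OF b])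
  also have "\<dots> = (\<Sum>j\<in>{i}. scale_sf (coordinate I b F j) (b j))"
    by (rule sum.mono_neutral_left) (use 0 in auto)
  finally show ?thesis by simp
qed

lemma coordinate_eigen:
  assumes b: "basis_family I b"
    and D: "\<And>F G. D (F + G) = D F + D G" "\<And>c F. D (scale_sf c F) = scale_sf c (D F)"
    and Db: "\<And>i. i \<in> I \<Longrightarrow> D (b i) = scale_sf (e i) (b i)"
  shows "coordinate I b (D F) i = e i * coordinate I b F i"
proof (cases "i \<in> I")
  case True
  have "F \<in> sf.span (b ` I)" using b by (simp add: basis_family_def)
  then show ?thesis
  proof (induction rule: sf.span_induct_alt)
    case base
    show ?case using D(2)[of 0 0] by (simp add: coordinate_zero[OF b])
  next
    case (step c x y)
    then obtain j where j: "j \<in> I" "x = b j" by blast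
    then show ?case
      using step.IH
      by (simp add: D Db coordinate_add[OF b] coordinate_scale[OF b] coordinate_basis[OF b] algebra_simps)
  qed
qed (simp add: coordinate_def)

text \<open>The first condition makes X to X(1 - q) and X to X(1 - t) invertible, the second makes
  the spectrum simple.\<close>

definition generic_parameters :: "'a :: field_char_0 \<Rightarrow> 'a \<Rightarrow> bool" where
  "generic_parameters q t \<longleftrightarrow> (\<forall>r>0. q ^ r \<noteq> 1 \<and> t ^ r \<noteq> 1) \<and>
     inj_on (vertex_eigenvalue q t) partitions"

text \<open>These vectors live after the substitution X to X(1 - q);
  \<open>divide_alphabet q\<close> carries them to eigenfunctions of
  \<open>macdonald_operator\<close>.\<close>

definition eigenbasis :: "'a :: field_char_0 \<Rightarrow> 'a \<Rightarrow> (nat list \<Rightarrow> 'a symfun) \<Rightarrow> bool" where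
  "eigenbasis q t v \<longleftrightarrow> (\<forall>\<mu>. is_partition \<mu> \<longrightarrow>
     vertex_op (\<lambda>r. 1 - t ^ r) (gamma q) (v \<mu>) = scale_sf (vertex_eigenvalue q t \<mu>) (v \<mu>) \<and>
     v \<mu> - glist hsym \<mu> \<in> rspan UNIV (glist hsym ` {\<nu>. below \<mu> \<nu>}))"

lemma eigenbasis_triangular:
  fixes v :: "nat list \<Rightarrow> 'a :: field_char_0 symfun"
  assumes "eigenbasis q t v"
  shows "basis_family partitions v"
    and "is_partition \<mu> \<Longrightarrow> sf.span (v ` {\<nu>. is_partition \<nu> \<and> dominates \<nu> \<mu>})
      = sf.span (schur ` {\<nu>. is_partition \<nu> \<and> dominates \<nu> \<mu>})"
proof -
  have eq: "{\<nu>. below \<mu> \<nu>} = {\<nu> \<in> partitions. below \<mu> \<nu>}" for \<mu> by (auto simp: below_def)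
  have tri: "v \<mu> - scale_sf 1 (glist hsym \<mu>) \<in> sf.span (glist hsym ` {\<nu> \<in> partitions. below \<mu> \<nu>})"
    if "\<mu> \<in> partitions" for \<mu>
    using assms that unfolding eigenbasis_def rspan_UNIV eq by simp
  note * = triangular_basis[OF hsym_basis below_irrefl below_trans finite_below _ tri]
  show "basis_family partitions v" by (rule *(1)) auto
  assume \<mu>: "is_partition \<mu>"
  have "sf.span (v ` {\<nu> \<in> partitions. \<nu> = \<mu> \<or> below \<mu> \<nu>}) = sf.span (glist hsym ` {\<nu> \<in> partitions. \<nu> = \<mu> \<or> below \<mu> \<nu>})"
    by (rule *(2)) (use \<mu> in auto)
  then show "sf.span (v ` {\<nu>. is_partition \<nu> \<and> dominates \<nu> \<mu>})
      = sf.span (schur ` {\<nu>. is_partition \<nu> \<and> dominates \<nu> \<mu>})"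
    unfolding dominating_set_eq[OF \<mu>] span_schur_eq[OF \<mu>] .
qed

context
  fixes q t :: "'a :: field_char_0" and v v' :: "nat list \<Rightarrow> 'a symfun"
  assumes generic: "generic_parameters q t"
    and eb: "eigenbasis q t v" and eb': "eigenbasis t q v'"
begin

lemma q: "r > 0 \<Longrightarrow> q ^ r \<noteq> 1" and t: "r > 0 \<Longrightarrow> t ^ r \<noteq> 1"
  using generic by (auto simp: generic_parameters_def)

lemma v: "is_partition \<mu> \<Longrightarrow> vertex_op (\<lambda>r. 1 - t ^ r) (gamma q) (v \<mu>) = scale_sf (vertex_eigenvalue q t \<mu>) (v \<mu>)"
  and v': "is_partition \<mu> \<Longrightarrow> vertex_op (\<lambda>r. 1 - q ^ r) (gamma t) (v' \<mu>) = scale_sf (vertex_eigenvalue t q \<mu>) (v' \<mu>)"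
  using eb eb' by (auto simp: eigenbasis_def)

lemma basis_F: "basis_family partitions (\<lambda>\<mu>. divide_alphabet q (v \<mu>))"
  by (rule basis_family_scaling[OF eigenbasis_triangular(1)[OF eb] q])

lemma basis_F': "basis_family partitions (\<lambda>\<mu>. divide_alphabet t (v' \<mu>))"
  by (rule basis_family_scaling[OF eigenbasis_triangular(1)[OF eb'] t])

text \<open>D_0 is symmetric in q and t, so both families consist of its eigenfunctions. The
  eigenvalues agree after conjugation, and the spectrum is simple.\<close>

lemma F'_conj:
  assumes \<mu>: "is_partition \<mu>"
  shows "\<exists>c. c \<noteq> 0 \<and> divide_alphabet t (v' (conj_partition \<mu>)) = scale_sf c (divide_alphabet q (v \<mu>))"
proof -
  let ?F = "\<lambda>\<mu>. divide_alphabet q (v \<mu>)" and ?F' = "\<lambda>\<mu>. divide_alphabet t (v' \<mu>)"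
  let ?D = "macdonald_operator q t" and ?c = "coordinate partitions (\<lambda>\<mu>. divide_alphabet q (v \<mu>))"
  have p: "is_partition (conj_partition \<mu>)" by (rule is_partition_conj[OF \<mu>])
  have D': "?D (?F' (conj_partition \<mu>)) = scale_sf (vertex_eigenvalue q t \<mu>) (?F' (conj_partition \<mu>))"
    unfolding macdonald_operator_commute[of q t] vertex_eigenvalue_conj[OF \<mu>, symmetric]
    by (rule macdonald_operator_eigen[OF t v'[OF p]])
  have c0: "?c (?F' (conj_partition \<mu>)) \<nu> = 0" if "\<nu> \<noteq> \<mu>" for \<nu>
  proof (rule ccontr)
    assume ne: "?c (?F' (conj_partition \<mu>)) \<nu> \<noteq> 0"
    then have \<nu>: "is_partition \<nu>" using coordinate_in[OF basis_F] by blast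
    have "?c (?D (?F' (conj_partition \<mu>))) \<nu> = vertex_eigenvalue q t \<nu> * ?c (?F' (conj_partition \<mu>)) \<nu>"
      by (rule coordinate_eigen[OF basis_F vertex_op_add vertex_op_scale])
        (use macdonald_operator_eigen[OF q v] in simp)
    then show False
      using ne inj_onD[of "vertex_eigenvalue q t" partitions \<nu> \<mu>] generic \<nu> \<mu> that unfolding generic_parameters_def D' coordinate_scale[OF basis_F] by simp
  qed
  define c where "c = ?c (?F' (conj_partition \<mu>)) \<mu>"
  have eq: "?F' (conj_partition \<mu>) = scale_sf c (?F \<mu>)"
    unfolding c_def by (rule coordinate_single[OF basis_F c0])
  have "?F' (conj_partition \<mu>) \<noteq> 0"
  proof
    assume 0: "?F' (conj_partition \<mu>) = 0"
    have "coordinate partitions ?F' (?F' (conj_partition \<mu>)) (conj_partition \<mu>) = 1"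
      using p by (subst coordinate_basis[OF basis_F']) auto
    then show False unfolding 0 by (simp add: coordinate_zero[OF basis_F'])
  qed
  then show ?thesis using eq by (intro exI[of _ c]) auto
qed

lemma F_in_flags:
  assumes \<mu>: "is_partition \<mu>"
  shows "multiply_alphabet q (divide_alphabet q (v \<mu>)) \<in> sf.span (schur ` {\<nu>. is_partition \<nu> \<and> dominates \<nu> \<mu>})"
    and "multiply_alphabet t (divide_alphabet q (v \<mu>)) \<in> sf.span (schur ` {\<nu>. is_partition \<nu> \<and> dominates \<nu> (conj_partition \<mu>)})"
proof -
  show "multiply_alphabet q (divide_alphabet q (v \<mu>)) \<in> sf.span (schur ` {\<nu>. is_partition \<nu> \<and> dominates \<nu> \<mu>})"
    unfolding eigenbasis_triangular(2)[OF eb \<mu>, symmetric]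
    by (simp only: multiply_divide_alphabet(1)[OF q], rule sf.span_base) (auto simp: \<mu> dominates_refl)
  obtain c where c: "c \<noteq> 0" "divide_alphabet t (v' (conj_partition \<mu>)) = scale_sf c (divide_alphabet q (v \<mu>))"
    using F'_conj[OF \<mu>] by blast
  then have "divide_alphabet q (v \<mu>) = scale_sf (1 / c) (divide_alphabet t (v' (conj_partition \<mu>)))" by simp
  then have "multiply_alphabet t (divide_alphabet q (v \<mu>)) = scale_sf (1 / c) (v' (conj_partition \<mu>))"
    by (simp only: alphabet_scaling_simps(5) multiply_divide_alphabet[OF t])
  also have "\<dots> \<in> sf.span (v' ` {\<nu>. is_partition \<nu> \<and> dominates \<nu> (conj_partition \<mu>)})"
    using is_partition_conj[OF \<mu>] by (intro sf.span_scale sf.span_base) (auto simp: dominates_refl)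
  finally show "multiply_alphabet t (divide_alphabet q (v \<mu>)) \<in> sf.span (schur ` {\<nu>. is_partition \<nu> \<and> dominates \<nu> (conj_partition \<mu>)})"
    unfolding eigenbasis_triangular(2)[OF eb' is_partition_conj[OF \<mu>]] .
qed

text \<open>The first condition confines the support in the eigenbasis to partitions dominating
  \<mu>. The second, transported by \<open>F'_conj\<close>, confines it to partitions whose
  conjugates dominate the conjugate of \<mu>.\<close>

lemma flags_unique:
  assumes \<mu>: "is_partition \<mu>"
    and Fq: "multiply_alphabet q F \<in> sf.span (schur ` {\<nu>. is_partition \<nu> \<and> dominates \<nu> \<mu>})"
    and Ft: "multiply_alphabet t F \<in> sf.span (schur ` {\<nu>. is_partition \<nu> \<and> dominates \<nu> (conj_partition \<mu>)})"
  shows "\<exists>c. F = scale_sf c (divide_alphabet q (v \<mu>))"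
proof -
  let ?F = "\<lambda>\<mu>. divide_alphabet q (v \<mu>)" and ?c = "coordinate partitions (\<lambda>\<mu>. divide_alphabet q (v \<mu>))"
  let ?I = "{\<nu>. is_partition \<nu> \<and> dominates \<nu> \<mu>}" and ?J = "{\<nu>. is_partition \<nu> \<and> dominates (conj_partition \<nu>) (conj_partition \<mu>)}"
  have "F \<in> sf.span (?F ` ?I)"
    using span_divide[OF Fq[folded eigenbasis_triangular(2)[OF eb \<mu>]], of q]
    by (simp only: multiply_divide_alphabet[OF q])
  then have I: "?c F \<nu> = 0" if "\<nu> \<notin> ?I" for \<nu>
    by (rule coordinate_span[OF basis_F _ _ that]) auto
  have "F \<in> sf.span ((\<lambda>\<mu>. divide_alphabet t (v' \<mu>)) ` {\<nu>. is_partition \<nu> \<and> dominates \<nu> (conj_partition \<mu>)})"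
    using span_divide[OF Ft[folded eigenbasis_triangular(2)[OF eb' is_partition_conj[OF \<mu>]]], of t]
    by (simp only: multiply_divide_alphabet[OF t])
  also have "\<dots> \<subseteq> sf.span (?F ` ?J)"
  proof (rule sf.span_minimal[OF _ sf.subspace_span], clarify)
    fix \<kappa> assume \<kappa>: "is_partition \<kappa>" "dominates \<kappa> (conj_partition \<mu>)"
    obtain c where "divide_alphabet t (v' (conj_partition (conj_partition \<kappa>))) = scale_sf c (?F (conj_partition \<kappa>))"
      using F'_conj[OF is_partition_conj[OF \<kappa>(1)]] by blast
    then have "divide_alphabet t (v' \<kappa>) = scale_sf c (?F (conj_partition \<kappa>))" by (simp only: conj_conj[OF \<kappa>(1)])
    also have "\<dots> \<in> sf.span (?F ` ?J)"
      using \<kappa> by (intro sf.span_scale sf.span_base) (auto simp: conj_conj is_partition_conj)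
    finally show "divide_alphabet t (v' \<kappa>) \<in> sf.span (?F ` ?J)" .
  qed
  finally have J: "?c F \<nu> = 0" if "\<nu> \<notin> ?J" for \<nu>
    by (rule coordinate_span[OF basis_F _ _ that]) auto
  have "?c F \<nu> = 0" if "\<nu> \<noteq> \<mu>" for \<nu>
    using I[of \<nu>] J[of \<nu>] dominates_both[OF \<mu>, of \<nu>] that by blast
  then show ?thesis by (intro exI[of _ "?c F \<mu>"] coordinate_single[OF basis_F])
qed

lemma F_degree:
  assumes \<mu>: "is_partition \<mu>"
  shows "divide_alphabet q (v \<mu>) \<in> rspan UNIV (glist psym ` long_partitions (sum_list \<mu>) 0)"
proof (rule scaling_lattice[OF subring_set_UNIV UNIV_I])
  have "v \<mu> - glist hsym \<mu> \<in> rspan UNIV (glist hsym ` long_partitions (sum_list \<mu>) 0)"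
    by (rule rspan_mono[of _ UNIV "glist hsym ` {\<nu>. below \<mu> \<nu>}"])
      (use eb \<mu> in \<open>auto simp: eigenbasis_def\<close>, auto simp: long_partitions_def below_def dominates_def)
  moreover have "glist hsym \<mu> \<in> rspan UNIV (glist hsym ` long_partitions (sum_list \<mu>) 0 :: 'a symfun set)"
    using \<mu> by (intro rspan_base) (auto simp: long_partitions_def)
  ultimately have "(v \<mu> - glist hsym \<mu>) + glist hsym \<mu> \<in> rspan UNIV (glist hsym ` long_partitions (sum_list \<mu>) 0)"
    by (rule rspan_plus)
  then show "v \<mu> \<in> rspan UNIV (glist psym ` long_partitions (sum_list \<mu>) 0)"
    by (simp add: rspan_psym_eq_hsym)
qed

end

text \<open>The triangularity conditions determine a line. On it the pairing with h_n is
  \<open>eval_h\<close>, so a nonzero value there gives exactly one normalized vector.\<close>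

lemma macdonald_H_eq:
  fixes v v' :: "nat list \<Rightarrow> ratfun_qt symfun"
  assumes gen: "generic_parameters qq tt" "eigenbasis qq tt v" "eigenbasis tt qq v'"
    and \<mu>: "is_partition \<mu>" and nz: "eval_h (divide_alphabet qq (v \<mu>)) \<noteq> 0"
  shows "macdonald_H \<mu> = scale_sf (1 / eval_h (divide_alphabet qq (v \<mu>))) (divide_alphabet qq (v \<mu>))"
proof -
  let ?F = "divide_alphabet qq (v \<mu>)"
  have deg: "hall (scale_sf c ?F) (hsym (sum_list \<mu>)) = c * eval_h ?F" for c
  proof -
    have "scale_sf c ?F \<in> rspan UNIV (glist hsym ` long_partitions (sum_list \<mu>) 0)"
      unfolding rspan_psym_eq_hsym[OF rational_subring_UNIV, symmetric]
      by (intro rspan_scale F_degree[OF gen \<mu>]) auto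
    then show ?thesis by (simp add: hall_hsym eval_h_simps)
  qed
  show ?thesis
    unfolding macdonald_H_def
  proof (rule the_equality)
    show "is_modified_macdonald \<mu> (scale_sf (1 / eval_h ?F) ?F)"
      unfolding is_modified_macdonald_def psym_scaling_eq alphabet_scaling_simps(5) deg
      using nz F_in_flags[OF gen \<mu>] by (auto intro: sf.span_scale)
    fix G assume G: "is_modified_macdonald \<mu> G"
    then obtain c where c: "G = scale_sf c ?F"
      using flags_unique[OF gen \<mu>] unfolding is_modified_macdonald_def psym_scaling_eq by blast
    have "c * eval_h ?F = 1" using G deg[of c] by (simp add: is_modified_macdonald_def c)
    then show "G = scale_sf (1 / eval_h ?F) ?F" using nz by (simp add: c field_simps)
  qed
qed

section \<open>Pochhammer symbols\<close>

text \<open>The symbol (q;q)_n.\<close>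

definition q_poch :: "'a :: field \<Rightarrow> nat \<Rightarrow> 'a" where
  "q_poch q n = (\<Prod>i=1..n. 1 - q ^ i)"

lemma q_poch_simps [simp]: "q_poch q 0 = 1" "q_poch q (Suc n) = q_poch q n * (1 - q ^ Suc n)"
  by (simp_all add: q_poch_def)

lemma q_poch_nonzero: "(\<And>r. r > 0 \<Longrightarrow> q ^ r \<noteq> 1) \<Longrightarrow> q_poch q n \<noteq> 0"
  by (simp add: q_poch_def)

text \<open>The value is h_n[1/(1 - q)]. Splitting this alphabet as 1 + q/(1 - q) expresses each
  term as a sum over all earlier ones and itself; subtracting consecutive sums gives the
  recursion.\<close>

lemma newton_q_poch:
  fixes q :: "'a :: field_char_0"
  assumes q: "\<And>r. r > 0 \<Longrightarrow> q ^ r \<noteq> 1" and x: "newton (\<lambda>r. 1 / (1 - q ^ r)) x"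
  shows "x n = 1 / q_poch q n"
proof (induction n)
  case 0
  show ?case using newtonD(1)[OF x] by simp
next
  case (Suc n)
  have "newton (\<lambda>r. 1) (\<lambda>n. 1 :: 'a)" by (rule newtonI) auto
  note 1 = newton_mult[OF newton_dilate[OF x, of q] this]
  have xs: "x n = (\<Sum>i=0..n. q ^ i * x i)" for n
  proof -
    have "x n = (\<Sum>i=0..n. q ^ i * x i * 1)"
    proof (rule newton_unique[OF torsion_free_field x 1])
      fix r :: nat assume "r > 0"
      then show "1 / (1 - q ^ r) = q ^ r * (1 / (1 - q ^ r)) + 1" using q[of r] by (simp add: field_simps)
    qed
    then show ?thesis by simp
  qed
  have "x (Suc n) = x n + q ^ Suc n * x (Suc n)"
    by (subst xs[of "Suc n"], subst xs[of n]) (simp only: sum.atLeast0_atMost_Suc)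
  then have "x (Suc n) * (1 - q ^ Suc n) = x n" by (simp add: algebra_simps)
  then have "x (Suc n) = x n / (1 - q ^ Suc n)"
    using q[of "Suc n"] by (subst nonzero_eq_divide_eq) auto
  then show ?case by (simp add: Suc)
qed

text \<open>The value is e_n[1/(1 - q)]. With the same splitting, one variable contributes only e_0
  and e_1, so the recursion has two terms and picks up a factor q^n.\<close>

lemma newton_q_poch_signed:
  fixes q :: "'a :: field_char_0"
  assumes q: "\<And>r. r > 0 \<Longrightarrow> q ^ r \<noteq> 1" and x: "newton (\<lambda>r. - ((-1) ^ r) / (1 - q ^ r)) x"
  shows "x n = q ^ (n choose 2) / q_poch q n"
proof (induction n)
  case 0
  show ?case using newtonD(1)[OF x] by (simp add: numeral_2_eq_2)
next
  case (Suc n)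
  have "newton (\<lambda>r. - ((-1) ^ r)) (\<lambda>n. eval_e (hsym n :: 'a symfun))"
    unfolding eval_e_def by (rule scalar_id.newton_psym_hom_hsym)
  note 1 = newton_mult[OF newton_dilate[OF x, of q] this]
  have "x (Suc n) = (\<Sum>i=0..Suc n. q ^ i * x i * eval_e (hsym (Suc n - i) :: 'a symfun))"
  proof (rule newton_unique[OF torsion_free_field x 1])
    fix r :: nat assume "r > 0"
    then show "- ((-1) ^ r) / (1 - q ^ r) = q ^ r * (- ((-1) ^ r) / (1 - q ^ r)) + - ((-1) ^ r)"
      using q[of r] by (simp add: field_simps)
  qed
  also have "\<dots> = (\<Sum>i\<in>{n, Suc n}. q ^ i * x i * eval_e (hsym (Suc n - i) :: 'a symfun))"
    by (rule sum.mono_neutral_right) (auto simp: eval_e_hsym)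
  also have "\<dots> = q ^ n * x n + q ^ Suc n * x (Suc n)" by (simp add: eval_e_hsym)
  finally have "x (Suc n) * (1 - q ^ Suc n) = q ^ n * x n" by (simp add: algebra_simps)
  then have "x (Suc n) = q ^ n * x n / (1 - q ^ Suc n)"
    using q[of "Suc n"] by (subst nonzero_eq_divide_eq) auto
  moreover have "q ^ (Suc n choose 2) = q ^ n * q ^ (n choose 2)"
    by (simp add: numeral_2_eq_2 power_add)
  ultimately show ?case by (simp add: Suc)
qed

lemma eval_psym:
  assumes "r > 0"
  shows "eval_h (psym r :: 'a :: field_char_0 symfun) = 1" "eval_e (psym r :: 'a symfun) = - ((-1) ^ r)"
  unfolding eval_h_def eval_e_def using assms by (rule scalar_id.psym_hom_psym)+

lemma eval_e_neg_one_power: "eval_e ((-1) ^ k :: 'a :: field_char_0 symfun) = (-1) ^ k"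
  by (induction k) (simp_all add: eval_e_simps eval_e_uminus)

lemma eval_scaling:
  "eval_h (alphabet_scaling c F) = scalar_id.psym_hom c F"
  "eval_e (alphabet_scaling c F) = scalar_id.psym_hom (\<lambda>r. - ((-1) ^ r) * c r) F"
proof -
  have "(\<lambda>F. eval_h (alphabet_scaling c F)) = scalar_id.psym_hom c"
    by (rule scalar_id.psym_hom_unique)
      (simp_all add: alphabet_scaling_simps eval_h_simps eval_psym)
  then show "eval_h (alphabet_scaling c F) = scalar_id.psym_hom c F" by (rule fun_cong)
  have "(\<lambda>F. eval_e (alphabet_scaling c F)) = scalar_id.psym_hom (\<lambda>r. - ((-1) ^ r) * c r)"
    by (rule scalar_id.psym_hom_unique)
      (simp_all add: alphabet_scaling_simps eval_e_simps eval_psym)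
  then show "eval_e (alphabet_scaling c F) = scalar_id.psym_hom (\<lambda>r. - ((-1) ^ r) * c r) F" by (rule fun_cong)
qed

lemma eval_h_divide_hsym:
  assumes "\<And>r. r > 0 \<Longrightarrow> q ^ r \<noteq> (1 :: 'a :: field_char_0)"
  shows "eval_h (divide_alphabet q (hsym n)) = 1 / q_poch q n"
  unfolding eval_scaling by (rule newton_q_poch[OF assms scalar_id.newton_psym_hom_hsym])

lemma eval_e_divide_hsym:
  assumes "\<And>r. r > 0 \<Longrightarrow> q ^ r \<noteq> (1 :: 'a :: field_char_0)"
  shows "eval_e (divide_alphabet q (hsym n)) = q ^ (n choose 2) / q_poch q n"
proof -
  have "(\<lambda>r. - ((-1) ^ r) * (1 / (1 - q ^ r))) = (\<lambda>r. - ((-1) ^ r) / (1 - q ^ r))" by simp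
  then show ?thesis
    unfolding eval_scaling by (simp only: newton_q_poch_signed[OF assms scalar_id.newton_psym_hom_hsym])
qed

text \<open>The involution inside \<open>eval_e\<close> turns e_k into h_k, so all signs cancel and
  the sequence is that of the complete functions with p_r replaced by c_r.\<close>

lemma newton_eval_e_scaling_esym: "newton c (\<lambda>k. eval_e (alphabet_scaling c (esym k)))"
proof -
  have "newton (\<lambda>r. - (- ((-1) ^ r) * c r)) (\<lambda>k. eval_e (alphabet_scaling c ((-1) ^ k * esym k)))"
    unfolding eval_scaling by (rule scalar_id.newton_psym_hom_esym)
  from newton_dilate[OF this, of "-1"]
  have "newton (\<lambda>r. (-1) ^ r * - (- ((-1) ^ r) * c r)) (\<lambda>k. (-1) ^ k * eval_e (alphabet_scaling c ((-1) ^ k * esym k)))" .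
  moreover have "(-1) ^ k * eval_e (alphabet_scaling c ((-1) ^ k * esym k)) = eval_e (alphabet_scaling c (esym k))" for k
  proof -
    have "(-1) ^ k * (esym k :: 'a symfun) = scale_sf ((-1) ^ k) (esym k)"
      by (cases "even k") simp_all
    then show ?thesis by (simp add: alphabet_scaling_simps(5) eval_e_simps flip: mult.assoc power_mult_distrib)
  qed
  ultimately show ?thesis by (simp add: mult.assoc[symmetric] flip: power_mult_distrib)
qed

text \<open>As \<open>eval_e\<close> sends the signed e_k to (-1)^k, the pairing becomes evaluation
  at w = -1. The composite is a homomorphism and is identified on power sums.\<close>

lemma eval_e_macdonald_operator:
  "eval_e (macdonald_operator q t F)
    = scalar_id.psym_hom (\<lambda>r. - ((-1) ^ r) * (1 - (1 - q ^ r) * (1 - t ^ r))) F"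
proof -
  have pair: "eval_e (pairing (\<lambda>k. (-1) ^ k * esym k) f) = eval_e (poly f (-1))" for f :: "'a symfun poly"
  proof -
    show ?thesis
      by (simp add: pairing_def poly_altdef eval_e_simps eval_e_esym eval_e_neg_one_power mult.commute)
  qed
  have "(\<lambda>F. eval_e (poly (shift_hom (\<lambda>r. (1 - q ^ r) * (1 - t ^ r)) F) (-1)))
      = scalar_id.psym_hom (\<lambda>r. - ((-1) ^ r) * (1 - (1 - q ^ r) * (1 - t ^ r)))"
  proof (rule scalar_id.psym_hom_unique)
    fix r :: nat assume r: "r > 0"
    have "scale_sf c 1 * (-1) ^ r = scale_sf (c * (-1) ^ r) (1 :: 'a symfun)" for c
      by (cases "even r") simp_all
    then have "poly (shift_hom (\<lambda>r. (1 - q ^ r) * (1 - t ^ r)) (psym r)) (-1)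
        = psym r + scale_sf ((1 - q ^ r) * (1 - t ^ r) * (-1) ^ r) 1"
      by (simp add: shift_hom_simps(5)[OF r] poly_monom)
    then show "eval_e (poly (shift_hom (\<lambda>r. (1 - q ^ r) * (1 - t ^ r)) (psym r)) (-1))
        = - ((-1) ^ r) * (1 - (1 - q ^ r) * (1 - t ^ r))"
      by (simp only: eval_e_simps eval_psym[OF r]) (simp add: algebra_simps)
  qed (simp_all add: shift_hom_simps eval_e_simps)
  then show ?thesis unfolding vertex_op_def pair by (rule fun_cong)
qed

section \<open>Specialization of the parameters\<close>

lemma to_fract_power: "to_fract (x ^ n) = to_fract x ^ n"
  by (induction n) simp_all

lemma to_fract_of_nat: "to_fract (of_nat n) = of_nat n"
  by (induction n) simp_all

abbreviation const_t :: "ratfun_q \<Rightarrow> ratfun_qt" where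
  "const_t c \<equiv> to_fract [:c:]"

lemma const_t_mult: "const_t (a * b) = const_t a * const_t b"
proof -
  have "[:a * b:] = [:a:] * [:b:]" by simp
  then show ?thesis by (simp only: to_fract_mult)
qed

lemma const_t_1: "const_t 1 = 1"
  by (simp flip: one_pCons)

lemma const_t_power: "const_t (a ^ n) = const_t a ^ n"
  by (induction n) (simp_all only: power.simps const_t_1 const_t_mult)

lemma const_t_diff: "const_t (a - b) = const_t a - const_t b"
  by (simp flip: to_fract_diff)

lemma const_t_divide: "b \<noteq> 0 \<Longrightarrow> const_t (a / b) = const_t a / const_t b"
  by (simp add: field_simps flip: const_t_mult)

lemma qq_eq: "qq = const_t q_var" and tt_eq: "tt = to_fract [:0, 1:]"
  by (simp_all add: qq_def tt_def to_fract_def)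

lemma qq_power: "qq ^ n = const_t (q_var ^ n)"
  by (simp only: qq_eq const_t_power)

lemma tt_power: "tt ^ n = to_fract (monom 1 n)"
  by (simp add: tt_eq monom_altdef flip: to_fract_power)

lemma q_var_power: "q_var ^ n = to_fract (monom 1 n)"
  unfolding q_var_def to_fract_def[symmetric] to_fract_power[symmetric] by (simp add: monom_altdef)

lemma q_var_power_eq_iff: "q_var ^ a = q_var ^ b \<longleftrightarrow> a = b"
proof
  assume "q_var ^ a = q_var ^ b"
  then have "monom 1 a = (monom 1 b :: rat poly)" by (simp add: q_var_power)
  then show "a = b" using arg_cong[of _ _ degree] by (metis degree_monom_eq zero_neq_one)
qed simp

lemma q_var_ne_1: "r > 0 \<Longrightarrow> q_var ^ r \<noteq> 1"
  using q_var_power_eq_iff[of r 0] by simp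

lemma qq_ne_1: "r > 0 \<Longrightarrow> qq ^ r \<noteq> 1"
  using q_var_ne_1[of r] unfolding qq_power const_t_1[symmetric] by simp

lemma tt_ne_1: "r > 0 \<Longrightarrow> tt ^ r \<noteq> 1"
proof
  assume "r > 0" "tt ^ r = 1"
  then have "monom 1 r = (1 :: ratfun_q poly)" unfolding tt_power by (metis to_fract_1 to_fract_eq_iff)
  then have "degree (monom 1 r :: ratfun_q poly) = 0" by simp
  then show False using \<open>r > 0\<close> by (simp add: degree_monom_eq)
qed

lemma q_poch_qq: "q_poch qq n = const_t (q_poch q_var n)"
  by (induction n) (simp_all only: q_poch_simps const_t_1 const_t_mult const_t_diff qq_power)

text \<open>Rational functions in t without poles on \<open>S\<close>. The point 0 is for the
  specialization, the point 1 for the normalization of the Macdonald polynomials.\<close>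

definition regular_on :: "ratfun_q set \<Rightarrow> ratfun_qt set" where
  "regular_on S = {to_fract a / to_fract b | a b. \<forall>s\<in>S. poly b s \<noteq> 0}"

lemma regular_onI: "\<forall>s\<in>S. poly b s \<noteq> 0 \<Longrightarrow> to_fract a / to_fract b \<in> regular_on S"
  by (auto simp: regular_on_def)

lemma to_fract_regular: "to_fract a \<in> regular_on S"
  using regular_onI[of S 1 a] by simp

lemma regular_divide: "\<forall>s\<in>S. poly b s \<noteq> 0 \<Longrightarrow> x \<in> regular_on S \<Longrightarrow> x / to_fract b \<in> regular_on S"
  by (clarsimp simp: regular_on_def simp flip: to_fract_mult) (metis mult_eq_0_iff poly_mult)

lemma subring_regular_on:
  assumes "S \<noteq> {}"
  shows "rational_subring (regular_on S)"
  unfolding rational_subring_def subring_set_def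
proof (intro conjI ballI allI impI)
  show "1 \<in> regular_on S" using to_fract_regular[of 1] by simp
  fix x y assume "x \<in> regular_on S" "y \<in> regular_on S"
  then obtain a b c d where x: "x = to_fract a / to_fract b" "\<forall>s\<in>S. poly b s \<noteq> 0"
    and y: "y = to_fract c / to_fract d" "\<forall>s\<in>S. poly d s \<noteq> 0" by (auto simp: regular_on_def)
  have bd: "b \<noteq> 0" "d \<noteq> 0" "\<forall>s\<in>S. poly (b * d) s \<noteq> 0" using x y assms by auto
  have "x * y = to_fract (a * c) / to_fract (b * d)" by (simp add: x y)
  then show "x * y \<in> regular_on S" using regular_onI[OF bd(3)] by metis
  have "x - y = to_fract (a * d - c * b) / to_fract (b * d)" using bd by (simp add: x y field_simps)
  then show "x - y \<in> regular_on S" using regular_onI[OF bd(3)] by metis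
next
  fix n :: nat assume "n > 0"
  then have "1 / to_fract (of_nat n) \<in> regular_on S"
    by (intro regular_divide) (use to_fract_regular[of 1] in auto)
  then show "1 / of_nat n \<in> regular_on S" by (simp add: to_fract_of_nat)
qed

abbreviation regular0 :: "ratfun_qt set" where
  "regular0 \<equiv> regular_on {0}"

lemmas subring0 = rational_subringD(1)[OF subring_regular_on[of "{0}", simplified]]

lemma eval_t0_quotient: "poly b 0 \<noteq> 0 \<Longrightarrow> eval_t0 (to_fract a / to_fract b) = poly a 0 / poly b 0"
  by (simp add: eval_t0_Fract flip: Fract_conv_to_fract)

lemma eval_t0_to_fract: "eval_t0 (to_fract a) = poly a 0"
  using eval_t0_quotient[of 1 a] by simp

text \<open>\<open>eval_t0\<close> is unspecified at poles, so it is additive and multiplicative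
  only under regularity, which the later inductions therefore carry along.\<close>

lemma eval_t0_hom:
  assumes "x \<in> regular0" "y \<in> regular0"
  shows "eval_t0 (x + y) = eval_t0 x + eval_t0 y" "eval_t0 (x * y) = eval_t0 x * eval_t0 y"
proof -
  from assms obtain a b c d where x: "x = to_fract a / to_fract b" "poly b 0 \<noteq> 0"
    and y: "y = to_fract c / to_fract d" "poly d 0 \<noteq> 0" by (auto simp: regular_on_def)
  have bd: "b \<noteq> 0" "d \<noteq> 0" "poly (b * d) 0 \<noteq> 0" using x y by auto
  have "x * y = to_fract (a * c) / to_fract (b * d)" by (simp add: x y)
  then have "eval_t0 (x * y) = poly (a * c) 0 / poly (b * d) 0" by (simp only: eval_t0_quotient[OF bd(3)])
  then show "eval_t0 (x * y) = eval_t0 x * eval_t0 y" using x y by (simp add: eval_t0_quotient)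
  have "x + y = to_fract (a * d + c * b) / to_fract (b * d)" using bd by (simp add: x y field_simps)
  then have "eval_t0 (x + y) = poly (a * d + c * b) 0 / poly (b * d) 0" by (simp only: eval_t0_quotient[OF bd(3)])
  then show "eval_t0 (x + y) = eval_t0 x + eval_t0 y" using x y by (simp add: eval_t0_quotient field_simps)
qed

lemma eval_t0_0: "eval_t0 (0 :: ratfun_qt) = 0" and eval_t0_1: "eval_t0 (1 :: ratfun_qt) = 1"
  using eval_t0_to_fract[of 0] eval_t0_to_fract[of 1] by simp_all

lemma eval_t0_const_t: "eval_t0 (const_t c) = c"
  by (simp add: eval_t0_to_fract)

lemma eval_t0_sum:
  "(\<And>i. i \<in> I \<Longrightarrow> f i \<in> regular0) \<Longrightarrow> eval_t0 (sum f I) = (\<Sum>i\<in>I. eval_t0 (f i))"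
proof (induction I rule: infinite_finite_induct)
  case (insert i I)
  then show ?case using subring_set_sum[OF subring0, of I f] by (simp add: eval_t0_hom)
qed (simp_all add: eval_t0_0)

lemma eval_t0_glist:
  assumes "\<And>r. r > 0 \<Longrightarrow> g r \<in> regular0" "0 \<notin> set \<mu>"
  shows "glist g \<mu> \<in> regular0" "eval_t0 (glist g \<mu>) = glist (\<lambda>r. eval_t0 (g r)) \<mu>"
proof -
  have "glist g \<mu> \<in> regular0 \<and> eval_t0 (glist g \<mu>) = glist (\<lambda>r. eval_t0 (g r)) \<mu>"
    using assms(2) by (induction \<mu>)
      (auto simp: eval_t0_1 eval_t0_hom assms(1) intro: subring_setD(1,3)[OF subring0])
  then show "glist g \<mu> \<in> regular0" "eval_t0 (glist g \<mu>) = glist (\<lambda>r. eval_t0 (g r)) \<mu>" by auto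
qed

lemma count_list_eq_coeff:
  "coeff (\<Sum>i<N. monom 1 (f i)) k = (of_nat (count (mset (map f [0..<N])) k) :: 'a :: comm_ring_1)"
  by (induction N) auto

text \<open>The multiset of parts is read off the coefficients of a polynomial in q. This shows that
  eigenvalue differences have only a simple zero at t = 1.\<close>

lemma sum_q_var_power_eq:
  assumes \<mu>: "is_partition \<mu>" "length \<mu> \<le> N" and \<nu>: "is_partition \<nu>" "length \<nu> \<le> N"
    and eq: "(\<Sum>i<N. q_var ^ part \<mu> i) = (\<Sum>i<N. q_var ^ part \<nu> i)"
  shows "\<mu> = \<nu>"
proof -
  have "(\<Sum>i<N. monom 1 (part \<mu> i)) = (\<Sum>i<N. monom 1 (part \<nu> i) :: rat poly)"
    using eq by (simp only: q_var_power to_fract_sum[symmetric] to_fract_eq_iff)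
  then have "of_nat (count (mset (map (part \<mu>) [0..<N])) k) = (of_nat (count (mset (map (part \<nu>) [0..<N])) k) :: rat)" for k
    using count_list_eq_coeff by metis
  then have ms: "mset (map (part \<mu>) [0..<N]) = mset (map (part \<nu>) [0..<N])" by (simp add: multiset_eq_iff)
  have "sorted (rev (map (part \<rho>) [0..<N]))" if "is_partition \<rho>" for \<rho>
    unfolding sorted_wrt_rev using part_antimono[OF that] by (simp add: sorted_wrt_iff_nth_less)
  then have "rev (map (part \<mu>) [0..<N]) = rev (map (part \<nu>) [0..<N])"
    using ms \<mu>(1) \<nu>(1) by (metis mset_rev properties_for_sort)
  then have "part \<mu> i = part \<nu> i" if "i < N" for i using that by simp
  moreover have "part \<mu> i = part \<nu> i" if "i \<ge> N" for i using that \<mu>(2) \<nu>(2) by (simp add: part_def)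
  ultimately show ?thesis by (intro partition_eq_partI[OF \<mu>(1) \<nu>(1)]) (metis not_le)
qed

text \<open>Apart from 1 - t, the difference is the polynomial \<open>V\<close> with coefficients
  q^\<mu>_i - q^\<nu>_i. Its lowest term sits at the first row where the partitions differ, and its
  value at t = 1 is nonzero by \<open>sum_q_var_power_eq\<close>.\<close>

lemma vertex_eigenvalue_diff:
  assumes \<mu>: "is_partition \<mu>" and \<nu>: "is_partition \<nu>" and ne: "\<mu> \<noteq> \<nu>"
  obtains p U where "vertex_eigenvalue qq tt \<mu> - vertex_eigenvalue qq tt \<nu> = (1 - tt) * (tt ^ p * to_fract U)"
    and "\<forall>s\<in>{0, 1}. poly U s \<noteq> 0" and "\<And>i. i < p \<Longrightarrow> part \<mu> i = part \<nu> i"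
proof -
  define N where "N = max (length \<mu>) (length \<nu>)"
  have N: "length \<mu> \<le> N" "length \<nu> \<le> N" by (auto simp: N_def)
  define V where "V = (\<Sum>i<N. monom (q_var ^ part \<mu> i - q_var ^ part \<nu> i) i)"
  have coeffV: "coeff V i = q_var ^ part \<mu> i - q_var ^ part \<nu> i" for i
  proof -
    have "coeff V i = (if i < N then q_var ^ part \<mu> i - q_var ^ part \<nu> i else 0)"
      by (simp add: V_def coeff_sum)
    then show ?thesis using N by (simp add: part_def)
  qed
  have "\<exists>i. part \<mu> i \<noteq> part \<nu> i" using partition_eq_partI[OF \<mu> \<nu>] ne by blast
  define p where "p = (LEAST i. part \<mu> i \<noteq> part \<nu> i)"
  have p: "part \<mu> p \<noteq> part \<nu> p"
    unfolding p_def by (rule LeastI_ex[OF \<open>\<exists>i. part \<mu> i \<noteq> part \<nu> i\<close>])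
  have less: "part \<mu> i = part \<nu> i" if "i < p" for i
    using not_less_Least[of i "\<lambda>i. part \<mu> i \<noteq> part \<nu> i"] that by (simp add: p_def)
  have "monom 1 p dvd V" unfolding monom_1_dvd_iff' coeffV using less by simp
  then obtain U where U: "V = monom 1 p * U" by blast
  have "coeff V p = poly U 0" unfolding U by (simp add: coeff_monom_mult poly_0_coeff_0)
  then have "poly U 0 = q_var ^ part \<mu> p - q_var ^ part \<nu> p" by (simp add: coeffV)
  then have U0: "poly U 0 \<noteq> 0" using p by (simp add: q_var_power_eq_iff)
  have "poly U 1 = poly V 1" by (simp add: U poly_monom)
  also have "\<dots> = (\<Sum>i<N. q_var ^ part \<mu> i) - (\<Sum>i<N. q_var ^ part \<nu> i)"
    by (simp add: V_def poly_sum poly_monom sum_subtractf)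
  finally have U1: "poly U 1 \<noteq> 0" using sum_q_var_power_eq[OF \<mu> N(1) \<nu> N(2)] ne by auto
  have "vertex_eigenvalue qq tt \<mu> - vertex_eigenvalue qq tt \<nu>
      = (1 - tt) * ((\<Sum>i<N. tt ^ i * (1 - qq ^ part \<nu> i)) - (\<Sum>i<N. tt ^ i * (1 - qq ^ part \<mu> i)))"
    unfolding vertex_eigenvalue_parts[OF N(1)] vertex_eigenvalue_parts[OF N(2)] by (simp add: algebra_simps)
  also have "(\<Sum>i<N. tt ^ i * (1 - qq ^ part \<nu> i)) - (\<Sum>i<N. tt ^ i * (1 - qq ^ part \<mu> i))
      = (\<Sum>i<N. tt ^ i * (qq ^ part \<mu> i - qq ^ part \<nu> i))"
    by (simp add: algebra_simps flip: sum_subtractf)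
  also have "\<dots> = to_fract V"
  proof -
    have "to_fract (monom c i) = tt ^ i * const_t c" for c i
      unfolding tt_power to_fract_mult[symmetric] by (simp add: smult_monom mult.commute)
    then show ?thesis by (simp only: V_def to_fract_sum qq_power const_t_diff)
  qed
  also have "\<dots> = tt ^ p * to_fract U" by (simp add: U tt_power)
  finally show ?thesis using that U0 U1 less by blast
qed

lemma vertex_eigenvalue_inj: "inj_on (vertex_eigenvalue qq tt) partitions"
proof (rule inj_onI, rule ccontr)
  fix \<mu> \<nu> assume \<mu>: "\<mu> \<in> partitions" "\<nu> \<in> partitions" and eq: "vertex_eigenvalue qq tt \<mu> = vertex_eigenvalue qq tt \<nu>" and ne: "\<mu> \<noteq> \<nu>"
  have part: "is_partition \<mu>" "is_partition \<nu>" using \<mu> by auto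
  obtain p U where "vertex_eigenvalue qq tt \<mu> - vertex_eigenvalue qq tt \<nu> = (1 - tt) * (tt ^ p * to_fract U)"
    "\<forall>s\<in>{0, 1}. poly U s \<noteq> 0" by (rule vertex_eigenvalue_diff[OF part ne])
  moreover have "tt \<noteq> 0" "1 - tt \<noteq> 0" using tt_ne_1[of 1] by (auto simp: tt_eq)
  moreover have "U \<noteq> 0" using calculation(2) by auto
  ultimately show False using eq by simp
qed

lemma generic_qq_tt: "generic_parameters qq tt"
  unfolding generic_parameters_def using qq_ne_1 tt_ne_1 vertex_eigenvalue_inj by blast

text \<open>The ideal of the off-diagonal coefficients: of the two factors 1 - t in an error term,
  one survives the division.\<close>

definition vanishing1 :: "ratfun_qt set" where
  "vanishing1 = {(1 - tt) * x | x. x \<in> regular_on {0, 1}}"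

lemma ideal_vanishing1: "ideal_set (regular_on {0, 1}) vanishing1"
proof -
  note R = rational_subringD(1)[OF subring_regular_on[of "{0, 1}", simplified]]
  have "1 - tt = to_fract (1 - [:0, 1:])" by (simp add: tt_eq del: diff_pCons)
  then have "1 - tt \<in> regular_on {0, 1}" using to_fract_regular by metis
  then show ?thesis
    unfolding ideal_set_def vanishing1_def using R subring_setD(3)[OF R] by (auto simp: mult.assoc)
qed

text \<open>The quotient to be controlled is (1 - t) t^(r-p) / U with U nonzero at 0 and 1.\<close>

lemma ex_regular_eigenvector:
  assumes "is_partition \<mu>"
  shows "\<exists>w. vertex_op (\<lambda>r. 1 - tt ^ r) (gamma qq) w = scale_sf (vertex_eigenvalue qq tt \<mu>) w \<and>
    w - glist hsym \<mu> \<in> rspan vanishing1 (glist hsym ` {\<nu>. below \<mu> \<nu>})"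
proof (rule vertex_eigenvector[OF ideal_vanishing1 _ _ _ _ assms])
  show "qq \<in> regular_on {0, 1}" "tt \<in> regular_on {0, 1}"
    unfolding qq_eq tt_eq by (rule to_fract_regular)+
  show "vertex_eigenvalue qq tt \<mu> \<noteq> vertex_eigenvalue qq tt \<nu>" if "is_partition \<mu>" "is_partition \<nu>" "\<mu> \<noteq> \<nu>" for \<mu> \<nu>
    using vertex_eigenvalue_inj that by (auto dest: inj_onD)
  fix \<mu> \<nu> r assume b: "below \<mu> \<nu>" and r: "sum_list (take (Suc r) \<mu>) < sum_list (take (Suc r) \<nu>)"
  obtain p U where U: "vertex_eigenvalue qq tt \<mu> - vertex_eigenvalue qq tt \<nu> = (1 - tt) * (tt ^ p * to_fract U)"
    "\<forall>s\<in>{0, 1}. poly U s \<noteq> 0" "\<And>i. i < p \<Longrightarrow> part \<mu> i = part \<nu> i"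
    by (rule vertex_eigenvalue_diff[of \<mu> \<nu>]) (use b in \<open>auto simp: below_def\<close>)
  \<comment> \<open>All rows before \<open>p\<close> agree, so a gain within rows 0 to r needs one
    of them to be row \<open>p\<close> or later.\<close>
  have "p \<le> r"
  proof (rule ccontr)
    assume "\<not> p \<le> r"
    then have "sum_list (take (Suc r) \<mu>) = sum_list (take (Suc r) \<nu>)"
      unfolding sum_list_take by (intro sum.cong refl U(3)) auto
    then show False using r by simp
  qed
  then have "tt ^ r = tt ^ p * tt ^ (r - p)" by (simp flip: power_add)
  moreover have "tt \<noteq> 0" "1 - tt \<noteq> 0" using tt_ne_1[of 1] by (auto simp: tt_eq)
  moreover have "U \<noteq> 0" using U(2) by auto
  ultimately have "(1 - tt) ^ 2 * tt ^ r / (vertex_eigenvalue qq tt \<mu> - vertex_eigenvalue qq tt \<nu>)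
      = (1 - tt) * (tt ^ (r - p) / to_fract U)"
    unfolding U(1) by (simp add: power2_eq_square field_simps)
  moreover have "tt ^ (r - p) / to_fract U \<in> regular_on {0, 1}"
    unfolding tt_power by (intro regular_onI U(2))
  ultimately show "(1 - tt) ^ 2 * tt ^ r / (vertex_eigenvalue qq tt \<mu> - vertex_eigenvalue qq tt \<nu>) \<in> vanishing1"
    unfolding vanishing1_def by (simp only:) blast
qed

text \<open>This basis only supplies the second triangularity condition, so coefficients range over
  the whole field. Distinctness of its eigenvalues is inherited through conjugation.\<close>

lemma ex_swapped_eigenbasis: "\<exists>v. eigenbasis tt qq v"
proof -
  have ne: "vertex_eigenvalue tt qq \<mu> \<noteq> vertex_eigenvalue tt qq \<nu>"
    if "is_partition \<mu>" "is_partition \<nu>" "\<mu> \<noteq> \<nu>" for \<mu> \<nu>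
  proof
    assume "vertex_eigenvalue tt qq \<mu> = vertex_eigenvalue tt qq \<nu>"
    then have "vertex_eigenvalue qq tt (conj_partition \<mu>) = vertex_eigenvalue qq tt (conj_partition \<nu>)"
      using vertex_eigenvalue_conj[OF that(1), of qq tt] vertex_eigenvalue_conj[OF that(2), of qq tt] by simp
    then have "conj_partition \<mu> = conj_partition \<nu>"
      using vertex_eigenvalue_inj that is_partition_conj by (auto dest: inj_onD)
    then show False using conj_conj that by metis
  qed
  have "\<exists>w. vertex_op (\<lambda>r. 1 - qq ^ r) (gamma tt) w = scale_sf (vertex_eigenvalue tt qq \<mu>) w \<and>
    w - glist hsym \<mu> \<in> rspan UNIV (glist hsym ` {\<nu>. below \<mu> \<nu>})" if "is_partition \<mu>" for \<mu>
    by (rule vertex_eigenvector[of UNIV, OF _ UNIV_I UNIV_I ne _ that]) (auto simp: ideal_set_def)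
  then show ?thesis unfolding eigenbasis_def by metis
qed

section \<open>The operator with Macdonald eigenfunctions\<close>

definition eigenvector :: "nat list \<Rightarrow> ratfun_qt symfun" where
  "eigenvector \<mu> = (SOME w. vertex_op (\<lambda>r. 1 - tt ^ r) (gamma qq) w = scale_sf (vertex_eigenvalue qq tt \<mu>) w \<and>
    w - glist hsym \<mu> \<in> rspan vanishing1 (glist hsym ` {\<nu>. below \<mu> \<nu>}))"

lemma eigenvector:
  assumes "is_partition \<mu>"
  shows "vertex_op (\<lambda>r. 1 - tt ^ r) (gamma qq) (eigenvector \<mu>) = scale_sf (vertex_eigenvalue qq tt \<mu>) (eigenvector \<mu>)"
    and "eigenvector \<mu> - glist hsym \<mu> \<in> rspan vanishing1 (glist hsym ` {\<nu>. below \<mu> \<nu>})"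
  using someI_ex[OF ex_regular_eigenvector[OF assms]] unfolding eigenvector_def by blast+

lemma eigenbasis_eigenvector: "eigenbasis qq tt eigenvector"
  unfolding eigenbasis_def using eigenvector rspan_mono[OF eigenvector(2) subset_UNIV order_refl] by blast

abbreviation eigenfunction :: "nat list \<Rightarrow> ratfun_qt symfun" where
  "eigenfunction \<mu> \<equiv> divide_alphabet qq (eigenvector \<mu>)"

lemma eigenfunction_basis: "basis_family partitions eigenfunction"
  using basis_F[OF generic_qq_tt eigenbasis_eigenvector] ex_swapped_eigenbasis by blast

text \<open>The value is the product of 1/(q;q)_r over the entries of the list, which is nonzero and
  free of t.\<close>

lemma eval_h_divide_glist:
  "\<exists>c. c \<noteq> 0 \<and> eval_h (divide_alphabet qq (glist hsym \<mu>)) = const_t c"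
proof (induction \<mu>)
  case Nil
  show ?case by (intro exI[of _ 1]) (simp add: alphabet_scaling_simps(1) eval_h_simps const_t_1)
next
  case (Cons r \<mu>)
  then obtain c where c: "c \<noteq> 0" "eval_h (divide_alphabet qq (glist hsym \<mu>)) = const_t c" by blast
  have P: "q_poch q_var r \<noteq> 0" by (rule q_poch_nonzero) (rule q_var_ne_1)
  have "eval_h (divide_alphabet qq (hsym r)) = 1 / q_poch qq r"
    by (rule eval_h_divide_hsym) (rule qq_ne_1)
  also have "\<dots> = const_t (1 / q_poch q_var r)" unfolding q_poch_qq const_t_divide[OF P] const_t_1 ..
  finally have "eval_h (divide_alphabet qq (glist hsym (r # \<mu>))) = const_t (1 / q_poch q_var r * c)"
    unfolding const_t_mult by (simp only: glist_simps alphabet_scaling_simps(4) eval_h_simps c(2))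
  then show ?case using c(1) P by (intro exI[of _ "1 / q_poch q_var r * c"]) simp
qed

text \<open>The off-diagonal coefficients vanish at t = 1, where the value therefore reduces to that
  of h_\<mu>, which is nonzero.\<close>

lemma eval_h_eigenfunction:
  assumes "is_partition \<mu>"
  shows "eval_h (eigenfunction \<mu>) \<noteq> 0"
proof
  assume 0: "eval_h (eigenfunction \<mu>) = 0"
  let ?f = "\<lambda>F. eval_h (divide_alphabet qq F)"
  have R: "subring_set (regular_on {0, 1})" by (rule ideal_setD(1)[OF ideal_vanishing1])
  have "?f (eigenvector \<mu> - glist hsym \<mu>) \<in> additive_span vanishing1"
    using eigenvector(2)[OF assms] unfolding rspan_def
  proof (rule additive_span_image[where f = ?f, rotated 3])
    fix x assume "x \<in> {scale_sf c b |c b. c \<in> vanishing1 \<and> b \<in> glist hsym ` {\<nu>. below \<mu> \<nu>}}"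
    then obtain c \<nu> where x: "x = scale_sf c (glist hsym \<nu>)" and c: "c \<in> vanishing1" by blast
    obtain d where "?f (glist hsym \<nu>) = const_t d" using eval_h_divide_glist by blast
    then have "?f x = c * const_t d" by (simp only: x alphabet_scaling_simps(5) eval_h_simps)
    then show "?f x \<in> additive_span vanishing1"
      using ideal_setD(3)[OF ideal_vanishing1 c to_fract_regular] by (simp add: additive_span_base)
  qed (simp_all add: alphabet_scaling_simps eval_h_simps)
  then have "\<exists>x \<in> regular_on {0, 1}. ?f (eigenvector \<mu> - glist hsym \<mu>) = (1 - tt) * x"
  proof (induction rule: additive_span.induct)
    case zero
    show ?case using subring_setD(4)[OF R] by (intro bexI[of _ 0]) auto
  next
    case (add x y)
    then obtain x' y' where "x = (1 - tt) * x'" "x' \<in> regular_on {0, 1}" "y = (1 - tt) * y'" "y' \<in> regular_on {0, 1}"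
      by (auto simp: vanishing1_def)
    then show ?case using subring_setD(5)[OF R] by (intro bexI[of _ "x' + y'"]) (auto simp: distrib_left)
  qed
  then obtain a b where ab: "?f (eigenvector \<mu> - glist hsym \<mu>) = (1 - tt) * (to_fract a / to_fract b)" "poly b 1 \<noteq> 0"
    by (auto simp: regular_on_def)
  obtain c where c: "c \<noteq> 0" "?f (glist hsym \<mu>) = const_t c" using eval_h_divide_glist by blast
  have "?f (eigenvector \<mu>) = ?f (eigenvector \<mu> - glist hsym \<mu>) + ?f (glist hsym \<mu>)"
    by (simp only: eval_h_simps(3)[symmetric] alphabet_scaling_simps(3)[symmetric] diff_add_cancel)
  then have "0 = (1 - tt) * (to_fract a / to_fract b) + const_t c" by (simp only: 0 ab c)
  moreover have "to_fract b \<noteq> 0" using ab(2) by auto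
  \<comment> \<open>Clearing the denominator gives a polynomial identity in t that can be evaluated
    at t = 1.\<close>
  ultimately have "0 = (1 - tt) * to_fract a + const_t c * to_fract b" by (simp add: field_simps)
  also have "\<dots> = to_fract ((1 - [:0, 1:]) * a + [:c:] * b)"
    by (simp only: to_fract_add to_fract_mult to_fract_diff to_fract_1 tt_eq)
  finally have "(1 - [:0, 1:]) * a + [:c:] * b = 0" by (metis to_fract_eq_0_iff)
  then have "poly ((1 - [:0, 1:]) * a + [:c:] * b) 1 = 0" by (simp only: poly_0)
  then show False using c(1) ab(2) by simp
qed

lemma macdonald_H_eigenfunction:
  "is_partition \<mu> \<Longrightarrow> macdonald_H \<mu> = scale_sf (1 / eval_h (eigenfunction \<mu>)) (eigenfunction \<mu>)"
  using macdonald_H_eq[OF generic_qq_tt eigenbasis_eigenvector] ex_swapped_eigenbasis eval_h_eigenfunction by blast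

lemma linear_on_basis_eqI:
  assumes b: "basis_family I b"
    and L: "\<And>F G. L (F + G) = L F + L G" "\<And>c F. L (scale_sf c F) = scale_sf c (L F)"
    and L': "\<And>F G. L' (F + G) = L' F + L' G" "\<And>c F. L' (scale_sf c F) = scale_sf c (L' F)"
    and eq: "\<And>i. i \<in> I \<Longrightarrow> L (b i) = L' (b i)"
  shows "L F = L' F"
proof -
  have "F \<in> sf.span (b ` I)" using b by (simp add: basis_family_def)
  then show ?thesis
  proof (induction rule: sf.span_induct_alt)
    case base
    show ?case using L(2)[of 0 0] L'(2)[of 0 0] by simp
  qed (auto simp: L L' eq)
qed

lemma ex_diagonal:
  assumes b: "basis_family I b"
  shows "\<exists>L. (\<forall>F G. L (F + G) = L F + L G) \<and> (\<forall>c F. L (scale_sf c F) = scale_sf c (L F)) \<and>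
    (\<forall>i\<in>I. L (b i) = scale_sf (p i) (b i))"
proof (intro exI conjI allI ballI)
  define L where "L F = (\<Sum>i | coordinate I b F i \<noteq> 0. scale_sf (p i * coordinate I b F i) (b i))" for F
  have sup: "L F = (\<Sum>i\<in>J. scale_sf (p i * coordinate I b F i) (b i))"
    if "finite J" "{i. coordinate I b F i \<noteq> 0} \<subseteq> J" for F J
    unfolding L_def using that by (intro sum.mono_neutral_left) auto
  fix F G c
  have fin: "finite ({i. coordinate I b F i \<noteq> 0} \<union> {i. coordinate I b G i \<noteq> 0})"
    using finite_coordinate[OF b] by blast
  have "{i. coordinate I b (F + G) i \<noteq> 0} \<subseteq> {i. coordinate I b F i \<noteq> 0} \<union> {i. coordinate I b G i \<noteq> 0}"
      "{i. coordinate I b (scale_sf c F) i \<noteq> 0} \<subseteq> {i. coordinate I b F i \<noteq> 0} \<union> {i. coordinate I b G i \<noteq> 0}"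
    by (auto simp: coordinate_add[OF b] coordinate_scale[OF b])
  note sup' = sup[OF fin this(1)] sup[OF fin this(2)] sup[OF fin Un_upper1] sup[OF fin Un_upper2]
  show "L (F + G) = L F + L G" "L (scale_sf c F) = scale_sf c (L F)"
    unfolding sup' by (simp_all add: coordinate_add[OF b] coordinate_scale[OF b] distrib_left
        sf.scale_left_distrib sum.distrib sf.scale_sum_right mult_ac)
next
  fix i assume i: "i \<in> I"
  have c: "coordinate I b (b i) j = (if j = i then 1 else 0)" for j by (rule coordinate_basis[OF b i])
  have "{j. coordinate I b (b i) j \<noteq> 0} = {i}" by (auto simp: c)
  then show "(\<Sum>j | coordinate I b (b i) j \<noteq> 0. scale_sf (p j * coordinate I b (b i) j) (b j)) = scale_sf (p i) (b i)"
    by (simp add: c)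
qed

lemma Pi_coeff_factor: "1 - qq ^ j * tt ^ i = to_fract (1 - monom (q_var ^ j) i)"
proof -
  have "monom (q_var ^ j) i = [:q_var ^ j:] * monom 1 i" by (simp add: smult_monom)
  then show ?thesis by (simp only: qq_power tt_power to_fract_diff to_fract_1 to_fract_mult)
qed

lemma finite_cells: "finite (cells \<mu>)"
proof (rule finite_subset)
  show "cells \<mu> \<subseteq> {..<length \<mu>} \<times> {..<sum_list \<mu>}"
  proof (clarsimp simp: cells_def)
    fix i j assume "i < length \<mu>" "j < \<mu> ! i"
    then show "j < sum_list \<mu>" using member_le_sum_list[OF nth_mem, of i \<mu>] by linarith
  qed
qed simp

text \<open>The constant term in t of a factor is 1 - q^j in row 0, where j > 0, and 1 in every
  other row.\<close>

lemma Pi_coeff_nonzero: "Pi_coeff \<mu> \<noteq> 0"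
proof -
  have nz: "1 - qq ^ j * tt ^ i \<noteq> 0" if "(i, j) \<noteq> (0, 0)" for i j
  proof
    assume "1 - qq ^ j * tt ^ i = 0"
    then have eq: "1 - monom (q_var ^ j) i = 0" unfolding Pi_coeff_factor by (metis to_fract_eq_0_iff)
    show False
    proof (cases "i = 0")
      case True
      then show False
        using arg_cong[OF eq, of "\<lambda>p. coeff p 0"] q_var_ne_1[of j] that by (auto simp: coeff_1)
    next
      case False
      then show False using arg_cong[OF eq, of "\<lambda>p. coeff p 0"] by (simp add: coeff_1)
    qed
  qed
  show ?thesis
  proof
    assume "Pi_coeff \<mu> = 0"
    then obtain x where x: "x \<in> cells \<mu> - {(0, 0)}" "(case x of (i, j) \<Rightarrow> 1 - qq ^ j * tt ^ i) = 0"
      unfolding Pi_coeff_def using prod_zero_iff[of "cells \<mu> - {(0, 0)}"] finite_cells by blast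
    obtain i j where "x = (i, j)" by (cases x)
    then show False using x nz[of i j] by simp
  qed
qed

lemma Pi_coeff_regular: "Pi_coeff \<mu> \<in> regular0"
  unfolding Pi_coeff_def
proof (rule subring_set_prod[OF subring0])
  fix x :: "nat \<times> nat"
  show "(case x of (i, j) \<Rightarrow> 1 - qq ^ j * tt ^ i) \<in> regular0"
    by (cases x) (simp only: prod.case Pi_coeff_factor to_fract_regular)
qed

lemma Pi_coeff_row: "Pi_coeff [Suc n] = q_poch qq n"
proof -
  have "cells [Suc n] - {(0, 0)} = (\<lambda>j. (0, j)) ` {1..n}"
    by (auto simp: cells_def)
  then show ?thesis by (simp add: Pi_coeff_def q_poch_def sum.reindex prod.reindex inj_on_def)
qed

text \<open>Rescaling basis vectors does not affect a diagonal operator, so it may be described on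
  \<open>eigenfunction\<close>. The diagonal operator with reciprocal entries is a two-sided
  inverse, which makes \<open>inv_into\<close> an actual inverse.\<close>

lemma Pi_op_props:
  shows Pi_op_add: "Pi_op (F + G) = Pi_op F + Pi_op G"
    and Pi_op_scale: "Pi_op (scale_sf c F) = scale_sf c (Pi_op F)"
    and Pi_op_eigenfunction: "is_partition \<mu> \<Longrightarrow> Pi_op (eigenfunction \<mu>) = scale_sf (Pi_coeff \<mu>) (eigenfunction \<mu>)"
    and Pi_op_inv: "Pi_op (inv_into UNIV Pi_op F) = F" "inv_into UNIV Pi_op (Pi_op F) = F"
proof -
  note b = eigenfunction_basis
  obtain L where L: "\<And>F G. L (F + G) = L F + L G" "\<And>c F. L (scale_sf c F) = scale_sf c (L F)"
    "\<And>\<mu>. \<mu> \<in> partitions \<Longrightarrow> L (eigenfunction \<mu>) = scale_sf (Pi_coeff \<mu>) (eigenfunction \<mu>)"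
    using ex_diagonal[OF b, of Pi_coeff] by blast
  obtain L' where L': "\<And>F G. L' (F + G) = L' F + L' G" "\<And>c F. L' (scale_sf c F) = scale_sf c (L' F)"
    "\<And>\<mu>. \<mu> \<in> partitions \<Longrightarrow> L' (eigenfunction \<mu>) = scale_sf (1 / Pi_coeff \<mu>) (eigenfunction \<mu>)"
    using ex_diagonal[OF b, of "\<lambda>\<mu>. 1 / Pi_coeff \<mu>"] by blast
  have Pi: "Pi_op = L"
    unfolding Pi_op_def
  proof (rule the_equality)
    show "Vector_Spaces.linear scale_sf scale_sf L \<and>
      (\<forall>\<mu>. is_partition \<mu> \<longrightarrow> L (macdonald_H \<mu>) = scale_sf (Pi_coeff \<mu>) (macdonald_H \<mu>))"
      by (auto simp: Vector_Spaces.linear_iff vector_space_scale_sf L macdonald_H_eigenfunction mult.commute)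
    fix K assume K: "Vector_Spaces.linear scale_sf scale_sf K \<and>
      (\<forall>\<mu>. is_partition \<mu> \<longrightarrow> K (macdonald_H \<mu>) = scale_sf (Pi_coeff \<mu>) (macdonald_H \<mu>))"
    then have lin: "K (F + G) = K F + K G" "K (scale_sf c F) = scale_sf c (K F)" for F G c
      by (simp_all add: Vector_Spaces.linear_iff)
    show "K = L"
    proof
      fix F show "K F = L F"
      proof (rule linear_on_basis_eqI[OF b lin L(1,2)])
        fix \<mu> assume \<mu>: "\<mu> \<in> partitions"
        let ?a = "eval_h (eigenfunction \<mu>)"
        have p: "is_partition \<mu>" using \<mu> by simp
        have a: "?a \<noteq> 0" by (rule eval_h_eigenfunction[OF p])
        have H: "macdonald_H \<mu> = scale_sf (1 / ?a) (eigenfunction \<mu>)" by (rule macdonald_H_eigenfunction[OF p])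
        then have F: "eigenfunction \<mu> = scale_sf ?a (macdonald_H \<mu>)" using a by simp
        have "K (eigenfunction \<mu>) = scale_sf ?a (K (macdonald_H \<mu>))" by (subst F) (rule lin)
        also have "K (macdonald_H \<mu>) = scale_sf (Pi_coeff \<mu>) (macdonald_H \<mu>)" using K \<mu> by simp
        finally show "K (eigenfunction \<mu>) = L (eigenfunction \<mu>)" using a by (simp add: L(3)[OF \<mu>] H)
      qed
    qed
  qed
  have LL': "L (L' F) = F" for F
    by (rule linear_on_basis_eqI[OF b, where L = "\<lambda>F. L (L' F)" and L' = "\<lambda>F. F"])
      (auto simp: L L' Pi_coeff_nonzero)
  have L'L: "L' (L F) = F" for F
    by (rule linear_on_basis_eqI[OF b, where L = "\<lambda>F. L' (L F)" and L' = "\<lambda>F. F"])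
      (auto simp: L L' Pi_coeff_nonzero)
  have "inv_into UNIV L = L'" by (rule inv_equality) (rule L'L, rule LL')
  then show "Pi_op (inv_into UNIV Pi_op F) = F" "inv_into UNIV Pi_op (Pi_op F) = F"
    unfolding Pi by (simp_all add: LL' L'L)
  show "Pi_op (F + G) = Pi_op F + Pi_op G" "Pi_op (scale_sf c F) = scale_sf c (Pi_op F)"
    unfolding Pi by (rule L)+
  show "Pi_op (eigenfunction \<mu>) = scale_sf (Pi_coeff \<mu>) (eigenfunction \<mu>)" if "is_partition \<mu>"
    unfolding Pi using L(3) that by simp
qed

lemma Pi_op_0: "Pi_op 0 = 0"
  using Pi_op_scale[of 0 0] by simp

section \<open>Values at \<open>t = 0\<close>\<close>

lemma one_minus_qq_power_regular: "1 - qq ^ r \<in> regular_on S"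
  unfolding qq_power const_t_1[symmetric] const_t_diff[symmetric] by (rule to_fract_regular)

lemma vanishing1_regular0: "vanishing1 \<subseteq> regular0"
proof -
  have "regular_on {0, 1} \<subseteq> regular0" unfolding regular_on_def by blast
  then show ?thesis using ideal_setD(2)[OF ideal_vanishing1] by blast
qed

text \<open>The off-diagonal coefficients and the scalars 1/(1 - q^r) are regular at t = 0, so
  eigenfunctions can be specialized there.\<close>

lemma eigenfunction_lattice:
  assumes "\<mu> \<in> long_partitions n 0"
  shows "eigenfunction \<mu> \<in> rspan regular0 (glist psym ` long_partitions n 0)"
proof (rule scaling_lattice[OF subring0])
  have \<mu>: "is_partition \<mu>" "sum_list \<mu> = n" using assms by (auto simp: long_partitions_def)
  show "1 / (1 - qq ^ r) \<in> regular0" if "r > 0" for r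
  proof -
    have "1 - qq ^ r = to_fract [:1 - q_var ^ r:]" unfolding qq_power const_t_1[symmetric] const_t_diff ..
    moreover have "1 / to_fract [:1 - q_var ^ r:] \<in> regular0"
      using q_var_ne_1[OF that] to_fract_regular[of 1] by (intro regular_divide) auto
    ultimately show ?thesis by simp
  qed
  have "eigenvector \<mu> - glist hsym \<mu> \<in> rspan regular0 (glist hsym ` long_partitions n 0)"
    by (rule rspan_mono[OF eigenvector(2)[OF \<mu>(1)] vanishing1_regular0])
      (use \<mu> in \<open>auto simp: long_partitions_def below_def dominates_def\<close>)
  moreover have "glist hsym \<mu> \<in> rspan regular0 (glist hsym ` long_partitions n 0)"
    using assms by (intro rspan_base subring0) auto
  ultimately have "(eigenvector \<mu> - glist hsym \<mu>) + glist hsym \<mu> \<in> rspan regular0 (glist hsym ` long_partitions n 0)"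
    by (rule rspan_plus)
  then show "eigenvector \<mu> \<in> rspan regular0 (glist psym ` long_partitions n 0)"
    using subring_regular_on[of "{0}"] by (simp add: rspan_psym_eq_hsym)
qed

text \<open>The converse inclusion, from the inverse triangular transformation: expanding a
  specializable element in eigenfunctions introduces no pole at t = 0.\<close>

lemma lattice_eigenfunction:
  assumes G: "G \<in> rspan regular0 (glist psym ` long_partitions n 0)"
  shows "G \<in> rspan regular0 (eigenfunction ` long_partitions n 0)"
proof -
  have "multiply_alphabet qq G \<in> rspan regular0 (glist psym ` long_partitions n 0)"
    by (intro scaling_lattice[OF subring0] G one_minus_qq_power_regular)
  then have "multiply_alphabet qq G \<in> rspan regular0 (glist hsym ` long_partitions n 0)"
    using subring_regular_on[of "{0}"] by (simp add: rspan_psym_eq_hsym)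
  then have "multiply_alphabet qq G \<in> rspan regular0 (eigenvector ` long_partitions n 0)"
  proof (rule rspan_subset[OF subring0, rotated])
    fix b :: "ratfun_qt symfun" assume "b \<in> glist hsym ` long_partitions n 0"
    then obtain \<mu> where \<mu>: "\<mu> \<in> long_partitions n 0" "is_partition \<mu>" "sum_list \<mu> = n" "b = glist hsym \<mu>"
      by (auto simp: long_partitions_def)
    have "glist hsym \<mu> - eigenvector \<mu> \<in> rspan vanishing1 (eigenvector ` {\<nu>. below \<mu> \<nu>})"
      by (rule triangular_inverse[OF ideal_vanishing1 \<mu>(2)])
        (use \<mu>(2) eigenvector(2) in \<open>auto simp: below_def\<close>)
    then have "glist hsym \<mu> - eigenvector \<mu> \<in> rspan regular0 (eigenvector ` long_partitions n 0)"
      by (rule rspan_mono[OF _ vanishing1_regular0]) (use \<mu> in \<open>auto simp: long_partitions_def below_def dominates_def\<close>)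
    moreover have "eigenvector \<mu> \<in> rspan regular0 (eigenvector ` long_partitions n 0)"
      using \<mu>(1) by (intro rspan_base subring0) auto
    ultimately have "(glist hsym \<mu> - eigenvector \<mu>) + eigenvector \<mu> \<in> rspan regular0 (eigenvector ` long_partitions n 0)"
      by (rule rspan_plus)
    then show "b \<in> rspan regular0 (eigenvector ` long_partitions n 0)" by (simp add: \<mu>)
  qed
  then have "divide_alphabet qq (multiply_alphabet qq G) \<in> rspan regular0 (eigenfunction ` long_partitions n 0)"
    by (rule rspan_image[where f = "divide_alphabet qq", OF alphabet_scaling_simps(3,2), rotated])
      (auto simp: alphabet_scaling_simps(5) intro!: rspan_gen)
  then show ?thesis by (simp only: multiply_divide_alphabet(2)[OF qq_ne_1])
qed

lemma psym_hom_regular: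
  assumes G: "G \<in> rspan regular0 (glist psym ` long_partitions n 0)" and g: "\<And>r. r > 0 \<Longrightarrow> g r \<in> regular0"
  shows "scalar_id.psym_hom g G \<in> regular0"
proof -
  have "scalar_id.psym_hom g G \<in> additive_span regular0"
    using G unfolding rspan_def
  proof (rule additive_span_image[where f = "scalar_id.psym_hom g", OF scalar_id.psym_hom_add scalar_id.psym_hom_zero, rotated])
    fix x :: "ratfun_qt symfun" assume "x \<in> {scale_sf c b |c b. c \<in> regular0 \<and> b \<in> glist psym ` long_partitions n 0}"
    then obtain c \<mu> where x: "x = scale_sf c (glist psym \<mu>)" "c \<in> regular0" "0 \<notin> set \<mu>"
      by (auto simp: long_partitions_def is_partition_def)
    have "scalar_id.psym_hom g x = c * glist g \<mu>"
      using scalar_id.psym_hom_plist[OF x(3), of g]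
      by (simp add: x(1) scalar_id.psym_hom_scale plist_eq_glist glist_def)
    also have "\<dots> \<in> regular0" by (intro subring_setD(3)[OF subring0] x(2) eval_t0_glist(1) g x(3))
    finally show "scalar_id.psym_hom g x \<in> additive_span regular0" by (rule additive_span_base)
  qed
  moreover have "x \<in> regular0" if "x \<in> additive_span regular0" for x
    using that by induction (auto intro: subring_setD(4,5)[OF subring0])
  ultimately show ?thesis by blast
qed

lemma sign_regular: "- ((-1) ^ r) \<in> regular0"
  by (intro subring_setD(6,7)[OF subring0] subring_setD(1)[OF subring0])

lemma eval_e_regular: "G \<in> rspan regular0 (glist psym ` long_partitions n 0) \<Longrightarrow> eval_e G \<in> regular0"
  unfolding eval_e_def by (erule psym_hom_regular) (rule sign_regular)

lemma eval_t0_minus_one_power: "eval_t0 ((-1) ^ r :: ratfun_qt) = (-1) ^ r" "eval_t0 (- ((-1) ^ r) :: ratfun_qt) = - ((-1) ^ r)"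
proof -
  note one = subring_setD(1)[OF subring0]
  have "eval_t0 (1 + (-1) :: ratfun_qt) = eval_t0 (1 :: ratfun_qt) + eval_t0 (-1 :: ratfun_qt)"
    by (rule eval_t0_hom(1)[OF one subring_setD(6)[OF subring0 one]])
  then have m: "eval_t0 (-1 :: ratfun_qt) = -1" by (simp add: eval_t0_0 eval_t0_1 eq_neg_iff_add_eq_0 add.commute)
  show "eval_t0 ((-1) ^ r :: ratfun_qt) = (-1) ^ r" "eval_t0 (- ((-1) ^ r) :: ratfun_qt) = - ((-1) ^ r)"
    by (cases "even r"; simp add: m eval_t0_1)+
qed

text \<open>For r > 0 the scalar 1 - (1 - q^r)(1 - t^r) becomes q^r at t = 0, and in degree n these
  powers multiply to q^n.\<close>

lemma eval_e_macdonald_operator_t0: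
  assumes G: "G \<in> rspan regular0 (glist psym ` long_partitions n 0)"
  shows "eval_t0 (eval_e (macdonald_operator qq tt G)) = q_var ^ n * eval_t0 (eval_e G)"
proof -
  define g where "g = (\<lambda>r. - ((-1) ^ r) * (1 - (1 - qq ^ r) * (1 - tt ^ r)))"
  have g: "g r \<in> regular0 \<and> eval_t0 (g r) = - ((-1) ^ r) * q_var ^ r" if r: "r > 0" for r
  proof -
    have eq: "1 - (1 - qq ^ r) * (1 - tt ^ r) = to_fract (1 - (1 - [:q_var ^ r:]) * (1 - monom 1 r))"
      by (simp only: qq_power tt_power to_fract_diff to_fract_1 to_fract_mult)
    have "eval_t0 (1 - (1 - qq ^ r) * (1 - tt ^ r)) = q_var ^ r"
      unfolding eq eval_t0_to_fract using r by (simp add: poly_monom zero_power)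
    moreover have "1 - (1 - qq ^ r) * (1 - tt ^ r) \<in> regular0" unfolding eq by (rule to_fract_regular)
    ultimately show ?thesis
      unfolding g_def using subring_setD(3)[OF subring0 sign_regular] eval_t0_hom(2)[OF sign_regular]
      by (simp add: eval_t0_minus_one_power)
  qed
  have "eval_t0 (scalar_id.psym_hom g G) = q_var ^ n * eval_t0 (eval_e G)"
    using G unfolding rspan_def
  proof (induction rule: additive_span.induct)
    case zero
    show ?case by (simp add: scalar_id.psym_hom_zero eval_e_simps eval_t0_0)
  next
    case (add x y)
    then obtain c \<mu> where x: "x = scale_sf c (glist psym \<mu>)" "c \<in> regular0" and \<mu>: "\<mu> \<in> long_partitions n 0" "0 \<notin> set \<mu>"
      by (auto simp: long_partitions_def is_partition_def)
    have xL: "x \<in> rspan regular0 (glist psym ` long_partitions n 0)" and yL: "y \<in> rspan regular0 (glist psym ` long_partitions n 0)"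
      using x \<mu> add.hyps(2) by (auto simp: rspan_def intro!: rspan_gen[unfolded rspan_def])
    have "scalar_id.psym_hom g x = c * glist g \<mu>"
      using scalar_id.psym_hom_plist[OF \<mu>(2), of g] by (simp add: x(1) scalar_id.psym_hom_scale plist_eq_glist glist_def)
    then have "eval_t0 (scalar_id.psym_hom g x) = eval_t0 c * glist (\<lambda>r. eval_t0 (g r)) \<mu>"
      using g eval_t0_glist[of g \<mu>] \<mu>(2) x(2) by (simp add: eval_t0_hom)
    also have "glist (\<lambda>r. eval_t0 (g r)) \<mu> = q_var ^ sum_list \<mu> * glist (\<lambda>r. - ((-1) ^ r)) \<mu>"
      using \<mu>(2) g by (induction \<mu>) (auto simp: power_add mult_ac)
    also have "glist (\<lambda>r. - ((-1) ^ r)) \<mu> = eval_t0 (glist (\<lambda>r. - ((-1) ^ r)) \<mu> :: ratfun_qt)"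
      using eval_t0_glist(2)[of "\<lambda>r. - ((-1) ^ r)", OF sign_regular \<mu>(2)] by (simp add: eval_t0_minus_one_power)
    also have "eval_t0 c * (q_var ^ sum_list \<mu> * eval_t0 (glist (\<lambda>r. - ((-1) ^ r)) \<mu>)) = q_var ^ n * eval_t0 (c * glist (\<lambda>r. - ((-1) ^ r)) \<mu>)"
      using \<mu>(1) by (simp add: eval_t0_hom(2)[OF x(2) eval_t0_glist(1)[OF sign_regular \<mu>(2)]] long_partitions_def)
    also have "c * glist (\<lambda>r. - ((-1) ^ r)) \<mu> = eval_e x"
      using scalar_id.psym_hom_plist[OF \<mu>(2), of "\<lambda>r. - ((-1) ^ r) :: ratfun_qt"]
      by (simp add: x(1) eval_e_simps plist_eq_glist glist_def eval_e_def[symmetric])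
    finally have "eval_t0 (scalar_id.psym_hom g x) = q_var ^ n * eval_t0 (eval_e x)" .
    moreover have "scalar_id.psym_hom g x \<in> regular0" "scalar_id.psym_hom g y \<in> regular0"
      using psym_hom_regular[OF xL, of g] psym_hom_regular[OF yL, of g] g by auto
    ultimately show ?case
      using add.IH eval_e_regular[OF xL] eval_e_regular[OF yL]
      by (simp add: scalar_id.psym_hom_add eval_e_simps eval_t0_hom distrib_left)
  qed
  then show ?thesis unfolding eval_e_macdonald_operator g_def .
qed

text \<open>Computing the value of D_0 on the eigenfunction in two ways gives the factors q^n and
  q^x, where x is the largest part and x < n.\<close>

lemma eval_e_eigenfunction_t0:
  assumes \<mu>: "\<mu> \<in> long_partitions n 0" and ne: "\<mu> \<noteq> [n]" and n: "n > 0"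
  shows "eval_t0 (eval_e (eigenfunction \<mu>)) = 0"
proof -
  have p: "is_partition \<mu>" "sum_list \<mu> = n" using \<mu> by (auto simp: long_partitions_def)
  obtain x xs where xs: "\<mu> = x # xs" using p(2) n by (cases \<mu>) auto
  have xs0: "xs \<noteq> []" using ne p(2) xs by auto
  then obtain y ys where "xs = y # ys" by (cases xs) auto
  then have "x < n" using p xs by (auto simp: is_partition_def intro!: gr0I)
  note L = eigenfunction_lattice[OF \<mu>]
  \<comment> \<open>The eigenvalue as a polynomial in t. At t = 0 only row 0 remains, giving 1 - (1
    - q^x) = q^x.\<close>
  define V where "V = 1 - (1 - [:0, 1:]) * (\<Sum>i<length \<mu>. monom 1 i * (1 - [:q_var ^ part \<mu> i:]))"
  have V: "vertex_eigenvalue qq tt \<mu> = to_fract V"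
    unfolding vertex_eigenvalue_parts[OF order_refl] V_def
    by (simp only: to_fract_diff to_fract_1 to_fract_mult to_fract_sum qq_power tt_power tt_eq[symmetric])
  have "poly V 0 = q_var ^ x"
  proof -
    have "(\<Sum>i<length \<mu>. poly (monom 1 i * (1 - [:q_var ^ part \<mu> i:])) 0) = (\<Sum>i\<in>{0}. poly (monom 1 i * (1 - [:q_var ^ part \<mu> i:])) 0)"
      using xs by (intro sum.mono_neutral_right) (auto simp: poly_monom)
    then show ?thesis by (simp add: V_def poly_sum poly_monom xs part_def)
  qed
  then have e: "vertex_eigenvalue qq tt \<mu> \<in> regular0" "eval_t0 (vertex_eigenvalue qq tt \<mu>) = q_var ^ x"
    unfolding V eval_t0_to_fract by (simp_all add: to_fract_regular)
  have "macdonald_operator qq tt (eigenfunction \<mu>) = scale_sf (vertex_eigenvalue qq tt \<mu>) (eigenfunction \<mu>)"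
    by (rule macdonald_operator_eigen[OF qq_ne_1 eigenvector(1)[OF p(1)]])
  then have "q_var ^ n * eval_t0 (eval_e (eigenfunction \<mu>)) = eval_t0 (vertex_eigenvalue qq tt \<mu> * eval_e (eigenfunction \<mu>))"
    using eval_e_macdonald_operator_t0[OF L] by (simp add: eval_e_simps)
  also have "\<dots> = q_var ^ x * eval_t0 (eval_e (eigenfunction \<mu>))"
    by (simp add: eval_t0_hom(2)[OF e(1) eval_e_regular[OF L]] e(2))
  finally show ?thesis using \<open>x < n\<close> q_var_power_eq_iff[of n x] by auto
qed

text \<open>In the expansion by eigenfunctions with regular coefficients only the one-row term
  survives at t = 0, and its eigenvalue is (q;q)_n in degree n+1.\<close>

lemma eval_e_Pi_op_t0:
  assumes G: "G \<in> rspan regular0 (glist psym ` long_partitions (Suc n) 0)"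
  shows "Pi_op G \<in> rspan regular0 (glist psym ` long_partitions (Suc n) 0)"
    and "eval_t0 (eval_e (Pi_op G)) = q_poch q_var n * eval_t0 (eval_e G)"
proof -
  let ?L = "rspan regular0 (glist psym ` long_partitions (Suc n) 0)"
  have "G \<in> ?L \<and> Pi_op G \<in> ?L \<and> eval_t0 (eval_e (Pi_op G)) = q_poch q_var n * eval_t0 (eval_e G)"
    using lattice_eigenfunction[OF G] unfolding rspan_def[of regular0 "eigenfunction ` _"]
  proof (induction rule: additive_span.induct)
    case zero
    show ?case by (simp add: Pi_op_0 eval_e_simps eval_t0_0)
  next
    case (add x y)
    then obtain c \<mu> where x: "x = scale_sf c (eigenfunction \<mu>)" "c \<in> regular0" and \<mu>: "\<mu> \<in> long_partitions (Suc n) 0"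
      by blast
    note L = eigenfunction_lattice[OF \<mu>]
    have Pi: "Pi_op x = scale_sf (c * Pi_coeff \<mu>) (eigenfunction \<mu>)"
      using \<mu> by (simp add: x Pi_op_scale Pi_op_eigenfunction long_partitions_def)
    have xL: "x \<in> ?L" "Pi_op x \<in> ?L"
      unfolding Pi unfolding x(1) by (intro rspan_scale subring0 x(2) L subring_setD(3)[OF subring0] Pi_coeff_regular)+
    have "eval_t0 (eval_e (Pi_op x)) = eval_t0 c * eval_t0 (Pi_coeff \<mu>) * eval_t0 (eval_e (eigenfunction \<mu>))"
      unfolding Pi eval_e_simps
      by (simp add: eval_t0_hom(2) x(2) Pi_coeff_regular eval_e_regular[OF L] subring_setD(3)[OF subring0])
    also have "\<dots> = q_poch q_var n * eval_t0 (eval_e x)"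
    proof (cases "\<mu> = [Suc n]")
      case True
      then have "eval_t0 (Pi_coeff \<mu>) = q_poch q_var n" by (simp add: Pi_coeff_row q_poch_qq eval_t0_const_t)
      then show ?thesis unfolding x(1) eval_e_simps by (simp add: eval_t0_hom(2) x(2) eval_e_regular[OF L])
    next
      case False
      then show ?thesis unfolding x(1) eval_e_simps
        by (simp add: eval_t0_hom(2) x(2) eval_e_regular[OF L] eval_e_eigenfunction_t0[OF \<mu>])
    qed
    finally have ex: "eval_t0 (eval_e (Pi_op x)) = q_poch q_var n * eval_t0 (eval_e x)" .
    have yL: "y \<in> ?L" "Pi_op y \<in> ?L" and ey: "eval_t0 (eval_e (Pi_op y)) = q_poch q_var n * eval_t0 (eval_e y)"
      using add.IH by simp_all
    show ?case
      by (simp only: Pi_op_add eval_e_simps ex ey distrib_left rspan_plus[OF xL(1) yL(1)] rspan_plus[OF xL(2) yL(2)]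
        eval_t0_hom(1)[OF eval_e_regular[OF xL(1)] eval_e_regular[OF yL(1)]]
        eval_t0_hom(1)[OF eval_e_regular[OF xL(2)] eval_e_regular[OF yL(2)]] simp_thms)
  qed
  then show "Pi_op G \<in> ?L" "eval_t0 (eval_e (Pi_op G)) = q_poch q_var n * eval_t0 (eval_e G)" by auto
qed

text \<open>The monomial coefficients are the same natural numbers over every ring, so specializing
  coefficientwise agrees with specializing the coefficients of power sum products.\<close>

lemma coeff_sf_plist_nat:
  assumes "0 \<notin> set \<mu>"
  shows "\<exists>k. coeff_sf (plist \<mu> :: 'a :: comm_ring_1 symfun) m = of_nat k
    \<and> coeff_sf (plist \<mu> :: 'b :: comm_ring_1 symfun) m = of_nat k"
  using assms
proof (induction \<mu> arbitrary: m)
  case Nil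
  show ?case by (intro exI[of _ "if m = {#} then 1 else 0"]) (simp add: one_symfun.rep_eq)
next
  case (Cons r \<mu>)
  then have "\<forall>m. \<exists>k. coeff_sf (plist \<mu> :: 'a symfun) m = of_nat k \<and> coeff_sf (plist \<mu> :: 'b symfun) m = of_nat k"
    by simp
  then obtain k where k: "\<forall>m. coeff_sf (plist \<mu> :: 'a symfun) m = of_nat (k m)
    \<and> coeff_sf (plist \<mu> :: 'b symfun) m = of_nat (k m)" by (rule choice[elim_format]) blast
  have "r > 0" using Cons.prems by auto
  then show ?case
    by (intro exI[of _ "\<Sum>i | count m i \<ge> r. k (m - replicate_mset r i)"]) (simp add: coeff_sf_psym_mult k)
qed

text \<open>Setting t = 0 in monomial coefficients commutes with \<open>eval_e\<close>, which is
  defined through power sums; regularity of every coefficient is part of the induction.\<close>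

lemma eval_t0_sf_lattice:
  assumes G: "G \<in> rspan regular0 (glist psym ` long_partitions n 0)"
  shows "eval_t0_sf G \<in> rspan UNIV (glist psym ` long_partitions n 0)"
    and "eval_e (eval_t0_sf G) = eval_t0 (eval_e G)"
proof -
  let ?L = "rspan regular0 (glist psym ` long_partitions n 0)" and ?L' = "rspan UNIV (glist psym ` long_partitions n 0)"
  have "G \<in> ?L \<and> (\<forall>m. coeff_sf G m \<in> regular0) \<and> eval_t0_sf G \<in> ?L' \<and> eval_e (eval_t0_sf G) = eval_t0 (eval_e G)"
    using G unfolding rspan_def[of regular0]
  proof (induction rule: additive_span.induct)
    case zero
    have "eval_t0_sf 0 = (0 :: ratfun_q symfun)" by (rule symfun_eqI) (simp add: eval_t0_sf.rep_eq eval_t0_0)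
    then show ?case by (simp add: eval_e_simps eval_t0_0 additive_span.zero subring_setD(4)[OF subring0])
  next
    case (add x y)
    then obtain c \<mu> where x: "x = scale_sf c (glist psym \<mu>)" "c \<in> regular0" and \<mu>: "\<mu> \<in> long_partitions n 0" "0 \<notin> set \<mu>"
      by (auto simp: long_partitions_def is_partition_def)
    have xL: "x \<in> ?L" unfolding x(1) using \<mu> x(2) by (intro rspan_gen) auto
    have nat: "(of_nat k :: ratfun_qt) \<in> regular0" "eval_t0 (of_nat k :: ratfun_qt) = of_nat k" for k
      using to_fract_regular[of "of_nat k"] eval_t0_to_fract[of "of_nat k"] by (simp_all add: to_fract_of_nat)
    have coeffs: "coeff_sf x m \<in> regular0 \<and> eval_t0 (coeff_sf x m) = coeff_sf (scale_sf (eval_t0 c) (glist psym \<mu>)) m" for m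
    proof -
      obtain k where "coeff_sf (glist psym \<mu> :: ratfun_qt symfun) m = of_nat k" "coeff_sf (glist psym \<mu> :: ratfun_q symfun) m = of_nat k"
        using coeff_sf_plist_nat[OF \<mu>(2), where 'a = ratfun_qt and 'b = ratfun_q, of m] unfolding plist_eq_glist by blast
      then show ?thesis
        using x(2) nat[of k] by (simp add: x(1) eval_t0_hom(2) subring_setD(3)[OF subring0])
    qed
    then have ex: "eval_t0_sf x = scale_sf (eval_t0 c) (glist psym \<mu>)"
      by (intro symfun_eqI) (simp add: eval_t0_sf.rep_eq)
    have "eval_e x = c * glist (\<lambda>r. - ((-1) ^ r)) \<mu>" "eval_e (eval_t0_sf x) = eval_t0 c * glist (\<lambda>r. - ((-1) ^ r)) \<mu>"
      using scalar_id.psym_hom_plist[OF \<mu>(2), of "\<lambda>r. - ((-1) ^ r) :: ratfun_qt"]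
        scalar_id.psym_hom_plist[OF \<mu>(2), of "\<lambda>r. - ((-1) ^ r) :: ratfun_q"]
      unfolding ex by (simp_all add: x(1) eval_e_simps plist_eq_glist glist_def eval_e_def[symmetric])
    then have ee: "eval_e (eval_t0_sf x) = eval_t0 (eval_e x)"
      by (simp add: eval_t0_hom(2)[OF x(2) eval_t0_glist(1)[OF sign_regular \<mu>(2)]]
        eval_t0_glist(2)[OF sign_regular \<mu>(2)] eval_t0_minus_one_power)
    have sum: "eval_t0_sf (x + y) = eval_t0_sf x + eval_t0_sf y"
      using coeffs add.IH by (intro symfun_eqI) (simp add: eval_t0_sf.rep_eq eval_t0_hom)
    have "eval_t0_sf x \<in> ?L'" unfolding ex using \<mu>(1) by (intro rspan_gen) auto
    then show ?case
      using add.IH xL coeffs ee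
      by (auto simp: sum eval_e_simps eval_t0_hom eval_e_regular rspan_def[of regular0, symmetric]
        intro: rspan_plus subring_setD(5)[OF subring0])
  qed
  then show "eval_t0_sf G \<in> ?L'" "eval_e (eval_t0_sf G) = eval_t0 (eval_e G)" by auto
qed

section \<open>Theta operators on a one-row Macdonald polynomial\<close>

abbreviation theta_factor :: "nat \<Rightarrow> ratfun_qt symfun" where
  "theta_factor k \<equiv> alphabet_scaling (\<lambda>r. 1 / ((1 - qq ^ r) * (1 - tt ^ r))) (esym k)"

lemma theta_scalar:
  assumes "r > 0"
  shows "1 / ((1 - qq ^ r) * (1 - tt ^ r)) \<in> regular0"
    and "eval_t0 (1 / ((1 - qq ^ r) * (1 - tt ^ r))) = 1 / (1 - q_var ^ r)"
proof -
  let ?b = "(1 - [:q_var ^ r:]) * (1 - monom 1 r)"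
  have eq: "1 / ((1 - qq ^ r) * (1 - tt ^ r)) = to_fract 1 / to_fract ?b"
    by (simp only: qq_power tt_power to_fract_diff to_fract_1 to_fract_mult)
  have b: "poly ?b 0 = 1 - q_var ^ r" using assms by (simp add: poly_monom)
  then have b0: "poly ?b 0 \<noteq> 0" using q_var_ne_1[OF assms] by simp
  then show "1 / ((1 - qq ^ r) * (1 - tt ^ r)) \<in> regular0" unfolding eq by (intro regular_onI) simp
  show "eval_t0 (1 / ((1 - qq ^ r) * (1 - tt ^ r))) = 1 / (1 - q_var ^ r)"
    unfolding eq eval_t0_quotient[OF b0] b by simp
qed

lemma theta_factor_lattice: "theta_factor k \<in> rspan regular0 (glist psym ` long_partitions k 0)"
  by (intro scaling_lattice[OF subring0] theta_scalar esym_lattice subring_regular_on) simp_all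

text \<open>The evaluations are the h_k[1/M]. Newton's identities for them have regular terms and
  specialize at t = 0 to those for h_k[1/(1 - q)].\<close>

lemma eval_e_theta_factor_t0: "eval_t0 (eval_e (theta_factor k)) = 1 / q_poch q_var k"
proof (rule newton_q_poch[OF q_var_ne_1])
  let ?c = "\<lambda>r. 1 / ((1 - qq ^ r) * (1 - tt ^ r))" and ?x = "\<lambda>k. eval_e (theta_factor k)"
  have N: "newton ?c ?x" by (rule newton_eval_e_scaling_esym)
  have x: "?x k \<in> regular0" for k by (rule eval_e_regular[OF theta_factor_lattice])
  show "newton (\<lambda>r. 1 / (1 - q_var ^ r)) (\<lambda>k. eval_t0 (?x k))"
  proof (rule newtonI)
    show "eval_t0 (?x 0) = 1" using newtonD(1)[OF N] by (simp add: eval_t0_1)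
    fix n
    have "(of_nat n :: ratfun_qt) \<in> regular0" "eval_t0 (of_nat n :: ratfun_qt) = of_nat n"
      using to_fract_regular[of "of_nat n"] eval_t0_to_fract[of "of_nat n"] by (simp_all add: to_fract_of_nat)
    then have "of_nat n * eval_t0 (?x n) = eval_t0 (of_nat n * ?x n)" using x by (simp add: eval_t0_hom(2))
    also have "of_nat n * ?x n = (\<Sum>r=1..n. ?c r * ?x (n - r))" by (rule newtonD(2)[OF N])
    also have "eval_t0 \<dots> = (\<Sum>r=1..n. eval_t0 (?c r * ?x (n - r)))"
      by (rule eval_t0_sum) (intro subring_setD(3)[OF subring0] x theta_scalar; simp)
    also have "\<dots> = (\<Sum>r=1..n. 1 / (1 - q_var ^ r) * eval_t0 (?x (n - r)))"
    proof (rule sum.cong[OF refl])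
      fix r assume "r \<in> {1..n}"
      then have "r > 0" by simp
      then show "eval_t0 (?c r * ?x (n - r)) = 1 / (1 - q_var ^ r) * eval_t0 (?x (n - r))"
        unfolding eval_t0_hom(2)[OF theta_scalar(1)[OF \<open>r > 0\<close>] x] by (simp only: theta_scalar(2))
    qed
    finally show "of_nat n * eval_t0 (?x n) = (\<Sum>r=1..n. 1 / (1 - q_var ^ r) * eval_t0 (?x (n - r)))" .
  qed
qed

text \<open>One row is maximal in the dominance order, so h_m receives no correction.\<close>

lemma eigenvector_row:
  assumes "m > 0"
  shows "eigenvector [m] = hsym m"
proof -
  have p: "is_partition [m]" using assms by (simp add: is_partition_def)
  have "\<not> below [m] \<nu>" for \<nu>
  proof
    assume b: "below [m] \<nu>"
    then have \<nu>: "is_partition \<nu>" "sum_list \<nu> = m" "m \<le> sum_list (take 1 \<nu>)" "\<nu> \<noteq> [m]"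
      unfolding below_def dominates_def by (auto dest: spec[of _ 1])
    then obtain x xs where "\<nu> = x # xs" using assms by (cases \<nu>) auto
    then show False using \<nu> by (cases xs) (auto simp: is_partition_def)
  qed
  then have "eigenvector [m] - hsym m \<in> rspan vanishing1 {}"
    using eigenvector(2)[OF p] by simp
  moreover have "x = 0" if "x \<in> rspan vanishing1 {}" for x
    using that unfolding rspan_def by induction auto
  ultimately show ?thesis by (metis eq_iff_diff_eq_0)
qed

text \<open>Normalization multiplies h_(m+1)[X/(1 - q)] by (q;q)_(m+1), and the inverse operator
  divides by (q;q)_m, leaving one factor.\<close>

lemma inverse_Pi_op_row:
  "inv_into UNIV Pi_op (macdonald_H [Suc m]) = scale_sf (1 - qq ^ Suc m) (divide_alphabet qq (hsym (Suc m)))"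
proof -
  have p: "is_partition [Suc m]" by (simp add: is_partition_def)
  have F: "eigenfunction [Suc m] = divide_alphabet qq (hsym (Suc m))" by (simp add: eigenvector_row)
  have P: "q_poch qq n \<noteq> 0" for n by (rule q_poch_nonzero) (rule qq_ne_1)
  have "eval_h (eigenfunction [Suc m]) = 1 / q_poch qq (Suc m)"
    unfolding F by (rule eval_h_divide_hsym) (rule qq_ne_1)
  then have H: "macdonald_H [Suc m] = scale_sf (q_poch qq (Suc m)) (eigenfunction [Suc m])"
    using macdonald_H_eigenfunction[OF p] by simp
  have "Pi_op (scale_sf (1 - qq ^ Suc m) (eigenfunction [Suc m])) = macdonald_H [Suc m]"
    unfolding Pi_op_scale Pi_op_eigenfunction[OF p] H Pi_coeff_row by (simp add: mult.commute)
  then have "inv_into UNIV Pi_op (macdonald_H [Suc m]) = scale_sf (1 - qq ^ Suc m) (eigenfunction [Suc m])"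
    using Pi_op_inv(2)[of "scale_sf (1 - qq ^ Suc m) (eigenfunction [Suc m])"] by (simp only:)
  then show ?thesis unfolding F .
qed

lemma not_homogeneous_0:
  fixes F :: "'a :: field_char_0 symfun"
  assumes "F \<in> rspan R (glist psym ` long_partitions (Suc n) 0)" "homogeneous_sf 0 F"
  shows "F = 0"
proof (rule symfun_eqI)
  fix m
  have "homogeneous_sf (Suc n) F" using assms(1) by (rule homogeneous_psym_span)
  then show "coeff_sf F m = coeff_sf 0 m" using assms(2) unfolding homogeneous_sf_def by (metis coeff_sf_simps(1) nat.distinct(1))
qed

text \<open>The inverse operator of the outer Theta cancels the operator of the inner one. Most of
  the work is to see that the branch for degree 0 does no harm.\<close>

lemma Theta_Theta_row:
  fixes k l m :: nat
  defines "B \<equiv> scale_sf (1 - qq ^ Suc m) (divide_alphabet qq (hsym (Suc m)))"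
  shows "Theta (esym k) (Theta (esym l) (macdonald_H [Suc m])) = Pi_op (theta_factor k * (theta_factor l * B))"
    and "theta_factor k * (theta_factor l * B) \<in> rspan regular0 (glist psym ` long_partitions (k + (l + Suc m)) 0)"
proof -
  have p: "[Suc m] \<in> long_partitions (Suc m) 0" by (simp add: long_partitions_def is_partition_def)
  have BL: "B \<in> rspan regular0 (glist psym ` long_partitions (Suc m) 0)"
    using eigenfunction_lattice[OF p] unfolding B_def eigenvector_row[OF zero_less_Suc]
    by (intro rspan_scale subring0 one_minus_qq_power_regular)
  have lB: "theta_factor l * B \<in> rspan regular0 (glist psym ` long_partitions (l + Suc m) 0)"
    using rspan_glist_mult[OF subring0 theta_factor_lattice BL] by simp
  show klB: "theta_factor k * (theta_factor l * B) \<in> rspan regular0 (glist psym ` long_partitions (k + (l + Suc m)) 0)"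
    using rspan_glist_mult[OF subring0 theta_factor_lattice lB] by simp
  have H: "\<not> homogeneous_sf 0 (macdonald_H [Suc m])"
  proof
    assume h: "homogeneous_sf 0 (macdonald_H [Suc m])"
    have HB: "macdonald_H [Suc m] = Pi_op B" unfolding B_def inverse_Pi_op_row[symmetric] by (rule Pi_op_inv(1)[symmetric])
    then have "macdonald_H [Suc m] = 0"
      using not_homogeneous_0[OF eval_e_Pi_op_t0(1)[OF BL]] h by simp
    then have "B = 0" using Pi_op_inv(2)[of B, folded HB] Pi_op_inv(2)[of 0] by (simp only: Pi_op_0)
    then have "divide_alphabet qq (hsym (Suc m)) = 0"
      using qq_ne_1[of "Suc m"] unfolding B_def sf.scale_eq_0_iff by auto
    then show False
      using eval_h_divide_hsym[OF qq_ne_1, of "Suc m"] q_poch_nonzero[OF qq_ne_1, of "Suc m"] by (simp add: eval_h_simps)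
  qed
  define X where "X = Theta (esym l) (macdonald_H [Suc m])"
  have X: "X = Pi_op (theta_factor l * B)"
    unfolding X_def Theta_def psym_scaling_eq inverse_Pi_op_row B_def using H by simp
  have XL: "X \<in> rspan regular0 (glist psym ` long_partitions (Suc (l + m)) 0)"
    unfolding X using eval_e_Pi_op_t0(1)[of "theta_factor l * B" "l + m"] lB by simp
  have inv: "inv_into UNIV Pi_op X = theta_factor l * B" unfolding X by (rule Pi_op_inv(2))
  show "Theta (esym k) (Theta (esym l) (macdonald_H [Suc m])) = Pi_op (theta_factor k * (theta_factor l * B))"
  \<comment> \<open>\<open>X\<close> lies in positive degree, so it can be homogeneous of degree 0
    only if it is zero, and then both sides vanish.\<close>
  proof (cases "homogeneous_sf 0 X")
    case True
    then have "X = 0" using not_homogeneous_0[OF XL] by simp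
    moreover from this have "theta_factor l * B = 0" using inv Pi_op_inv(2)[of 0] by (simp only: Pi_op_0)
    ultimately show ?thesis unfolding X_def[symmetric] Theta_def[of _ X] by (simp add: Pi_op_0 homogeneous_sf_def)
  next
    case False
    then show ?thesis unfolding X_def[symmetric] Theta_def[of _ X] psym_scaling_eq inv by simp
  qed
qed

text \<open>Pairing with e_n is \<open>eval_e\<close>. It commutes with t = 0, turns the operator
  into the factor (q;q)_(n-1), and is multiplicative on the remaining product.\<close>

lemma hall_SF_poch:
  "hall (SF (k + (l + Suc m)) k l) (esym (k + (l + Suc m)))
    = q_poch q_var (k + (l + m)) * (1 / q_poch q_var k) * (1 / q_poch q_var l) * (q_var ^ (Suc m choose 2) / q_poch q_var m)"
proof -
  let ?n = "k + (l + Suc m)" and ?B0 = "divide_alphabet qq (hsym (Suc m))"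
  let ?B = "scale_sf (1 - qq ^ Suc m) ?B0"
  let ?G = "theta_factor k * (theta_factor l * ?B)"
  have GL: "?G \<in> rspan regular0 (glist psym ` long_partitions (Suc (k + (l + m))) 0)"
    using Theta_Theta_row(2)[of k l m] by simp
  note PL = eval_e_Pi_op_t0[OF GL]
  note SL = eval_t0_sf_lattice[OF PL(1)]
  have "SF ?n k l = eval_t0_sf (Pi_op ?G)"
    unfolding SF_def using Theta_Theta_row(1)[of k l m] by simp
  moreover have "eval_t0_sf (Pi_op ?G) \<in> rspan UNIV (glist hsym ` long_partitions ?n 0)"
    using SL(1) by (simp add: rspan_psym_eq_hsym)
  ultimately have "hall (SF ?n k l) (esym ?n) = eval_e (eval_t0_sf (Pi_op ?G))"
    by (simp add: hall_esym)
  also have "\<dots> = q_poch q_var (k + (l + m)) * eval_t0 (eval_e ?G)" unfolding SL(2) PL(2) ..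
  also have "eval_t0 (eval_e ?G) = (1 / q_poch q_var k) * (1 / q_poch q_var l) * (q_var ^ (Suc m choose 2) / q_poch q_var m)"
  proof -
    have P: "q_poch q_var n \<noteq> 0" for n by (rule q_poch_nonzero) (rule q_var_ne_1)
    have "eval_e ?B = (1 - qq ^ Suc m) * (qq ^ (Suc m choose 2) / q_poch qq (Suc m))"
      by (simp only: eval_e_simps eval_e_divide_hsym[OF qq_ne_1])
    also have "\<dots> = const_t ((1 - q_var ^ Suc m) * (q_var ^ (Suc m choose 2) / q_poch q_var (Suc m)))"
      by (simp only: q_poch_qq qq_power const_t_mult const_t_diff const_t_1 const_t_divide[OF P])
    \<comment> \<open>The factor 1 - q^(m+1) cancels the last factor of (q;q)_(m+1).\<close>
    finally have B: "eval_e ?B = const_t (q_var ^ (Suc m choose 2) / q_poch q_var m)"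
      using q_var_ne_1[of "Suc m"] P[of m] by (simp add: field_simps)
    have E: "eval_e (theta_factor k) \<in> regular0" for k by (rule eval_e_regular[OF theta_factor_lattice])
    have "eval_t0 (eval_e ?G) = eval_t0 (eval_e (theta_factor k) * (eval_e (theta_factor l) * const_t (q_var ^ (Suc m choose 2) / q_poch q_var m)))"
      by (simp only: eval_e_simps(4) B)
    also have "\<dots> = eval_t0 (eval_e (theta_factor k)) * (eval_t0 (eval_e (theta_factor l)) * (q_var ^ (Suc m choose 2) / q_poch q_var m))"
      by (simp only: eval_t0_hom(2) E to_fract_regular subring_setD(3)[OF subring0] eval_t0_const_t)
    finally show ?thesis by (simp only: eval_e_theta_factor_t0 mult.assoc)
  qed
  finally show ?thesis by (simp only: mult.assoc)
qed

lemma q_poch_q_fact: "q_poch q n = (1 - q) ^ n * q_fact q n"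
proof (induction n)
  case (Suc n)
  have "q_poch q (Suc n) = (1 - q) ^ n * q_fact q n * ((1 - q) * (\<Sum>i<Suc n. q ^ i))"
    by (simp only: q_poch_simps Suc one_diff_power_eq)
  also have "\<dots> = (1 - q) ^ Suc n * (q_fact q n * (\<Sum>i<Suc n. q ^ i))" by (simp only: power_Suc mult_ac)
  also have "q_fact q n * (\<Sum>i<Suc n. q ^ i) = q_fact q (Suc n)" by (simp only: q_fact_def prod.nat_ivl_Suc' mult.commute)
  finally show ?case .
qed (simp add: q_fact_def)

text \<open>The powers of 1 - q that relate (q;q)_n to the q-factorial cancel in the
  quotient.\<close>

lemma q_binomial_poch:
  assumes "k \<le> n" "q \<noteq> 1"
  shows "q_binomial q n k = q_poch q n / (q_poch q k * q_poch q (n - k))"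
proof -
  have "(1 - q) ^ n = (1 - q) ^ k * (1 - q) ^ (n - k)" using assms(1) by (simp flip: power_add)
  then show ?thesis using assms by (simp add: q_binomial_def q_poch_q_fact)
qed

theorem theorem5p6:
  fixes n k l :: nat
  assumes "n \<ge> 1" and "k + l < n"
  shows "hall (SF n k l) (esym n) =
    q_var ^ ((n - k - l) choose 2) * q_binomial q_var (n - 1) (k + l) * q_binomial q_var (k + l) k"
proof -
  define m where "m = n - k - l - 1"
  have n: "n = k + (l + Suc m)" using assms(2) by (simp add: m_def)
  have P: "q_poch q_var n \<noteq> 0" for n by (rule q_poch_nonzero) (rule q_var_ne_1)
  have "q_var \<noteq> 1" using q_var_ne_1[of 1] by simp
  then have "q_binomial q_var (n - 1) (k + l) = q_poch q_var (k + (l + m)) / (q_poch q_var (k + l) * q_poch q_var m)"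
    "q_binomial q_var (k + l) k = q_poch q_var (k + l) / (q_poch q_var k * q_poch q_var l)"
    using q_binomial_poch[of "k + l" "n - 1" q_var] q_binomial_poch[of k "k + l" q_var] by (simp_all add: n add.assoc)
  moreover have "n - k - l = Suc m" by (simp add: n)
  moreover note hall_SF_poch[of k l m, folded n]
  \<comment> \<open>The symbol (q;q)_(k+l) cancels between the two binomials.\<close>
  ultimately show ?thesis
    using P[of "k + l"] P[of k] P[of l] P[of m] by (simp only:) (simp add: field_simps del: binomial_Suc_Suc)
qed

end
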